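(* For any $\beta>0$ and $k\in\mathbb N$ with $k\ge\beta$, the measure $m^\beta_k$ on $\mathbb R^k$ is absolutely continuous. Its density is strictly positive and continuous on the simplex $\Sigma_k:=\{(x_1,\dots,x_k):0<x_1<\dots<x_k<1\}$ and vanishes on $\mathbb R^k\setminus\Sigma_k$. For $x\in\Sigma_k$ it is given by $$\rho^\beta_k(x_1,\dots,x_k)=\frac{\Gamma(\beta)}{\Gamma(\beta/k)^k}\int_{x_{k-1}}^{x_k}\!\!\cdots\int_{x_1}^{x_2}\prod_{i=1}^k\Big[\vartheta_{\beta/k}\Big(\frac{x_i-y_{i-1}}{y_i-y_{i-1}}\Big)(y_i-y_{i-1})^{\beta/k-2}\Big]dy_1\cdots dy_{k-1},$$ where $y_0:=0$, $y_k:=1$.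
   Context: $\mathcal G$ is the set of right continuous nondecreasing $g:[0,1]\to[0,1]$ with $g(1)=1$. $\mathbb Q^\beta$ is the Dirichlet–Ferguson process on $\mathcal G$: the unique probability measure such that for all $0=t_0<t_1<\dots<t_n=1$ (with $x_0=0,x_n=1$) $\mathbb Q^\beta(g_{t_1}\in dx_1,\dots,g_{t_{n-1}}\in dx_{n-1})=\frac{\Gamma(\beta)}{\prod_{i=1}^n\Gamma(\beta(t_i-t_{i-1}))}\prod_{i=1}^n(x_i-x_{i-1})^{\beta(t_i-t_{i-1})-1}dx_1\dots dx_{n-1}$. For $i=1,\dots,k$ let $\Phi^{(i)}_k(t)=1$ on $[0,\frac{i-1}k]$, $=i-kt$ on $[\frac{i-1}k,\frac ik]$, $=0$ on $[\frac ik,1]$, so that $\int_0^1\Phi^{(i)}_kdg=k\int_{(i-1)/k}^{i/k}g(t)\,dt$. $m^\beta_k$ is the distribution under $\mathbb Q^\beta$ of $\hat{\mathcal J}_k(g)=(\int_0^1\Phi^{(1)}_kdg,\dots,\int_0^1\Phi^{(k)}_kdg)$. For $\alpha\in(0,1]$, $\vartheta_\alpha(z)=\alpha e^\alpha\int_0^z(z-y)^{\alpha-1}y^{-\alpha y}(1-y)^{-\alpha(1-y)}[\cos(\pi\alpha y)-\frac1\pi\sin(\pi\alpha y)\log\frac y{1-y}]dy$ for $z\in[0,1]$. *)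

theory Defs
  imports "HOL-Probability.Probability"
begin

text \<open>The path space G. A right continuous nondecreasing g on [0,1] with values
in [0,1] and g 1 = 1 is encoded by its canonical extension to the real line:
g t = 0 for t < 0 and g t = 1 for t \<ge> 1 (a distribution function).\<close>
definition G_space :: "(real \<Rightarrow> real) set" where
  "G_space = {g. mono g \<and> (\<forall>t. continuous (at_right t) g)
                  \<and> (\<forall>t<0. g t = 0) \<and> (\<forall>t\<ge>1. g t = 1)}"

definition G_measurable :: "(real \<Rightarrow> real) measure" where
  "G_measurable = restrict_space (PiM UNIV (\<lambda>_::real. (borel :: real measure))) G_space"

definition leb :: "nat \<Rightarrow> (nat \<Rightarrow> real) measure" where
  "leb m = PiM {1..m} (\<lambda>_. lborel)"

definition dir_fdd_density :: "real \<Rightarrow> nat \<Rightarrow> (nat \<Rightarrow> real) \<Rightarrow> (nat \<Rightarrow> real) \<Rightarrow> real" where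
  "dir_fdd_density \<beta> n t x =
     (let X = (\<lambda>i. if i = 0 then 0 else if i = n then 1 else x i) in
      if (\<forall>i\<in>{1..n}. X (i - 1) < X i)
      then Gamma \<beta> / (\<Prod>i\<in>{1..n}. Gamma (\<beta> * (t i - t (i - 1))))
           * (\<Prod>i\<in>{1..n}. (X i - X (i - 1)) powr (\<beta> * (t i - t (i - 1)) - 1))
      else 0)"

definition is_dirichlet_ferguson :: "real \<Rightarrow> (real \<Rightarrow> real) measure \<Rightarrow> bool" where
  "is_dirichlet_ferguson \<beta> Q \<longleftrightarrow>
     prob_space Q \<and> sets Q = sets G_measurable \<and>
     (\<forall>n::nat. \<forall>t::nat \<Rightarrow> real. n \<ge> 1 \<longrightarrow> t 0 = 0 \<longrightarrow> t n = 1 \<longrightarrow>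
        (\<forall>i<n. t i < t (Suc i)) \<longrightarrow>
        distr Q (leb (n - 1)) (\<lambda>g. \<lambda>i\<in>{1..n-1}. g (t i))
          = density (leb (n - 1)) (\<lambda>x. ennreal (dir_fdd_density \<beta> n t x)))"

text \<open>The functional hat J_k, using int_0^1 Phi^(i)_k dg = k int_{(i-1)/k}^{i/k} g(t) dt.\<close>
definition hatJ :: "nat \<Rightarrow> (real \<Rightarrow> real) \<Rightarrow> (nat \<Rightarrow> real)" where
  "hatJ k g = (\<lambda>i\<in>{1..k}. real k * (LBINT t=(real i - 1) / real k..real i / real k. g t))"

definition m_beta :: "(real \<Rightarrow> real) measure \<Rightarrow> nat \<Rightarrow> (nat \<Rightarrow> real) measure" where
  "m_beta Q k = distr Q (leb k) (hatJ k)"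

definition vartheta :: "real \<Rightarrow> real \<Rightarrow> real" where
  "vartheta \<alpha> z = \<alpha> * exp \<alpha> *
     (LBINT y=0..z. (z - y) powr (\<alpha> - 1) * y powr (- \<alpha> * y) * (1 - y) powr (- \<alpha> * (1 - y))
        * (cos (pi * \<alpha> * y) - 1 / pi * sin (pi * \<alpha> * y) * ln (y / (1 - y))))"

definition Sigma_k :: "nat \<Rightarrow> (nat \<Rightarrow> real) set" where
  "Sigma_k k = {x \<in> space (leb k). 0 < x 1 \<and> x k < 1 \<and> (\<forall>i\<in>{1..<k}. x i < x (i + 1))}"

definition rho_formula :: "real \<Rightarrow> nat \<Rightarrow> (nat \<Rightarrow> real) \<Rightarrow> real" where
  "rho_formula \<beta> k x =
     Gamma \<beta> / Gamma (\<beta> / real k) ^ k *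
     set_lebesgue_integral (leb (k - 1))
       {y \<in> space (leb (k - 1)). \<forall>i\<in>{1..k-1}. x i < y i \<and> y i < x (i + 1)}
       (\<lambda>y. let Y = (\<lambda>i. if i = 0 then 0 else if i = k then 1 else y i) in
          \<Prod>i\<in>{1..k}. vartheta (\<beta> / real k) ((x i - Y (i - 1)) / (Y i - Y (i - 1)))
                        * (Y i - Y (i - 1)) powr (\<beta> / real k - 2))"

end

theory Submission
  imports Defs "HOL-Complex_Analysis.Complex_Analysis" "HOL-Real_Asymp.Real_Asymp"
begin

text \<open>A measure on \<open>[0, 1]\<^sup>k\<close> is determined by its generalised Stieltjes transform
  \<open>\<lambda> \<mapsto> \<integral> (1 + \<lambda> \<bullet> x) powr (- \<beta>)\<close>: the binomial series in \<open>\<lambda>\<close> recovers the moments of linear forms, hence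
  the integrals of exponentials, to which Stone-Weierstrass applies. So it suffices to match transforms.

  For a Dirichlet vector \<open>D\<close> with parameters \<open>a\<^sub>i\<close> of sum \<open>\<beta>\<close>, the Markov-Krein identity
  \<open>E (c \<bullet> D) powr (- \<beta>) = \<Prod> c\<^sub>i powr (- a\<^sub>i)\<close> holds (mix with an independent Gamma variable). Applied to Riemann sums,
  it gives the transform of \<open>m_beta\<close> as \<open>exp (- \<beta> \<integral> ln (1 + \<lambda> \<bullet> \<Phi>))\<close>, which factorises over the \<open>k\<close> blocks.
  The claimed density is that of \<open>x\<^sub>i = y\<^sub>i\<^sub>-\<^sub>1 + (y\<^sub>i - y\<^sub>i\<^sub>-\<^sub>1) z\<^sub>i\<close> with \<open>y\<close> the nodes of a symmetric Dirichlet vector and \<open>z\<^sub>i\<close>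
  independent of density \<open>vartheta \<alpha>\<close>, \<open>\<alpha> = \<beta> / k\<close>; integrating out \<open>y\<close> by the same identity reduces the claim to
  \<open>\<integral> (A + s z) powr (- \<alpha>) * vartheta \<alpha> z = exp (- \<alpha> \<integral> ln (A + s t))\<close> over the unit interval. This is a residue computation
  for a function on the plane slit along \<open>[0, 1]\<close> (the formula of Cifarelli and Regazzini for the mean of a
  Dirichlet process).

  Positivity of \<open>vartheta \<alpha>\<close> is not visible from its definition; it follows from its invariance under a strictly
  positive Markov kernel (Sethuraman's stick breaking), which again is an identity of transforms.\<close>

section \<open>Dirichlet distributions\<close>

text \<open>The transform works because its exponent is minus the total mass of the Dirichlet law:
  only then does the Gamma mixture factorise. For the claimed density the exponent
  \<open>\<beta> = k * \<alpha>\<close> thus splits into one exponent \<alpha> per block, the one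
  for which \<open>vartheta \<alpha>\<close> has a closed transform. Coefficients are kept
  nonnegative so that \<open>1 + \<lambda> \<bullet> x\<close> stays positive on the cube; hence the
  test functions are exponentials with nonnegative coefficients, and the power series argument is
  one-sided.

  The sign of \<open>vartheta \<alpha>\<close> is needed before the density can be handled, since
  its transform is computed with nonnegative integrals and Tonelli; it cannot be read off from the
  final identity. Stick breaking combines a parameter 1 with a parameter \<alpha>, so its natural
  exponent is \<open>\<alpha> + 1\<close>, which is why the transform of
  \<open>vartheta \<alpha>\<close> is also differentiated. The hypothesis
  \<open>\<beta> \<le> k\<close> means \<open>\<alpha> \<le> 1\<close>; it keeps
  \<open>sin (pi * \<alpha> * y)\<close> nonnegative on the unit interval, which gives monotone
  convergence in the contour limit.\<close>

interpretation lb: product_sigma_finite "\<lambda>_::nat. lborel :: real measure" ..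

lemma sets_leb: "sets (leb m) = sets (PiM {1..m} (\<lambda>_. borel))"
  unfolding leb_def by (intro sets_PiM_cong) auto

lemma measurable_leb_cong [simp]: "measurable (leb m) N = measurable (PiM {1..m} (\<lambda>_. borel)) N"
  by (intro measurable_cong_sets sets_leb refl)

section \<open>Changes of variables on finite products of Lebesgue measure\<close>

lemma nn_integral_PiM_affine:
  assumes "finite I" "\<And>i. i \<in> I \<Longrightarrow> c i > 0"
    and "f \<in> borel_measurable (PiM I (\<lambda>_. lborel :: real measure))"
  shows "(\<integral>\<^sup>+x. f x \<partial>PiM I (\<lambda>_. lborel)) =
     ennreal (\<Prod>i\<in>I. c i) * (\<integral>\<^sup>+x. f (\<lambda>i\<in>I. t i + c i * x i) \<partial>PiM I (\<lambda>_::nat. lborel))"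
  using assms
proof (induction I arbitrary: f rule: finite_induct)
  case empty
  then show ?case by (simp add: PiM_empty nn_integral_count_space_finite)
next
  case (insert j I)
  note [measurable] = insert.prems(2)
  have cj: "c j > 0" using insert.prems by auto
  have cp: "(\<Prod>i\<in>I. c i) > 0" using insert.prems by (intro prod_pos) auto
  have m: "(\<lambda>x. f (\<lambda>i\<in>insert j I. t i + c i * x i)) \<in> borel_measurable (PiM (insert j I) (\<lambda>_. lborel))"
    by measurable
  have upd: "(\<lambda>i\<in>insert j I. t i + c i * (x(j := y)) i) = (\<lambda>i\<in>I. t i + c i * x i)(j := t j + c j * y)" for x y
    using insert.hyps by (auto simp: fun_eq_iff)
  have mm: "(\<lambda>(x,y). f (x(j:=y))) \<in> borel_measurable (PiM I (\<lambda>_. lborel) \<Otimes>\<^sub>M lborel)"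
    by measurable
  have mI: "(\<lambda>x. \<integral>\<^sup>+y. f (x(j := y)) \<partial>lborel) \<in> borel_measurable (PiM I (\<lambda>_. lborel))"
    using lborel.borel_measurable_nn_integral[OF mm] by simp
  have m3: "(\<lambda>(x,y). f ((\<lambda>i\<in>I. t i + c i * x i)(j := t j + c j * y))) \<in> borel_measurable (PiM I (\<lambda>_. lborel) \<Otimes>\<^sub>M lborel)"
    by measurable
  have mI3: "(\<lambda>x. \<integral>\<^sup>+y. f ((\<lambda>i\<in>I. t i + c i * x i)(j := t j + c j * y)) \<partial>lborel) \<in> borel_measurable (PiM I (\<lambda>_. lborel))"
    using lborel.borel_measurable_nn_integral[OF m3] by simp
  have m2: "(\<lambda>y. f (x(j := y))) \<in> borel_measurable lborel" if "x \<in> space (PiM I (\<lambda>_. lborel))" for x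
    using that by measurable
  have "(\<integral>\<^sup>+x. f x \<partial>PiM (insert j I) (\<lambda>_. lborel)) =
     (\<integral>\<^sup>+x. (\<integral>\<^sup>+y. f (x(j := y)) \<partial>lborel) \<partial>PiM I (\<lambda>_. lborel))"
    by (rule lb.product_nn_integral_insert) (use insert in auto)
  also have "\<dots> = ennreal (\<Prod>i\<in>I. c i) *
     (\<integral>\<^sup>+x. (\<integral>\<^sup>+y. f ((\<lambda>i\<in>I. t i + c i * x i)(j := y)) \<partial>lborel) \<partial>PiM I (\<lambda>_. lborel))"
    by (rule insert.IH[OF _ mI]) (use insert.prems in auto)
  also have "\<dots> = ennreal (\<Prod>i\<in>I. c i) *
     (\<integral>\<^sup>+x. ennreal (c j) * (\<integral>\<^sup>+y. f ((\<lambda>i\<in>I. t i + c i * x i)(j := t j + c j * y)) \<partial>lborel) \<partial>PiM I (\<lambda>_. lborel))"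
  proof (intro arg_cong2[where f="(*)"] nn_integral_cong refl)
    fix x assume x: "x \<in> space (PiM I (\<lambda>_. lborel :: real measure))"
    let ?x = "\<lambda>i\<in>I. t i + c i * x i"
    have "?x \<in> space (PiM I (\<lambda>_. lborel :: real measure))" by (auto simp: space_PiM)
    from m2[OF this] have "(\<lambda>y. f (?x(j := y))) \<in> borel_measurable borel" by simp
    from nn_integral_real_affine[OF this, of "c j" "t j"] cj
    show "(\<integral>\<^sup>+y. f (?x(j := y)) \<partial>lborel) =
       ennreal (c j) * (\<integral>\<^sup>+y. f (?x(j := t j + c j * y)) \<partial>lborel)" by simp
  qed
  also have "\<dots> = ennreal (\<Prod>i\<in>insert j I. c i) *
     (\<integral>\<^sup>+x. (\<integral>\<^sup>+y. f ((\<lambda>i\<in>I. t i + c i * x i)(j := t j + c j * y)) \<partial>lborel) \<partial>PiM I (\<lambda>_. lborel))"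
    using insert.hyps cj cp
    by (subst nn_integral_cmult[OF mI3]) (simp add: mult.assoc[symmetric] ennreal_mult' mult.commute)
  also have "\<dots> = ennreal (\<Prod>i\<in>insert j I. c i) *
     (\<integral>\<^sup>+x. f (\<lambda>i\<in>insert j I. t i + c i * x i) \<partial>PiM (insert j I) (\<lambda>_. lborel))"
    by (subst lb.product_nn_integral_insert[OF insert.hyps m]) (simp only: upd)
  finally show ?case .
qed

lemma nn_integral_leb_affine:
  assumes "\<And>i. i \<in> {1..m} \<Longrightarrow> c i > 0" and "f \<in> borel_measurable (leb m)"
  shows "(\<integral>\<^sup>+x. f x \<partial>leb m) =
     ennreal (\<Prod>i=1..m. c i) * (\<integral>\<^sup>+x. f (\<lambda>i\<in>{1..m}. t i + c i * x i) \<partial>leb m)"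
  using nn_integral_PiM_affine[of "{1..m}" c f t] assms unfolding leb_def by auto

lemma nn_integral_leb_Suc:
  assumes "f \<in> borel_measurable (leb (Suc m))"
  shows "(\<integral>\<^sup>+x. f x \<partial>leb (Suc m)) = (\<integral>\<^sup>+x. (\<integral>\<^sup>+y. f (x(Suc m := y)) \<partial>lborel) \<partial>leb m)"
proof -
  have eq: "{1..Suc m} = insert (Suc m) {1..m}" by auto
  show ?thesis using assms unfolding leb_def eq
    by (intro lb.product_nn_integral_insert) auto
qed

lemma nn_integral_leb_Suc_rev:
  assumes "f \<in> borel_measurable (leb (Suc m))"
  shows "(\<integral>\<^sup>+x. f x \<partial>leb (Suc m)) = (\<integral>\<^sup>+y. (\<integral>\<^sup>+x. f (x(Suc m := y)) \<partial>leb m) \<partial>lborel)"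
proof -
  have eq: "{1..Suc m} = insert (Suc m) {1..m}" by auto
  show ?thesis using assms unfolding leb_def eq
    by (intro lb.product_nn_integral_insert_rev) auto
qed

lemma increment_measurable:
  fixes h :: "nat \<Rightarrow> real \<Rightarrow> ennreal"
  assumes "\<And>i. h i \<in> borel_measurable borel"
  shows "(\<lambda>z. \<Prod>i=1..m. h i (z i - (if i = 1 then 0 else z (i - 1)))) \<in> borel_measurable (PiM {1..m} (\<lambda>_. borel))"
proof (rule borel_measurable_prod_ennreal)
  fix i assume i: "i \<in> {1..m}"
  have "(\<lambda>z. z i - (if i = 1 then 0 else z (i - 1)) :: real) \<in> borel_measurable (PiM {1..m} (\<lambda>_. borel))"
  proof (cases "i = 1")
    case False
    then have i': "i - 1 \<in> {1..m}" using i by auto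
    have "(\<lambda>z. z i - z (i - 1) :: real) \<in> borel_measurable (PiM {1..m} (\<lambda>_. borel))"
      by (rule borel_measurable_diff[OF measurable_component_singleton[OF i] measurable_component_singleton[OF i']])
    then show ?thesis using False by simp
  qed (use i in simp)
  from measurable_compose[OF this assms]
  show "(\<lambda>z. h i (z i - (if i = 1 then 0 else z (i - 1)))) \<in> borel_measurable (PiM {1..m} (\<lambda>_. borel))" .
qed

text \<open>The last variable occurs only in the last factor, and translation invariance removes
  \<open>z (i - 1)\<close> from it; peeling off one coordinate at a time decouples the
  increments.\<close>

lemma nn_integral_leb_increments:
  fixes h :: "nat \<Rightarrow> real \<Rightarrow> ennreal"
  assumes [measurable]: "\<And>i. h i \<in> borel_measurable borel"
  shows "(\<integral>\<^sup>+z. (\<Prod>i=1..m. h i (z i - (if i = 1 then 0 else z (i - 1)))) \<partial>leb m) =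
     (\<Prod>i=1..m. \<integral>\<^sup>+u. h i u \<partial>lborel)"
proof (induction m)
  case 0
  then show ?case by (simp add: leb_def PiM_empty nn_integral_count_space_finite)
next
  case (Suc m)
  let ?g = "\<lambda>z i. h i (z i - (if i = 1 then 0 else z (i - 1)))"
  have "(\<integral>\<^sup>+z. (\<Prod>i=1..Suc m. ?g z i) \<partial>leb (Suc m)) =
     (\<integral>\<^sup>+x. (\<integral>\<^sup>+y. (\<Prod>i=1..Suc m. ?g (x(Suc m := y)) i) \<partial>lborel) \<partial>leb m)"
    by (rule nn_integral_leb_Suc) (simp only: measurable_leb_cong increment_measurable assms)
  also have "\<dots> = (\<integral>\<^sup>+x. (\<Prod>i=1..m. ?g x i) * (\<integral>\<^sup>+u. h (Suc m) u \<partial>lborel) \<partial>leb m)"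
  proof (intro nn_integral_cong)
    fix x
    have "(\<integral>\<^sup>+y. (\<Prod>i=1..Suc m. ?g (x(Suc m := y)) i) \<partial>lborel) =
      (\<integral>\<^sup>+y. (\<Prod>i=1..m. ?g x i) * h (Suc m) (y - (if m = 0 then 0 else x m)) \<partial>lborel)"
      by (intro nn_integral_cong) (auto intro!: arg_cong2[where f="(*)"] prod.cong)
    also have "\<dots> = (\<Prod>i=1..m. ?g x i) * (\<integral>\<^sup>+y. h (Suc m) (y - (if m = 0 then 0 else x m)) \<partial>lborel)"
      by (rule nn_integral_cmult) measurable
    also have "(\<integral>\<^sup>+y. h (Suc m) (y - (if m = 0 then 0 else x m)) \<partial>lborel) = (\<integral>\<^sup>+u. h (Suc m) u \<partial>lborel)"
      using nn_integral_real_affine[of "h (Suc m)" 1 "- (if m = 0 then 0 else x m)"] by simp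
    finally show "(\<integral>\<^sup>+y. (\<Prod>i=1..Suc m. ?g (x(Suc m := y)) i) \<partial>lborel) =
      (\<Prod>i=1..m. ?g x i) * (\<integral>\<^sup>+u. h (Suc m) u \<partial>lborel)" .
  qed
  also have "\<dots> = (\<integral>\<^sup>+x. (\<Prod>i=1..m. ?g x i) \<partial>leb m) * (\<integral>\<^sup>+u. h (Suc m) u \<partial>lborel)"
    by (rule nn_integral_multc) (simp only: measurable_leb_cong increment_measurable assms)
  also have "\<dots> = (\<Prod>i=1..Suc m. \<integral>\<^sup>+u. h i u \<partial>lborel)" unfolding Suc.IH by simp
  finally show ?case .
qed

lemma nn_integral_gamma_kernel:
  fixes a c :: real
  assumes "a > 0" "c > 0"
  shows "(\<integral>\<^sup>+u. ennreal (indicator {0<..} u * (u powr (a - 1) * exp (- c * u))) \<partial>lborel) =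
    ennreal (Gamma a * c powr (- a))"
proof -
  let ?f = "\<lambda>u. ennreal (indicator {0<..} u * (u powr (a - 1) * exp (- c * u)))"
  have "ennreal (Gamma a) = (\<integral>\<^sup>+t. ennreal (indicator {0..} t * t powr (a - 1) / exp t) \<partial>lborel)"
    by (rule Gamma_conv_nn_integral_real) fact
  also have "\<dots> = ennreal c * (\<integral>\<^sup>+t. ennreal (indicator {0..} (c * t) * (c * t) powr (a - 1) / exp (c * t)) \<partial>lborel)"
    using assms by (subst nn_integral_real_affine[where c=c and t=0]) auto
  also have "(\<integral>\<^sup>+t. ennreal (indicator {0..} (c * t) * (c * t) powr (a - 1) / exp (c * t)) \<partial>lborel) =
     (\<integral>\<^sup>+t. ennreal (c powr (a - 1)) * ?f t \<partial>lborel)"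
  proof (intro nn_integral_cong_AE AE_I[where N="{0::real}"] subsetI)
    fix t assume "t \<in> {t \<in> space lborel. ennreal (indicator {0..} (c * t) * (c * t) powr (a - 1) / exp (c * t))
       \<noteq> ennreal (c powr (a - 1)) * ?f t}"
    then show "t \<in> {0}" using assms
      by (cases "t > 0") (auto simp: ennreal_mult[symmetric] powr_mult indicator_def zero_le_mult_iff exp_minus divide_inverse)
  qed auto
  also have "\<dots> = ennreal (c powr (a - 1)) * (\<integral>\<^sup>+t. ?f t \<partial>lborel)"
    by (rule nn_integral_cmult) measurable
  finally have eq: "ennreal (Gamma a) = ennreal (c * c powr (a - 1)) * (\<integral>\<^sup>+t. ?f t \<partial>lborel)"
    using assms by (simp add: ennreal_mult mult.assoc)
  also have "c * c powr (a - 1) = c powr a"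
    using assms by (simp add: powr_diff)
  finally have "ennreal (c powr (- a)) * ennreal (Gamma a) =
     ennreal (c powr (- a) * c powr a) * (\<integral>\<^sup>+t. ?f t \<partial>lborel)"
    by (simp add: ennreal_mult mult.assoc)
  then show ?thesis using assms
    by (simp add: powr_minus ennreal_mult[symmetric] mult.commute Gamma_real_pos less_imp_le)
qed

section \<open>Nodes, increments and the Markov-Krein identity\<close>

definition node :: "nat \<Rightarrow> (nat \<Rightarrow> real) \<Rightarrow> nat \<Rightarrow> real" where
  "node n y i = (if i = 0 then 0 else if i = n then 1 else y i)"

definition incr :: "nat \<Rightarrow> (nat \<Rightarrow> real) \<Rightarrow> nat \<Rightarrow> real" where
  "incr n y i = node n y i - node n y (i - 1)"

lemma sum_incr: "n \<ge> 1 \<Longrightarrow> (\<Sum>i=1..n. incr n y i) = 1"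
  using sum_telescope''[of 0 n "node n y"] by (simp add: incr_def node_def)

lemma node_measurable:
  "i \<le> n \<Longrightarrow> (\<lambda>y. node n y i) \<in> borel_measurable (PiM {1..n-1} (\<lambda>_. borel))"
proof -
  assume "i \<le> n"
  then consider "i = 0" | "i = n" | "i \<in> {1..n-1}" by fastforce
  then show ?thesis
  proof cases
    case 2
    then have "(\<lambda>y. node n y i) = (\<lambda>_. if n = 0 then 0 else 1)" by (auto simp: node_def fun_eq_iff)
    then show ?thesis by simp
  next
    case 3
    then have "(\<lambda>y. node n y i) = (\<lambda>y. y i)" by (auto simp: node_def fun_eq_iff)
    then show ?thesis using 3 by simp
  qed (simp add: node_def)
qed

lemma incr_measurable:
  "i \<in> {1..n} \<Longrightarrow> (\<lambda>y. incr n y i) \<in> borel_measurable (PiM {1..n-1} (\<lambda>_. borel))"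
  unfolding incr_def by (intro borel_measurable_diff node_measurable) auto

text \<open>A density for the partial sums of the weights, which are the inner nodes, rather than
  for the weights themselves. The indicator confines it to increasing nodes.\<close>

definition dirichlet_density :: "nat \<Rightarrow> (nat \<Rightarrow> real) \<Rightarrow> (nat \<Rightarrow> real) \<Rightarrow> real" where
  "dirichlet_density n a y = Gamma (\<Sum>i=1..n. a i) / (\<Prod>i=1..n. Gamma (a i)) *
     (\<Prod>i=1..n. indicator {0<..} (incr n y i) * incr n y i powr (a i - 1))"

lemma sigma_finite_leb: "sigma_finite_measure (leb m)"
  unfolding leb_def by (rule lb.sigma_finite) simp

text \<open>Write the product of the Gamma integrals of shape \<open>a i\<close> and rate
  \<open>c i\<close> as one integral over the increments of \<open>z\<close>. With the total
  \<open>s = z n\<close> split off and the other coordinates rescaled by \<open>s\<close>, the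
  integrand becomes the Dirichlet density times a Gamma kernel in \<open>s\<close> of shape
  \<open>b\<close> and rate \<open>C y\<close>, and integrating out \<open>s\<close> gives the
  factor \<open>C y powr - b\<close>.\<close>

lemma dirichlet_markov_krein:
  assumes n: "n \<ge> 1" and a: "\<And>i. i \<in> {1..n} \<Longrightarrow> a i > 0" and c: "\<And>i. i \<in> {1..n} \<Longrightarrow> c i > 0"
  shows "(\<integral>\<^sup>+y. ennreal (dirichlet_density n a y *
            (\<Sum>i=1..n. c i * incr n y i) powr (- (\<Sum>i=1..n. a i))) \<partial>leb (n - 1)) =
         ennreal (\<Prod>i=1..n. c i powr (- a i))"
proof -
  obtain m where m: "n = Suc m" using n by (cases n) auto
  define b where "b = (\<Sum>i=1..n. a i)"
  have b: "b > 0" unfolding b_def using n a by (intro sum_pos) auto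
  define K where "K = (\<Prod>i=1..n. Gamma (a i))"
  have K: "K > 0" unfolding K_def using a by (intro prod_pos) (auto intro: Gamma_real_pos)
  define h where "h = (\<lambda>i u. ennreal (indicator {0<..} u * (u powr (a i - 1) * exp (- c i * u))))"
  have hm[measurable]: "h i \<in> borel_measurable borel" for i unfolding h_def by measurable
  define D where "D = (\<lambda>y. \<Prod>i=1..n. indicator {0<..} (incr n y i) * incr n y i powr (a i - 1))"
  define C where "C = (\<lambda>y. \<Sum>i=1..n. c i * incr n y i)"
  have dd: "dirichlet_density n a y = Gamma b / K * D y" for y
    by (simp add: dirichlet_density_def D_def K_def b_def)
  have D0: "D y \<ge> 0" for y unfolding D_def by (intro prod_nonneg) auto
  have Dpos: "D y \<noteq> 0 \<Longrightarrow> i \<in> {1..n} \<Longrightarrow> incr n y i > 0" for y i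
    unfolding D_def by (auto simp: indicator_def split: if_splits)
  have Cpos: "C y > 0" if "D y \<noteq> 0" for y
    unfolding C_def using n c Dpos[OF that] by (intro sum_pos) auto
  have Dm: "D \<in> borel_measurable (leb m)"
    unfolding D_def m measurable_leb_cong by (intro borel_measurable_prod borel_measurable_times powr_real_measurable
        measurable_compose[OF incr_measurable[of _ n, unfolded m diff_Suc_1] borel_measurable_indicator]
        incr_measurable[of _ n, unfolded m diff_Suc_1] borel_measurable_const) auto
  have Cm: "C \<in> borel_measurable (leb m)"
    unfolding C_def m measurable_leb_cong by (intro borel_measurable_sum borel_measurable_times
        incr_measurable[of _ n, unfolded m diff_Suc_1] borel_measurable_const)
  have eqI: "{1..n} = insert n {1..m}" using m by auto
  interpret P: pair_sigma_finite lborel "leb m"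
    by (intro pair_sigma_finite.intro sigma_finite_leb lborel.sigma_finite_measure_axioms)
  have gm: "(\<lambda>z. \<Prod>i=1..n. h i (z i - (if i = 1 then 0 else z (i - 1)))) \<in> borel_measurable (leb n)"
    unfolding measurable_leb_cong by (rule increment_measurable) (rule hm)
  define F where "F = (\<lambda>z. \<Prod>i=1..n. h i (z i - (if i = 1 then 0 else z (i - 1))))"
  have Fm: "F \<in> borel_measurable (leb n)" unfolding F_def by (rule gm)
  \<comment> \<open>Where \<open>F\<close> is nonzero the total is a sum of positive increments, so
    only \<open>s > 0\<close>, where rescaling by \<open>s\<close> is legitimate,
    contributes.\<close>
  have F_nonpos: "F (z(n := s)) = 0" if "\<not> s > 0" for s z
  proof (rule ccontr)
    define Z where "Z = (\<lambda>i. if i = 0 then 0 else (z(n := s)) i)"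
    assume F: "F (z(n := s)) \<noteq> 0"
    have "F (z(n := s)) = (\<Prod>i=1..n. h i (Z i - Z (i - 1)))"
      unfolding F_def Z_def by (intro prod.cong) auto
    with F have "\<forall>i\<in>{1..n}. h i (Z i - Z (i - 1)) \<noteq> 0"
      by (simp add: prod_zero_iff)
    then have *: "Z i - Z (i - 1) > 0" if "i \<in> {1..n}" for i
      using that unfolding h_def by (metis ennreal_0 greaterThan_iff indicator_simps(2) mult_zero_left)
    have "(\<Sum>i=1..n. Z i - Z (i - 1)) > 0" using n * by (intro sum_pos) auto
    moreover have "(\<Sum>i=1..n. Z i - Z (i - 1)) = s"
      using sum_telescope''[of 0 n Z] n by (simp add: Z_def)
    ultimately show False using that by simp
  qed
  have F_scale: "F ((\<lambda>i\<in>{1..m}. 0 + s * y i)(n := s)) = ennreal (s powr (b - n) * exp (- C y * s) * D y)"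
    if s: "s > 0" for s y
  proof -
    have "F ((\<lambda>i\<in>{1..m}. 0 + s * y i)(n := s)) = (\<Prod>i=1..n. h i (s * incr n y i))"
      unfolding F_def
      by (intro prod.cong refl arg_cong2[where f=h]) (auto simp: incr_def node_def m algebra_simps)
    also have "\<dots> = (\<Prod>i=1..n. ennreal (s powr (a i - 1) * exp (- s * (c i * incr n y i)) *
       (indicator {0<..} (incr n y i) * incr n y i powr (a i - 1))))"
      using s by (intro prod.cong refl) (auto simp: h_def indicator_def powr_mult zero_less_mult_iff mult_ac)
    also have "\<dots> = ennreal ((\<Prod>i=1..n. s powr (a i - 1)) * (\<Prod>i=1..n. exp (- s * (c i * incr n y i))) * D y)"
      unfolding D_def by (subst prod_ennreal) (auto simp: prod.distrib)
    also have "(\<Prod>i=1..n. s powr (a i - 1)) = s powr (b - n)"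
      using s by (simp add: powr_sum[symmetric] sum_subtractf b_def)
    also have "(\<Prod>i=1..n. exp (- s * (c i * incr n y i))) = exp (- C y * s)"
      by (simp add: exp_sum[symmetric] C_def sum_distrib_left sum_distrib_right sum_negf mult_ac)
    finally show ?thesis .
  qed
  have inner: "(\<integral>\<^sup>+z. F (z(n := s)) \<partial>leb m) =
       (\<integral>\<^sup>+y. ennreal (indicator {0<..} s * (s powr (b - 1) * exp (- C y * s) * D y)) \<partial>leb m)" for s
  proof (cases "s > 0")
    case False
    then show ?thesis by (simp add: F_nonpos)
  next
    case True
    have "(\<lambda>z. z(n := s)) \<in> measurable (PiM {1..m} (\<lambda>_. lborel)) (PiM {1..n} (\<lambda>_. lborel))"
      unfolding eqI by measurable
    from measurable_compose[OF this Fm[unfolded leb_def]]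
    have mz: "(\<lambda>z. F (z(n := s))) \<in> borel_measurable (leb m)" unfolding leb_def .
    have "(\<integral>\<^sup>+z. F (z(n := s)) \<partial>leb m) = ennreal (\<Prod>i=1..m. s) *
       (\<integral>\<^sup>+y. F ((\<lambda>i\<in>{1..m}. 0 + s * y i)(n := s)) \<partial>leb m)"
      by (rule nn_integral_leb_affine[where c="\<lambda>_. s" and t="\<lambda>_. 0", OF True mz])
    also have "\<dots> = (\<integral>\<^sup>+y. ennreal (s ^ m) * ennreal (s powr (b - n) * exp (- C y * s) * D y) \<partial>leb m)"
      unfolding F_scale[OF True] using Cm Dm by (subst nn_integral_cmult) auto
    also have "\<dots> = (\<integral>\<^sup>+y. ennreal (indicator {0<..} s * (s powr (b - 1) * exp (- C y * s) * D y)) \<partial>leb m)"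
    proof (rule nn_integral_cong)
      fix y
      \<comment> \<open>The Jacobian is \<open>s ^ m\<close> with \<open>m = n - 1\<close>; against
        \<open>s powr (b - n)\<close> it leaves the exponent \<open>b - 1\<close> of the Gamma
        kernel.\<close>
      have "s ^ m * s powr (b - n) = s powr (b - 1)"
        using True by (simp add: powr_realpow[symmetric] powr_add[symmetric] m)
      then have "s ^ m * (s powr (b - n) * exp (- C y * s) * D y) = s powr (b - 1) * exp (- C y * s) * D y"
        by (metis mult.assoc)
      then show "ennreal (s ^ m) * ennreal (s powr (b - n) * exp (- C y * s) * D y) =
         ennreal (indicator {0<..} s * (s powr (b - 1) * exp (- C y * s) * D y))"
        using True D0[of y] by (simp add: ennreal_mult[symmetric])
    qed
    finally show ?thesis .
  qed
  have outer: "(\<integral>\<^sup>+s. ennreal (indicator {0<..} s * (s powr (b - 1) * exp (- C y * s) * D y)) \<partial>lborel) =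
       ennreal K * ennreal (dirichlet_density n a y * C y powr - b)" for y
  proof (cases "D y = 0")
    case True
    then show ?thesis unfolding dd by simp
  next
    case False
    have "(\<integral>\<^sup>+s. ennreal (indicator {0<..} s * (s powr (b - 1) * exp (- C y * s) * D y)) \<partial>lborel) =
      (\<integral>\<^sup>+s. ennreal (D y) * ennreal (indicator {0<..} s * (s powr (b - 1) * exp (- C y * s))) \<partial>lborel)"
      using D0 by (intro nn_integral_cong) (auto simp: ennreal_mult'[symmetric] mult_ac)
    also have "\<dots> = ennreal (D y) * ennreal (Gamma b * C y powr - b)"
      by (subst nn_integral_cmult) (use nn_integral_gamma_kernel[OF b Cpos[OF False]] in auto)
    also have "\<dots> = ennreal (K * (dirichlet_density n a y * C y powr - b))"
      unfolding dd using K D0[of y] by (simp add: ennreal_mult'[symmetric] mult_ac)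
    finally show ?thesis using K by (simp add: ennreal_mult')
  qed
  have "(\<Prod>i=1..n. \<integral>\<^sup>+u. h i u \<partial>lborel) = (\<integral>\<^sup>+z. F z \<partial>leb n)"
    unfolding F_def by (rule nn_integral_leb_increments[symmetric]) (rule hm)
  also have "\<dots> = (\<integral>\<^sup>+s. (\<integral>\<^sup>+z. F (z(n := s)) \<partial>leb m) \<partial>lborel)"
    unfolding m by (rule nn_integral_leb_Suc_rev) (use Fm m in simp)
  also have "\<dots> = (\<integral>\<^sup>+s. (\<integral>\<^sup>+y. ennreal (indicator {0<..} s * (s powr (b - 1) * exp (- C y * s) * D y)) \<partial>leb m) \<partial>lborel)"
    by (simp only: inner)
  also have "\<dots> = (\<integral>\<^sup>+y. (\<integral>\<^sup>+s. ennreal (indicator {0<..} s * (s powr (b - 1) * exp (- C y * s) * D y)) \<partial>lborel) \<partial>leb m)"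
  proof (rule P.Fubini'[symmetric])
    have [measurable]: "C \<in> borel_measurable (leb m)" "D \<in> borel_measurable (leb m)" by fact+
    show "(\<lambda>(s, y). ennreal (indicator {0<..} s * (s powr (b - 1) * exp (- C y * s) * D y)))
      \<in> borel_measurable (lborel \<Otimes>\<^sub>M leb m)" by measurable
  qed
  also have "\<dots> = ennreal K * (\<integral>\<^sup>+y. ennreal (dirichlet_density n a y * C y powr - b) \<partial>leb m)"
    unfolding outer unfolding dd using Cm Dm by (intro nn_integral_cmult) auto
  finally have main: "(\<Prod>i=1..n. \<integral>\<^sup>+u. h i u \<partial>lborel) =
     ennreal K * (\<integral>\<^sup>+y. ennreal (dirichlet_density n a y * C y powr - b) \<partial>leb m)" .
  have "(\<Prod>i=1..n. \<integral>\<^sup>+u. h i u \<partial>lborel) = (\<Prod>i=1..n. ennreal (Gamma (a i) * c i powr (- a i)))"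
    unfolding h_def using a c by (intro prod.cong nn_integral_gamma_kernel) auto
  also have "\<dots> = ennreal K * ennreal (\<Prod>i=1..n. c i powr (- a i))"
    using a K by (subst prod_ennreal) (auto simp: prod.distrib K_def ennreal_mult'[symmetric] Gamma_real_pos less_imp_le)
  finally have "ennreal K * (\<integral>\<^sup>+y. ennreal (dirichlet_density n a y * C y powr - b) \<partial>leb m) =
     ennreal K * ennreal (\<Prod>i=1..n. c i powr (- a i))" using main by simp
  then have "(\<integral>\<^sup>+y. ennreal (dirichlet_density n a y * C y powr - b) \<partial>leb m) =
     ennreal (\<Prod>i=1..n. c i powr (- a i))" using K
    by (simp add: ennreal_mult_cancel_left)
  moreover have "m = n - 1" using m by simp
  ultimately show ?thesis unfolding C_def b_def by simp
qed

lemma dir_fdd_density_eq: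
  assumes "(\<Sum>i=1..n. \<beta> * (t i - t (i - 1))) = \<beta>"
  shows "dir_fdd_density \<beta> n t y = dirichlet_density n (\<lambda>i. \<beta> * (t i - t (i - 1))) y"
proof -
  have "(\<Prod>i=1..n. indicator {0<..} (incr n y i) * incr n y i powr (\<beta> * (t i - t (i - 1)) - 1)) =
     (if (\<forall>i\<in>{1..n}. node n y (i - 1) < node n y i)
      then \<Prod>i=1..n. incr n y i powr (\<beta> * (t i - t (i - 1)) - 1) else 0)"
    by (auto simp: incr_def indicator_def prod_zero_iff intro!: prod.cong)
  moreover have "dir_fdd_density \<beta> n t y = (if (\<forall>i\<in>{1..n}. node n y (i - 1) < node n y i)
      then Gamma \<beta> / (\<Prod>i\<in>{1..n}. Gamma (\<beta> * (t i - t (i - 1))))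
           * (\<Prod>i\<in>{1..n}. incr n y i powr (\<beta> * (t i - t (i - 1)) - 1)) else 0)"
    unfolding dir_fdd_density_def Let_def node_def[symmetric] incr_def ..
  ultimately show ?thesis
    unfolding dirichlet_density_def assms by simp
qed

section \<open>Uniqueness of the generalised Stieltjes transform\<close>

lemma measure_eqI_lower_boxes:
  fixes M N :: "(nat \<Rightarrow> real) measure"
  assumes I: "finite I" and sM: "sets M = sets (PiM I (\<lambda>_. borel))" and sN: "sets N = sets (PiM I (\<lambda>_. borel))"
    and fin: "finite_measure M"
    and eq: "\<And>a. emeasure M (PiE I (\<lambda>i. {..a i})) = emeasure N (PiE I (\<lambda>i. {..a i}))"
  shows "M = N"
proof -
  have borel_eq: "(borel :: real measure) = sigma UNIV (range (\<lambda>a. {..a}))"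
    by (rule borel_eq_atMost)
  define P where "P = {{f\<in>(\<Pi>\<^sub>E i\<in>I. UNIV :: real set). \<forall>i\<in>j. f i \<in> A i} | A j. j \<in> {I} \<and> A \<in> Pi j (\<lambda>_. range (\<lambda>a. {..a}))}"
  have PE: "P = {PiE I (\<lambda>i. {..a i}) | a. True}"
  proof (intro set_eqI iffI)
    fix X assume "X \<in> P"
    then obtain A j where X: "X = {f\<in>(\<Pi>\<^sub>E i\<in>I. UNIV). \<forall>i\<in>j. f i \<in> A i}"
      and j: "j = I" and A: "A \<in> Pi j (\<lambda>_. range (\<lambda>a. {..a}))"
      unfolding P_def by blast
    have A: "\<forall>i\<in>I. \<exists>a. A i = {..a}" using A j by (fastforce simp: Pi_def)
    from bchoice[OF A] obtain a where "\<forall>i\<in>I. A i = {..a i}" by blast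
    then have "X = PiE I (\<lambda>i. {..a i})" unfolding X j by (auto simp: PiE_iff extensional_def)
    then show "X \<in> {PiE I (\<lambda>i. {..a i}) | a. True}" by blast
  next
    fix X assume "X \<in> {PiE I (\<lambda>i. {..a i :: real}) | a. True}"
    then obtain a where X: "X = PiE I (\<lambda>i. {..a i :: real})" by auto
    show "X \<in> P" unfolding P_def X
      by (intro CollectI exI[of _ "\<lambda>i. {..a i}"] exI[of _ I]) (auto simp: PiE_iff extensional_def)
  qed
  have "sets (PiM I (\<lambda>_. borel :: real measure)) = sets (sigma (\<Pi>\<^sub>E i\<in>I. UNIV) P)"
    unfolding borel_eq P_def
  proof (rule sets_PiM_sigma)
    show "\<exists>S\<subseteq>range (\<lambda>a. {..a}). countable S \<and> (UNIV :: real set) = \<Union>S" for i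
      by (rule exI[of _ "range (\<lambda>n::nat. {..real n})"]) (auto intro: real_arch_simple)
  qed (use I in auto)
  then have gen: "sets (PiM I (\<lambda>_. borel :: real measure)) = sigma_sets (\<Pi>\<^sub>E i\<in>I. UNIV) P"
    by (subst (asm) sets_measure_of) (auto simp: P_def)
  show ?thesis
  proof (rule measure_eqI_generator_eq[where E=P and \<Omega>="\<Pi>\<^sub>E i\<in>I. UNIV" and A="\<lambda>n. PiE I (\<lambda>_. {..real n})"])
    show "Int_stable P"
    proof (unfold PE, intro Int_stableI)
      fix X Y assume "X \<in> {PiE I (\<lambda>i. {..a i :: real}) | a. True}" "Y \<in> {PiE I (\<lambda>i. {..a i :: real}) | a. True}"
      then obtain a b where "X = PiE I (\<lambda>i. {..a i})" "Y = PiE I (\<lambda>i. {..b i})" by auto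
      then have "X \<inter> Y = PiE I (\<lambda>i. {..min (a i) (b i)})" by (auto simp: PiE_iff extensional_def)
      then show "X \<inter> Y \<in> {PiE I (\<lambda>i. {..a i}) | a. True}"
        by (intro CollectI exI[of _ "\<lambda>i. min (a i) (b i)"]) simp
    qed
    show "(\<Union>n. PiE I (\<lambda>_. {..real n})) = (\<Pi>\<^sub>E i\<in>I. UNIV)"
    proof (intro set_eqI iffI)
      fix x assume x: "x \<in> (\<Pi>\<^sub>E i\<in>I. UNIV :: real set)"
      obtain n :: nat where n: "(\<Sum>i\<in>I. \<bar>x i\<bar>) \<le> real n" using real_arch_simple by blast
      have "x i \<le> real n" if "i \<in> I" for i
        using member_le_sum[of i I "\<lambda>i. \<bar>x i\<bar>"] that I n by fastforce
      then show "x \<in> (\<Union>n. PiE I (\<lambda>_. {..real n}))" using x by (auto simp: PiE_iff extensional_def)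
    qed auto
    show "emeasure M (PiE I (\<lambda>_. {..real n})) \<noteq> \<infinity>" for n
      using finite_measure.emeasure_finite[OF fin] by auto
  qed (auto simp: sM sN gen PE eq)
qed

section \<open>Stone-Weierstrass for exponentials on the cube\<close>

lemma compact_PiE_Icc: "compact (PiE I (\<lambda>_. {0..1::real}))"
proof -
  \<comment> \<open>Coordinates outside \<open>I\<close> are frozen at \<open>undefined\<close>, so
    the set is a full product of compact factors and Tychonoff applies.\<close>
  have "PiE I (\<lambda>_. {0..1::real}) = PiE UNIV (\<lambda>i. if i \<in> I then {0..1} else {undefined})"
    by (auto simp: PiE_iff extensional_def split: if_splits)
  moreover have "compactin (product_topology (\<lambda>_. euclidean) UNIV) (PiE UNIV (\<lambda>i. if i \<in> I then {0..1::real} else {undefined}))"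
    by (subst compactin_PiE) auto
  ultimately show ?thesis
    by (simp add: euclidean_product_topology[symmetric] flip: compactin_euclidean_iff)
qed

inductive_set exp_span :: "nat set \<Rightarrow> ((nat \<Rightarrow> real) \<Rightarrow> real) set" for I where
  base: "(\<And>i. i \<in> I \<Longrightarrow> l i \<ge> 0) \<Longrightarrow> (\<lambda>x. c * exp (\<Sum>i\<in>I. l i * x i)) \<in> exp_span I"
| add: "f \<in> exp_span I \<Longrightarrow> g \<in> exp_span I \<Longrightarrow> (\<lambda>x. f x + g x) \<in> exp_span I"

lemma exp_span_mult:
  assumes "f \<in> exp_span I" "g \<in> exp_span I"
  shows "(\<lambda>x. f x * g x) \<in> exp_span I"
  using assms(1)
proof induction
  case (base l c)
  show ?case using assms(2)
  proof induction
    case (base l' c')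
    have "(\<lambda>x. (c * c') * exp (\<Sum>i\<in>I. (l i + l' i) * x i)) \<in> exp_span I"
      by (rule exp_span.base) (use base \<open>\<And>i. i \<in> I \<Longrightarrow> 0 \<le> l i\<close> in auto)
    then show ?case by (simp add: exp_add sum.distrib algebra_simps)
  next
    case (add f g)
    from exp_span.add[OF add(3,4)] show ?case by (simp add: algebra_simps)
  qed
next
  case (add f g)
  from exp_span.add[OF add(3,4)] show ?case by (simp add: algebra_simps)
qed

lemma continuous_on_coord [continuous_intros]: "continuous_on S (\<lambda>x::nat \<Rightarrow> real. x i)"
  by (rule continuous_on_subset[OF continuous_on_product_coordinates]) auto

lemma function_ring_exp_span:
  assumes "finite I"
  shows "function_ring_on (exp_span I) (PiE I (\<lambda>_. {0..1}))"
proof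
  show "continuous_on (PiE I (\<lambda>_. {0..1})) f" if "f \<in> exp_span I" for f
    using that by induction (auto intro!: continuous_intros)
  show "(\<lambda>_. c) \<in> exp_span I" for c
    using exp_span.base[of I "\<lambda>_. 0" c] by simp
  show "\<exists>f\<in>exp_span I. f x \<noteq> f y"
    if xy: "x \<in> PiE I (\<lambda>_. {0..1})" "y \<in> PiE I (\<lambda>_. {0..1})" and "x \<noteq> y" for x y
  proof -
    obtain j where j: "x j \<noteq> y j" using \<open>x \<noteq> y\<close> by auto
    have jI: "j \<in> I" using j xy by (metis PiE_arb)
    have "(\<lambda>x. 1 * exp (\<Sum>i\<in>I. (if i = j then 1 else 0) * x i)) \<in> exp_span I"
      by (rule exp_span.base) auto
    moreover have "(\<Sum>i\<in>I. (if i = j then 1 else 0) * z i) = z j" for z :: "nat \<Rightarrow> real"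
      using jI assms by (subst sum.mono_neutral_cong_right[of I "{j}" _ "\<lambda>_. z j"]) auto
    ultimately have "(\<lambda>x. exp (x j)) \<in> exp_span I" by simp
    with j show ?thesis by (intro bexI[of _ "\<lambda>x. exp (x j)"]) auto
  qed
qed (auto intro: compact_PiE_Icc exp_span.add exp_span_mult)

section \<open>From the transform to moments and exponentials\<close>

lemma (in finite_measure) integral_power_series:
  fixes u :: "'a \<Rightarrow> real" and c :: "nat \<Rightarrow> real"
  assumes um[measurable]: "u \<in> borel_measurable M" and [measurable]: "F \<in> borel_measurable borel" and ub: "AE x in M. \<bar>u x\<bar> \<le> r"
    and sm: "summable (\<lambda>n. \<bar>c n\<bar> * r ^ n)"
    and F: "\<And>z. \<bar>z\<bar> \<le> r \<Longrightarrow> (\<lambda>n. c n * z ^ n) sums F z"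
  shows "(\<lambda>n. c n * (\<integral>x. u x ^ n \<partial>M)) sums (\<integral>x. F (u x) \<partial>M)"
proof -
  have intp: "integrable M (\<lambda>x. u x ^ n)" for n
    by (rule integrable_const_bound[where B="r ^ n"])
      (use ub in \<open>eventually_elim, auto simp: power_abs intro: power_mono\<close>, measurable)
  have bd: "AE x in M. norm (c n * u x ^ n) \<le> \<bar>c n\<bar> * r ^ n" for n
    using ub by eventually_elim (auto simp: abs_mult power_abs intro!: mult_left_mono power_mono)
  have "(\<lambda>n. \<integral>x. c n * u x ^ n \<partial>M) sums (\<integral>x. (\<Sum>n. c n * u x ^ n) \<partial>M)"
  proof (rule sums_integral)
    show "AE x in M. summable (\<lambda>n. norm (c n * u x ^ n))"
      using ub
    proof eventually_elim
      case (elim x)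
      show ?case by (rule summable_comparison_test'[OF sm, of 0])
          (use elim in \<open>auto simp: abs_mult power_abs intro!: mult_left_mono power_mono\<close>)
    qed
    show "summable (\<lambda>n. \<integral>x. norm (c n * u x ^ n) \<partial>M)"
    proof (rule summable_comparison_test')
      show "summable (\<lambda>n. \<bar>c n\<bar> * r ^ n * measure M (space M))" by (rule summable_mult2[OF sm])
      fix n :: nat assume "0 \<le> n"
      have "(\<integral>x. norm (c n * u x ^ n) \<partial>M) \<le> (\<integral>x. \<bar>c n\<bar> * r ^ n \<partial>M)"
        by (rule integral_mono_AE) (use intp bd in auto)
      then show "norm (\<integral>x. norm (c n * u x ^ n) \<partial>M) \<le> \<bar>c n\<bar> * r ^ n * measure M (space M)"
        by (simp add: mult_ac)
    qed
  qed (use intp in auto)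
  also have "(\<integral>x. (\<Sum>n. c n * u x ^ n) \<partial>M) = (\<integral>x. F (u x) \<partial>M)"
  proof (rule integral_cong_AE)
    show "AE x in M. (\<Sum>n. c n * u x ^ n) = F (u x)"
      using ub
    proof eventually_elim
      case (elim x)
      from sums_unique[OF F[OF elim]] show ?case by simp
    qed
  qed measurable
  finally show ?thesis by simp
qed

text \<open>The transforms are compared for \<open>s \<ge> 0\<close> only, although their series
  converge on both sides of 0. A zero of a nonzero power series is isolated, and vanishing on a
  right neighbourhood already contradicts this. Coefficient 0 is read off from the value at
  0.\<close>

lemma powser_eq_zero_right:
  fixes a :: "nat \<Rightarrow> real"
  assumes r: "0 < r" and sm: "\<And>x. \<bar>x\<bar> < r \<Longrightarrow> (\<lambda>n. a n * x ^ n) sums f x"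
    and z: "\<And>x. 0 \<le> x \<Longrightarrow> x < r \<Longrightarrow> f x = 0"
  shows "a m = 0"
proof (cases "m = 0")
  case True
  have "(\<lambda>n. a n * 0 ^ n) sums f 0" using sm[of 0] r by simp
  then have "a 0 = f 0" by (simp only: powser_sums_zero_iff)
  then show ?thesis using z[of 0] r True by simp
next
  case False
  show ?thesis
  proof (rule ccontr)
    assume "a m \<noteq> 0"
    then obtain s where s: "0 < s" "\<And>z. z \<in> cball 0 s - {0} \<Longrightarrow> f z \<noteq> 0"
      using powser_0_nonzero[of r 0 a f m] r sm z[of 0] False by auto
    have "f (min s (r/2)) \<noteq> 0" using s(1) r by (intro s(2)) auto
    moreover have "f (min s (r/2)) = 0" using s(1) r by (intro z) auto
    ultimately show False by simp
  qed
qed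

text \<open>Every factor \<open>- b - i\<close> is negative. Hence the binomial coefficients can be
  cancelled and no moment is lost.\<close>

lemma gbinomial_neg_nonzero: "(b::real) > 0 \<Longrightarrow> (- b) gchoose n \<noteq> 0"
  by (auto simp: gbinomial_prod_rev)

lemma integral_power_eqI:
  fixes u :: "'a \<Rightarrow> real"
  assumes M: "finite_measure M" and N: "finite_measure N"
    and uM: "u \<in> borel_measurable M" and uN: "u \<in> borel_measurable N"
    and L: "L \<ge> 0" and bM: "AE x in M. \<bar>u x\<bar> \<le> L" and bN: "AE x in N. \<bar>u x\<bar> \<le> L"
    and b: "b > 0"
    and eq: "\<And>s. s \<ge> 0 \<Longrightarrow> (\<integral>x. (1 + s * u x) powr (- b) \<partial>M) = (\<integral>x. (1 + s * u x) powr (- b) \<partial>N)"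
  shows "(\<integral>x. u x ^ n \<partial>M) = (\<integral>x. u x ^ n \<partial>N)"
proof -
  \<comment> \<open>Keeps \<open>\<bar>s * u x\<bar> \<le> 1/2\<close>, inside the disc of
    convergence; the summand 1 covers \<open>L = 0\<close>.\<close>
  define r where "r = 1 / (2 * (L + 1))"
  have r: "r > 0" using L by (simp add: r_def)
  define c where "c = (\<lambda>n. (- b) gchoose n)"
  have c0: "c n \<noteq> 0" for n unfolding c_def using b by (rule gbinomial_neg_nonzero)
  have ser: "\<bar>z\<bar> < 1 \<Longrightarrow> (\<lambda>n. c n * z ^ n) sums (1 + z) powr (- b)" for z
    unfolding c_def by (rule gen_binomial_real)
  have sm: "summable (\<lambda>n. \<bar>c n\<bar> * (1/2) ^ n)"
  proof -
    have "summable (\<lambda>n. norm (c n * (1/2) ^ n))"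
      by (rule powser_insidea[where x="3/4"]) (use sums_summable[OF ser[of "3/4"]] in auto)
    then show ?thesis by (simp add: abs_mult power_abs)
  qed
  have key: "(\<lambda>n. c n * (\<integral>x. (s * u x) ^ n \<partial>K)) sums (\<integral>x. (1 + s * u x) powr (- b) \<partial>K)"
    if K: "finite_measure K" "u \<in> borel_measurable K" "AE x in K. \<bar>u x\<bar> \<le> L" and s: "\<bar>s\<bar> < r" for s and K :: "'a measure"
  proof (rule finite_measure.integral_power_series[OF K(1), where r="1/2" and F="\<lambda>z. (1 + z) powr (- b)"])
    show "(\<lambda>x. s * u x) \<in> borel_measurable K" using K(2) by measurable
    show "AE x in K. \<bar>s * u x\<bar> \<le> 1/2" using K(3)
    proof eventually_elim
      case (elim x)
      have "\<bar>s\<bar> * \<bar>u x\<bar> \<le> r * L" using s elim L by (intro mult_mono) auto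
      also have "\<dots> \<le> 1/2" using L by (simp add: r_def field_simps)
      finally show ?case by (simp add: abs_mult)
    qed
  qed (use sm in \<open>auto intro!: ser\<close>)
  define a where "a = (\<lambda>n. c n * ((\<integral>x. u x ^ n \<partial>M) - (\<integral>x. u x ^ n \<partial>N)))"
  have "a n = 0"
  proof (rule powser_eq_zero_right[OF r])
    fix s :: real assume s: "\<bar>s\<bar> < r"
    from sums_diff[OF key[OF M uM bM s] key[OF N uN bN s]]
    show "(\<lambda>n. a n * s ^ n) sums ((\<integral>x. (1 + s * u x) powr (- b) \<partial>M) - (\<integral>x. (1 + s * u x) powr (- b) \<partial>N))"
      unfolding a_def by (simp add: power_mult_distrib algebra_simps)
  qed (use eq in auto)
  then show ?thesis using c0[of n] by (simp add: a_def)
qed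

lemma integral_exp_eqI:
  fixes u :: "'a \<Rightarrow> real"
  assumes M: "finite_measure M" and N: "finite_measure N"
    and uM: "u \<in> borel_measurable M" and uN: "u \<in> borel_measurable N"
    and bM: "AE x in M. \<bar>u x\<bar> \<le> L" and bN: "AE x in N. \<bar>u x\<bar> \<le> L"
    and eq: "\<And>n. (\<integral>x. u x ^ n \<partial>M) = (\<integral>x. u x ^ n \<partial>N)"
  shows "(\<integral>x. exp (u x) \<partial>M) = (\<integral>x. exp (u x) \<partial>N)"
proof -
  have e: "(\<lambda>n. inverse (fact n) * z ^ n) sums exp z" for z :: real
    using exp_converges[of z] by (simp add: divide_inverse mult.commute)
  have "(\<lambda>n. inverse (fact n) * (\<integral>x. u x ^ n \<partial>K)) sums (\<integral>x. exp (u x) \<partial>K)"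
    if "finite_measure K" "u \<in> borel_measurable K" "AE x in K. \<bar>u x\<bar> \<le> L" for K :: "'a measure"
    by (rule finite_measure.integral_power_series[OF that(1,2) _ that(3)])
      (use sums_summable[OF e[of L]] e in auto)
  from this[OF M uM bM] this[OF N uN bN] show ?thesis
    unfolding eq by (rule sums_unique2)
qed

lemma measure_eqI_markov_krein:
  fixes M N :: "(nat \<Rightarrow> real) measure"
  assumes I: "finite I" and sM: "sets M = sets (PiM I (\<lambda>_. borel))" and sN: "sets N = sets (PiM I (\<lambda>_. borel))"
    and M: "finite_measure M" and N: "finite_measure N"
    and bM: "AE x in M. \<forall>i\<in>I. x i \<in> {0..1}" and bN: "AE x in N. \<forall>i\<in>I. x i \<in> {0..1}"
    and b: "b > 0"
    and eq: "\<And>l. (\<And>i. i \<in> I \<Longrightarrow> l i \<ge> 0) \<Longrightarrow>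
      (\<integral>x. (1 + (\<Sum>i\<in>I. l i * x i)) powr (- b) \<partial>M) = (\<integral>x. (1 + (\<Sum>i\<in>I. l i * x i)) powr (- b) \<partial>N)"
  shows "M = N"
proof -
  let ?S = "PiE I (\<lambda>_. {0..1::real})"
  interpret M: finite_measure M by fact
  interpret N: finite_measure N by fact
  have spM: "space M = PiE I (\<lambda>_. UNIV)" and spN: "space N = PiE I (\<lambda>_. UNIV)"
    using sets_eq_imp_space_eq[OF sM] sets_eq_imp_space_eq[OF sN] by (auto simp: space_PiM)
  have mM: "measurable M B = measurable (PiM I (\<lambda>_. borel)) B" for B :: "real measure"
    by (rule measurable_cong_sets[OF sM refl])
  have mN: "measurable N B = measurable (PiM I (\<lambda>_. borel)) B" for B :: "real measure"
    by (rule measurable_cong_sets[OF sN refl])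
  have SM: "AE x in M. x \<in> ?S" using bM AE_space by eventually_elim (auto simp: spM PiE_iff)
  have SN: "AE x in N. x \<in> ?S" using bN AE_space by eventually_elim (auto simp: spN PiE_iff)
  have exp_eq: "(\<integral>x. exp (\<Sum>i\<in>I. l i * x i) \<partial>M) = (\<integral>x. exp (\<Sum>i\<in>I. l i * x i) \<partial>N)"
    if l: "\<And>i. i \<in> I \<Longrightarrow> l i \<ge> 0" for l
  proof -
    define L where "L = (\<Sum>i\<in>I. l i)"
    have L: "L \<ge> 0" unfolding L_def by (intro sum_nonneg l)
    have bd: "\<bar>\<Sum>i\<in>I. l i * x i\<bar> \<le> L" if "x \<in> ?S" for x
    proof -
      have "\<bar>\<Sum>i\<in>I. l i * x i\<bar> \<le> (\<Sum>i\<in>I. \<bar>l i * x i\<bar>)" by (rule sum_abs)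
      also have "\<dots> \<le> L" unfolding L_def
      proof (rule sum_mono)
        fix i assume i: "i \<in> I"
        have "0 \<le> x i" "x i \<le> 1" using that i by (auto simp: PiE_iff)
        then show "\<bar>l i * x i\<bar> \<le> l i" using l[OF i] by (simp add: abs_mult mult_left_le)
      qed
      finally show ?thesis .
    qed
    have b1: "AE x in M. \<bar>\<Sum>i\<in>I. l i * x i\<bar> \<le> L" using SM by eventually_elim (rule bd)
    have b2: "AE x in N. \<bar>\<Sum>i\<in>I. l i * x i\<bar> \<le> L" using SN by eventually_elim (rule bd)
    have m1: "(\<lambda>x. \<Sum>i\<in>I. l i * x i) \<in> borel_measurable M" "(\<lambda>x. \<Sum>i\<in>I. l i * x i) \<in> borel_measurable N"
      unfolding mM mN by measurable
    show ?thesis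
    proof (rule integral_exp_eqI[OF M N m1 b1 b2], rule integral_power_eqI[OF M N m1 L b1 b2 b])
      \<comment> \<open>Along the ray \<open>s * l\<close> the transform is a function of one
        variable whose series carries the moments of this linear form.\<close>
      fix s :: real assume s: "s \<ge> 0"
      show "(\<integral>x. (1 + s * (\<Sum>i\<in>I. l i * x i)) powr (- b) \<partial>M) = (\<integral>x. (1 + s * (\<Sum>i\<in>I. l i * x i)) powr (- b) \<partial>N)"
        using eq[of "\<lambda>i. s * l i"] s l by (simp add: sum_distrib_left mult.assoc)
    qed
  qed
  have span: "integrable M f \<and> integrable N f \<and> (\<integral>x. f x \<partial>M) = (\<integral>x. f x \<partial>N)" if "f \<in> exp_span I" for f
    using that
  proof induction
    case (base l c)
    have ub: "\<bar>exp (\<Sum>i\<in>I. l i * x i)\<bar> \<le> exp (\<Sum>i\<in>I. l i)" if "x \<in> ?S" for x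
      using that base by (auto intro!: sum_mono mult_left_le simp: PiE_iff)
    have "integrable M (\<lambda>x. exp (\<Sum>i\<in>I. l i * x i))"
      by (rule M.integrable_const_bound[where B="exp (\<Sum>i\<in>I. l i)"])
        (use SM in \<open>eventually_elim, use ub in auto\<close>, unfold mM, measurable)
    moreover have "integrable N (\<lambda>x. exp (\<Sum>i\<in>I. l i * x i))"
      by (rule N.integrable_const_bound[where B="exp (\<Sum>i\<in>I. l i)"])
        (use SN in \<open>eventually_elim, use ub in auto\<close>, unfold mN, measurable)
    ultimately show ?case using exp_eq[OF base] by auto
  next
    case (add f g)
    then show ?case by auto
  qed
  interpret R: function_ring_on "exp_span I" ?S by (rule function_ring_exp_span[OF I])
  have cont: "(\<integral>x. f x \<partial>M) = (\<integral>x. f x \<partial>N)"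
    if fm: "f \<in> borel_measurable (PiM I (\<lambda>_. borel))" and fc: "continuous_on ?S f" and fb: "\<And>x. \<bar>f x\<bar> \<le> 1" for f :: "_ \<Rightarrow> real"
  proof -
    obtain G where G: "\<And>n. G n \<in> exp_span I" and lim: "uniform_limit ?S G f sequentially"
      using R.Stone_Weierstrass[OF fc] by blast
    have conv: "(\<lambda>n. \<integral>x. G n x \<partial>K) \<longlonglongrightarrow> (\<integral>x. f x \<partial>K)"
      if K: "finite_measure K" "sets K = sets (PiM I (\<lambda>_. borel))" "AE x in K. x \<in> ?S" "\<And>g. g \<in> exp_span I \<Longrightarrow> integrable K g" for K
    proof -
      interpret K: finite_measure K by fact
      have iK: "integrable K f"
        by (rule K.integrable_const_bound[where B=1])
          (use fb fm in \<open>auto simp: measurable_cong_sets[OF K(2) refl]\<close>)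
      have "(\<lambda>n. \<integral>x. G n x - f x \<partial>K) \<longlonglongrightarrow> 0"
      proof (rule LIMSEQ_I)
        fix e :: real assume e: "e > 0"
        define e' where "e' = e / (measure K (space K) + 1)"
        have mk: "measure K (space K) \<ge> 0" by simp
        have e': "e' > 0" using e mk unfolding e'_def by (intro divide_pos_pos) linarith+
        from uniform_limitD[OF lim e'] obtain n0 where n0: "\<And>n x. n \<ge> n0 \<Longrightarrow> x \<in> ?S \<Longrightarrow> dist (G n x) (f x) < e'"
          unfolding eventually_sequentially by blast
        show "\<exists>no. \<forall>n\<ge>no. norm ((\<integral>x. G n x - f x \<partial>K) - 0) < e"
        proof (intro exI allI impI)
          fix n assume n: "n0 \<le> n"
          have "norm (\<integral>x. G n x - f x \<partial>K) \<le> (\<integral>x. norm (G n x - f x) \<partial>K)" by (rule integral_norm_bound)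
          also have "\<dots> \<le> (\<integral>x. e' \<partial>K)"
          proof (rule integral_mono_AE)
            show "AE x in K. norm (G n x - f x) \<le> e'"
              using K(3) by eventually_elim (use n0[OF n] in \<open>force simp: dist_real_def\<close>)
          qed (use iK K(4)[OF G] in auto)
          also have "\<dots> = e' * measure K (space K)" by (simp add: mult.commute)
          also have "\<dots> < e' * (measure K (space K) + 1)" using e' by (intro mult_strict_left_mono) auto
          also have "\<dots> = e" using mk unfolding e'_def by (subst nonzero_eq_divide_eq[symmetric]) (linarith, simp)
          finally show "norm ((\<integral>x. G n x - f x \<partial>K) - 0) < e" by simp
        qed
      qed
      then have "(\<lambda>n. (\<integral>x. G n x \<partial>K) - (\<integral>x. f x \<partial>K)) \<longlonglongrightarrow> 0"
        using iK K(4)[OF G] by simp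
      then show ?thesis by (simp add: LIM_zero_iff)
    qed
    have "(\<lambda>n. \<integral>x. G n x \<partial>M) \<longlonglongrightarrow> (\<integral>x. f x \<partial>M)"
      by (rule conv[OF M sM SM]) (use span in auto)
    moreover have "(\<lambda>n. \<integral>x. G n x \<partial>M) \<longlonglongrightarrow> (\<integral>x. f x \<partial>N)"
      using conv[OF N sN SN] span G by simp
    ultimately show ?thesis by (rule LIMSEQ_unique)
  qed
  show ?thesis
  proof (rule measure_eqI_lower_boxes[OF I sM sN M])
    fix a :: "nat \<Rightarrow> real"
    define B where "B = PiE I (\<lambda>i. {..a i})"
    \<comment> \<open>Continuous cut-offs with values in [0, 1], equal to 1 on the box and tending
      to 0 off it: they carry the equality from continuous functions to boxes.\<close>
    define \<phi> where "\<phi> = (\<lambda>(n::nat) x. \<Prod>i\<in>I. max 0 (min 1 (1 - real n * (x i - a i))))"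
    have \<phi>b: "\<bar>\<phi> n x\<bar> \<le> 1" for n x unfolding \<phi>_def
      by (simp add: abs_prod prod_le_1)
    have \<phi>m: "\<phi> n \<in> borel_measurable (PiM I (\<lambda>_. borel))" for n
      unfolding \<phi>_def by measurable
    have \<phi>c: "continuous_on ?S (\<phi> n)" for n
      unfolding \<phi>_def by (intro continuous_intros)
    have lim: "(\<lambda>n. \<phi> n x) \<longlonglongrightarrow> indicator B x" if x: "x \<in> PiE I (\<lambda>_. UNIV)" for x
    proof -
      have "(\<lambda>n. max 0 (min 1 (1 - real n * (x i - a i)))) \<longlonglongrightarrow> indicator {..a i} (x i)" for i
      proof (cases "x i \<le> a i")
        case True
        then have "max 0 (min 1 (1 - real n * (x i - a i))) = 1" for n
          by (simp add: mult_nonneg_nonpos max_def min_def)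
        then show ?thesis using True by simp
      next
        case False
        obtain n0 :: nat where n0: "1 / (x i - a i) < real n0" using reals_Archimedean2 by blast
        have "max 0 (min 1 (1 - real n * (x i - a i))) = 0" if "n \<ge> n0" for n
        proof -
          have "1 / (x i - a i) < real n" using n0 that by linarith
          then have "1 < real n * (x i - a i)" using False by (simp add: field_simps)
          then show ?thesis by simp
        qed
        then have "\<forall>\<^sub>F n in sequentially. max 0 (min 1 (1 - real n * (x i - a i))) = 0"
          unfolding eventually_sequentially by blast
        then show ?thesis using False by (simp add: tendsto_eventually)
      qed
      then have "(\<lambda>n. \<phi> n x) \<longlonglongrightarrow> (\<Prod>i\<in>I. indicator {..a i} (x i))"
        unfolding \<phi>_def by (intro tendsto_prod)
      moreover have "(\<Prod>i\<in>I. indicator {..a i} (x i)) = (indicator B x :: real)"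
        using x I by (auto simp: B_def indicator_def PiE_iff prod_zero_iff split: if_splits intro!: prod.neutral)
      ultimately show ?thesis by simp
    qed
    have Bs: "B \<in> sets (PiM I (\<lambda>_. borel))" unfolding B_def using I by (intro sets_PiM_I_finite) auto
    have conv: "(\<lambda>n. \<integral>x. \<phi> n x \<partial>K) \<longlonglongrightarrow> measure K B"
      if K: "finite_measure K" "sets K = sets (PiM I (\<lambda>_. borel))" for K
    proof -
      interpret K: finite_measure K by fact
      have "(\<lambda>n. \<integral>x. \<phi> n x \<partial>K) \<longlonglongrightarrow> (\<integral>x. indicator B x \<partial>K)"
      proof (rule integral_dominated_convergence[where w="\<lambda>_. 1"])
        show "AE x in K. (\<lambda>n. \<phi> n x) \<longlonglongrightarrow> indicator B x"
          using sets_eq_imp_space_eq[OF K(2)] by (intro AE_I2 lim) (auto simp: space_PiM)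
      qed (use \<phi>b \<phi>m Bs K(2) in \<open>auto simp: measurable_cong_sets[OF K(2) refl]\<close>)
      then show ?thesis using Bs K by simp
    qed
    have "(\<lambda>n. \<integral>x. \<phi> n x \<partial>M) \<longlonglongrightarrow> measure M B" by (rule conv[OF M sM])
    moreover have "(\<lambda>n. \<integral>x. \<phi> n x \<partial>M) \<longlonglongrightarrow> measure N B"
      using conv[OF N sN] cont[OF \<phi>m \<phi>c \<phi>b] by simp
    ultimately have "measure M B = measure N B" by (rule LIMSEQ_unique)
    then show "emeasure M (PiE I (\<lambda>i. {..a i})) = emeasure N (PiE I (\<lambda>i. {..a i}))"
      unfolding B_def[symmetric] by (simp add: M.emeasure_eq_measure N.emeasure_eq_measure)
  qed
qed

section \<open>A contour integral around the unit interval\<close>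

text \<open>The substitution \<open>\<zeta> = 1 / (1 - exp (- w))\<close> carries the strip \<open>\<bar>Im w\<bar> < \<pi>\<close> onto the sphere slit along
  \<open>[0, 1]\<close>, and \<open>w = 0\<close> to \<open>\<infinity>\<close>. Since \<open>w = ln (\<zeta> / (\<zeta> - 1))\<close> and \<open>todd w = \<zeta> * w\<close>, the function
  \<open>slit_fun\<close> below is \<open>(1 - 1 / \<zeta>) powr (\<alpha> \<zeta>) * \<zeta> / (\<zeta> + c)\<close>; its only pole is at \<open>\<zeta> = - c\<close>.\<close>

definition todd :: "complex \<Rightarrow> complex" where
  "todd w = (if w = 0 then 1 else w / (1 - exp (- w)))"

lemma exp_minus_eq_one_strip:
  assumes "\<bar>Im w\<bar> < 2 * pi" "exp (- w) = 1"
  shows "w = 0"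
proof -
  from assms(2) obtain n :: int where n: "Re w = 0" "- Im w = of_int (2 * n) * pi"
    by (auto simp: exp_eq_1)
  have "\<bar>real_of_int n\<bar> < 1"
  proof -
    have "\<bar>Im w\<bar> = \<bar>real_of_int n\<bar> * (2 * pi)" using n(2) by (simp add: abs_mult flip: abs_minus_cancel[of "Im w"])
    then show ?thesis using assms(1) by simp
  qed
  then have "n = 0" by linarith
  then show ?thesis using n by (simp add: complex_eq_iff)
qed

lemma open_strip: "open {w. \<bar>Im w\<bar> < r}"
  by (intro open_Collect_less continuous_intros)

text \<open>The strip is twice as wide as the slit plane requires, so that the closed rectangle
  between \<open>Im w = - pi\<close> and \<open>Im w = pi\<close> lies inside it. In this width 0 is
  the only zero of \<open>1 - exp (- w)\<close>, and the singularity there is removable.\<close>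

lemma todd_holomorphic: "todd holomorphic_on {w. \<bar>Im w\<bar> < 2 * pi}"
proof (rule no_isolated_singularity'[where K="{0}"])
  let ?S = "{w. \<bar>Im w\<bar> < 2 * pi}"
  have d: "((\<lambda>w::complex. 1 - exp (- w)) has_field_derivative 1) (at 0)"
    by (auto intro!: derivative_eq_intros)
  then have "((\<lambda>w::complex. (1 - exp (- w)) / w) \<longlongrightarrow> 1) (at 0)"
    by (simp add: has_field_derivative_iff)
  from tendsto_inverse[OF this] have "((\<lambda>w::complex. w / (1 - exp (- w))) \<longlongrightarrow> 1) (at 0)" by simp
  then have "(todd \<longlongrightarrow> 1) (at 0)"
    by (rule Lim_transform_eventually) (auto simp: todd_def eventually_at_filter)
  then show "(todd \<longlongrightarrow> todd z) (at z within ?S)" if "z \<in> {0}" for z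
    using that by (auto simp: todd_def intro: tendsto_within_subset)
  have "(\<lambda>w. w / (1 - exp (- w))) holomorphic_on ?S - {0}"
    by (intro holomorphic_intros) (use exp_minus_eq_one_strip in auto)
  then show "todd holomorphic_on ?S - {0}"
    by (rule holomorphic_transform) (auto simp: todd_def)
qed (auto simp: open_strip)

definition slit_fun :: "real \<Rightarrow> real \<Rightarrow> complex \<Rightarrow> complex" where
  "slit_fun \<alpha> c w = exp (- (of_real \<alpha> * todd w)) / (1 + of_real c - of_real c * exp (- w))"

lemma exp_minus_of_real_ln:
  assumes "c > 0"
  shows "exp (- of_real (ln (c / (1 + c)))) = (of_real ((1 + c) / c) :: complex)"
proof -
  have "exp (- ln (c / (1 + c))) = (1 + c) / c" using assms by (simp add: ln_div exp_diff)
  then show ?thesis by (metis exp_of_real of_real_minus)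
qed

text \<open>This point is the image of the pole \<open>\<zeta> = - c\<close> under
  \<open>w = ln (\<zeta> / (\<zeta> - 1))\<close>. It is real, so the bound on \<open>Im w\<close>
  excludes the other values of the logarithm.\<close>

lemma slit_denom_zero:
  assumes c: "c > 0" and w: "\<bar>Im w\<bar> < 2 * pi" and z: "1 + of_real c - of_real c * exp (- w) = 0"
  shows "w = of_real (ln (c / (1 + c)))"
proof -
  let ?w0 = "of_real (ln (c / (1 + c))) :: complex"
  have e0: "of_real c * exp (- ?w0) = 1 + of_real c"
    unfolding exp_minus_of_real_ln[OF c] using c by simp
  have "of_real c * exp (- w) = of_real c * exp (- ?w0)" unfolding e0 using z by (simp add: algebra_simps)
  then have "exp (- w) = exp (- ?w0)" using c by simp
  then have "exp (- (w - ?w0)) = 1" by (simp add: exp_diff exp_minus field_simps)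
  then have "w - ?w0 = 0" by (rule exp_minus_eq_one_strip[rotated]) (use w in simp)
  then show ?thesis by simp
qed

lemma todd_of_real_ln:
  assumes "c > 0"
  shows "todd (of_real (ln (c / (1 + c)))) = of_real (- c * ln (c / (1 + c)))"
proof -
  have ne: "ln (c / (1 + c)) \<noteq> 0" using assms by (simp add: ln_div)
  have "todd (of_real (ln (c / (1 + c)))) = of_real (ln (c / (1 + c)) / (1 - (1 + c) / c))"
    using ne unfolding todd_def exp_minus_of_real_ln[OF assms] by simp
  also have "ln (c / (1 + c)) / (1 - (1 + c) / c) = - c * ln (c / (1 + c))"
    using assms by (simp add: field_simps)
  finally show ?thesis .
qed

text \<open>The pole is simple: the denominator has derivative \<open>c * exp (- w) = 1 + c\<close>
  there, and \<open>todd\<close> takes the value \<open>- c * ln (c / (1 + c))\<close>, which gives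
  the power in the numerator. The bound on \<open>R\<close> puts the pole inside the
  rectangle.\<close>

lemma slit_contour:
  assumes c: "c > 0" and R: "R > \<bar>ln (c / (1 + c))\<bar>"
  shows "contour_integral (rectpath (Complex (- R) (- pi)) (Complex R pi)) (slit_fun \<alpha> c) =
     2 * pi * \<i> * of_real ((c / (1 + c)) powr (\<alpha> * c) / (1 + c))"
proof -
  let ?S = "{w. \<bar>Im w\<bar> < 2 * pi}" and ?w0 = "of_real (ln (c / (1 + c))) :: complex"
  let ?g = "rectpath (Complex (- R) (- pi)) (Complex R pi)"
  let ?N = "\<lambda>w. exp (- (of_real \<alpha> * todd w))" and ?D = "\<lambda>w. 1 + of_real c - of_real c * exp (- w) :: complex"
  have R0: "R > 0" using R by linarith
  have conv: "convex ?S"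
  proof -
    have "?S = {w. Im w < 2 * pi} \<inter> {w. Im w > - (2 * pi)}" by auto
    then show ?thesis by (auto intro: convex_Int convex_halfspace_Im_lt convex_halfspace_Im_gt)
  qed
  have N: "?N holomorphic_on ?S" by (intro holomorphic_intros todd_holomorphic)
  have D: "?D holomorphic_on ?S" by (intro holomorphic_intros)
  have sub: "cbox (Complex (- R) (- pi)) (Complex R pi) \<subseteq> ?S"
  proof
    fix x assume "x \<in> cbox (Complex (- R) (- pi)) (Complex R pi)"
    then have "- pi \<le> Im x" "Im x \<le> pi" by (auto simp: in_cbox_complex_iff)
    then have "\<bar>Im x\<bar> < 2 * pi" using pi_gt_zero by linarith
    then show "x \<in> ?S" by simp
  qed
  have e0: "of_real c * exp (- ?w0) = 1 + of_real c"
    unfolding exp_minus_of_real_ln[OF c] using c by simp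
  have res: "contour_integral ?g (slit_fun \<alpha> c) = 2 * pi * \<i> * (\<Sum>p\<in>{?w0}. winding_number ?g p * residue (slit_fun \<alpha> c) p)"
  proof (rule Residue_theorem)
    show "open ?S" by (rule open_strip)
    show "connected ?S" using conv by (rule convex_connected)
    show "slit_fun \<alpha> c holomorphic_on ?S - {?w0}"
      unfolding slit_fun_def
      by (intro holomorphic_on_divide holomorphic_on_subset[OF N] holomorphic_on_subset[OF D])
        (use slit_denom_zero[OF c] in auto)
    have "path_image ?g \<subseteq> cbox (Complex (- R) (- pi)) (Complex R pi)"
      using R0 by (intro path_image_rectpath_subset_cbox) auto
    moreover have "?w0 \<notin> path_image ?g"
      using R R0 pi_gt_zero by (auto simp: path_image_rectpath)
    ultimately show "path_image ?g \<subseteq> ?S - {?w0}" using sub by auto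
    show "\<forall>z. z \<notin> ?S \<longrightarrow> winding_number ?g z = 0"
      using sub R0 by (intro allI impI winding_number_rectpath_outside) auto
  qed auto
  have wn: "winding_number ?g ?w0 = 1"
    using R by (intro winding_number_rectpath) (auto simp: in_box_complex_iff)
  have rs: "residue (slit_fun \<alpha> c) ?w0 = ?N ?w0 / (1 + of_real c)"
    unfolding slit_fun_def
  proof (rule residue_simple_pole_deriv[OF N D open_strip convex_connected[OF conv]])
    show "(?D has_field_derivative (1 + of_real c)) (at ?w0)"
      by (rule derivative_eq_intros refl)+ (use e0 in \<open>simp add: algebra_simps\<close>)
    show "1 + of_real c \<noteq> (0::complex)" using c
      by (metis add_pos_pos of_real_1 of_real_add of_real_eq_0_iff order_less_irrefl zero_less_one)
  qed (use e0 in auto)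
  have nw: "?N ?w0 = of_real ((c / (1 + c)) powr (\<alpha> * c))"
    unfolding todd_of_real_ln[OF c] using c by (simp add: powr_def mult.assoc flip: exp_of_real of_real_mult of_real_minus)
  show ?thesis unfolding res by (simp add: wn rs nw)
qed

section \<open>Decay of \<open>slit_fun\<close> on the vertical sides of the rectangle\<close>

lemma norm_todd_right:
  assumes R: "R > 0" and w: "Re w = R" "\<bar>Im w\<bar> \<le> pi"
  shows "Re (todd w) \<ge> R - (R + pi) * exp (- R) / (1 - exp (- R))"
proof -
  have e1: "norm (exp (- w)) = exp (- R)" using w by simp
  have lt: "exp (- R) < 1" using R by simp
  have ne: "1 - exp (- w) \<noteq> 0" using e1 lt by (metis eq_iff_diff_eq_0 norm_one order_less_irrefl)
  have w0: "w \<noteq> 0" using w R by auto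
  have nw: "norm w \<le> R + pi" using cmod_le[of w] w R by simp
  have "1 - exp (- R) \<le> norm (1 - exp (- w))" using norm_triangle_ineq2[of 1 "exp (- w)"] e1 by simp
  then have "norm (w * exp (- w) / (1 - exp (- w))) \<le> (R + pi) * exp (- R) / (1 - exp (- R))"
    unfolding norm_divide norm_mult e1 using lt nw R by (intro frac_le mult_right_mono) auto
  \<comment> \<open>\<open>todd w\<close> differs from \<open>w\<close> by an exponentially small
    term, so its real part grows like \<open>R\<close> and the exponential in
    \<open>slit_fun\<close> decays.\<close>
  moreover have "todd w = w + w * exp (- w) / (1 - exp (- w))"
    using ne w0 by (simp add: todd_def field_simps)
  moreover have "\<bar>Re (w * exp (- w) / (1 - exp (- w)))\<bar> \<le> norm (w * exp (- w) / (1 - exp (- w)))"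
    by (rule abs_Re_le_cmod)
  ultimately show ?thesis using w by (simp add: abs_le_iff)
qed

lemma norm_slit_right:
  assumes "\<alpha> > 0" "c > 0" and R: "R > 0" and w: "Re w = R" "\<bar>Im w\<bar> \<le> pi"
  shows "norm (slit_fun \<alpha> c w) \<le> exp (- \<alpha> * (R - (R + pi) * exp (- R) / (1 - exp (- R))))"
proof -
  have e1: "norm (exp (- w)) = exp (- R)" using w by simp
  have "1 \<le> norm (1 + of_real c :: complex) - norm (of_real c * exp (- w))"
  proof -
    have "norm (1 + of_real c :: complex) = 1 + c" using assms(2)
      by (metis abs_of_pos add_pos_pos norm_of_real of_real_1 of_real_add zero_less_one)
    moreover have "c * exp (- R) \<le> c" using assms R by (simp add: mult_left_le)
    ultimately show ?thesis using assms(2) unfolding norm_mult e1 by simp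
  qed
  also have "\<dots> \<le> norm (1 + of_real c - of_real c * exp (- w))" by (rule norm_triangle_ineq2)
  finally have d: "1 \<le> norm (1 + of_real c - of_real c * exp (- w))" .
  have n: "norm (exp (- (of_real \<alpha> * todd w))) \<le> exp (- \<alpha> * (R - (R + pi) * exp (- R) / (1 - exp (- R))))"
    using norm_todd_right[OF R w] assms(1) by simp
  have "norm (slit_fun \<alpha> c w) \<le> exp (- \<alpha> * (R - (R + pi) * exp (- R) / (1 - exp (- R)))) / 1"
    unfolding slit_fun_def norm_divide using n d by (intro frac_le) auto
  then show ?thesis by simp
qed

text \<open>Here \<open>todd w\<close> tends to 0, so the numerator stays bounded and the decay
  comes from \<open>c * exp R\<close> in the denominator.\<close>

lemma norm_slit_left:
  assumes "\<alpha> > 0" "c > 0" and R: "R > 0" "c * exp R > 1 + c" and w: "Re w = - R" "\<bar>Im w\<bar> \<le> pi"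
  shows "norm (slit_fun \<alpha> c w) \<le> exp (\<alpha> * ((R + pi) / (exp R - 1))) / (c * exp R - (1 + c))"
proof -
  have e1: "norm (exp (- w)) = exp R" using w by simp
  have lt: "exp R > 1" using R by simp
  have w0: "w \<noteq> 0" using w R by auto
  have nw: "norm w \<le> R + pi" using cmod_le[of w] w R by simp
  have "exp R - 1 \<le> norm (exp (- w) - 1)" using norm_triangle_ineq2[of "exp (- w)" 1] e1 by simp
  also have "\<dots> = norm (1 - exp (- w))" by (rule norm_minus_commute)
  finally have "norm (todd w) \<le> (R + pi) / (exp R - 1)"
    unfolding todd_def using lt nw w0 R by (simp add: norm_divide frac_le)
  then have "\<bar>Re (todd w)\<bar> \<le> (R + pi) / (exp R - 1)" using abs_Re_le_cmod order_trans by blast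
  then have "\<alpha> * - ((R + pi) / (exp R - 1)) \<le> \<alpha> * Re (todd w)" using assms(1)
    by (intro mult_left_mono) auto
  then have n: "norm (exp (- (of_real \<alpha> * todd w))) \<le> exp (\<alpha> * ((R + pi) / (exp R - 1)))"
    by simp
  have "norm (1 + of_real c :: complex) = 1 + c" using assms(2)
    by (metis abs_of_pos add_pos_pos norm_of_real of_real_1 of_real_add zero_less_one)
  then have "c * exp R - (1 + c) = norm (of_real c * exp (- w)) - norm (1 + of_real c :: complex)"
    using assms(2) unfolding norm_mult e1 by simp
  also have "\<dots> \<le> norm (of_real c * exp (- w) - (1 + of_real c))" by (rule norm_triangle_ineq2)
  also have "\<dots> = norm (1 + of_real c - of_real c * exp (- w))" by (rule norm_minus_commute)
  finally show ?thesis unfolding slit_fun_def norm_divide using n R by (intro frac_le) auto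
qed

text \<open>On both edges of the strip \<open>exp (- w) = - exp (- x)\<close>, so \<zeta> is the
  logistic value \<open>y\<close>. The values of \<open>slit_fun\<close> on the two edges are
  complex conjugates, and this is their difference, lower minus upper, divided by
  \<open>2 * \<i>\<close>.\<close>

definition slit_jump :: "real \<Rightarrow> real \<Rightarrow> real \<Rightarrow> real" where
  "slit_jump \<alpha> c x = (let y = 1 / (1 + exp (- x)) in exp (- (\<alpha> * y * x)) * sin (pi * \<alpha> * y) * (y / (y + c)))"

lemma slit_fun_on_line:
  assumes "c > 0" and s: "\<bar>s\<bar> = 1"
  defines "y x \<equiv> 1 / (1 + exp (- x))"
  shows "slit_fun \<alpha> c (Complex x (s * pi)) =
     of_real (exp (- (\<alpha> * y x * x)) * (y x / (y x + c))) * (cos (pi * \<alpha> * y x) - \<i> * of_real s * sin (pi * \<alpha> * y x))"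
proof -
  have y0: "y x > 0" unfolding y_def by (intro divide_pos_pos add_pos_pos) auto
  have y1: "1 + exp (- x) = 1 / y x" by (simp add: y_def)
  have sc: "s = 1 \<or> s = -1" using s by linarith
  have e: "exp (- Complex x (s * pi)) = - of_real (exp (- x))"
    using sc by (auto simp: complex_eq_iff Re_exp Im_exp)
  have "todd (Complex x (s * pi)) = Complex x (s * pi) * of_real (y x)"
  proof -
    have "Complex x (s * pi) \<noteq> 0" using sc pi_gt_zero by (auto simp: complex_eq_iff)
    then have "todd (Complex x (s * pi)) = Complex x (s * pi) / of_real (1 + exp (- x))"
      unfolding todd_def e by simp
    then show ?thesis unfolding y1 using y0 by (simp add: field_simps)
  qed
  then have n: "exp (- (of_real \<alpha> * todd (Complex x (s * pi)))) =
      of_real (exp (- (\<alpha> * y x * x))) * (cos (pi * \<alpha> * y x) - \<i> * of_real s * sin (pi * \<alpha> * y x))"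
    using sc by (auto simp: complex_eq_iff Re_exp Im_exp mult_ac)
  have d: "1 + of_real c - of_real c * exp (- Complex x (s * pi)) = of_real ((y x + c) / y x)"
  proof -
    have "1 + of_real c - of_real c * exp (- Complex x (s * pi)) = of_real (1 + c * (1 + exp (- x)))"
      unfolding e by (simp add: algebra_simps)
    also have "1 + c * (1 + exp (- x)) = (y x + c) / y x" unfolding y1 using y0 by (simp add: field_simps)
    finally show ?thesis .
  qed
  show ?thesis unfolding slit_fun_def n d by (simp add: mult_ac)
qed

lemma slit_jump_eq:
  assumes "c > 0"
  shows "slit_fun \<alpha> c (Complex x (- pi)) - slit_fun \<alpha> c (Complex x pi) = 2 * \<i> * of_real (slit_jump \<alpha> c x)"
proof -
  define y where "y = 1 / (1 + exp (- x))"
  define E where "E = exp (- (\<alpha> * y * x)) * (y / (y + c))"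
  have j: "slit_jump \<alpha> c x = E * sin (pi * \<alpha> * y)"
    unfolding slit_jump_def Let_def y_def[symmetric] E_def by simp
  show ?thesis
    using slit_fun_on_line[OF assms, of "-1" \<alpha> x, folded y_def, folded E_def] slit_fun_on_line[OF assms, of 1 \<alpha> x, folded y_def, folded E_def]
    unfolding j by (simp add: algebra_simps)
qed

lemma integral_linepath_horizontal:
  assumes ab: "a < b" and f: "continuous_on (closed_segment (Complex a y) (Complex b y)) f"
  shows "contour_integral (linepath (Complex a y) (Complex b y)) f = integral {a..b} (\<lambda>x. f (Complex x y))"
proof -
  let ?I = "integral {a..b} (\<lambda>x. f (Complex x y))" and ?g = "\<lambda>w. f (w + \<i> * of_real y)"
  have shift: "of_real x + \<i> * of_real y = Complex x y" for x by (simp add: complex_eq_iff)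
  have "((\<lambda>x. f (Complex x y)) has_integral ?I) {a..b}"
  proof (intro integrable_integral integrable_continuous_interval continuous_on_compose2[OF f])
    show "continuous_on {a..b} (\<lambda>x. Complex x y)"
      by (simp add: Complex_eq continuous_intros)
    show "(\<lambda>x. Complex x y) ` {a..b} \<subseteq> closed_segment (Complex a y) (Complex b y)"
      using ab by (auto simp: closed_segment_same_Im closed_segment_eq_real_ivl)
  qed
  then have "(?g has_contour_integral ?I) (linepath (of_real a) (of_real b))"
    using ab by (subst has_contour_integral_linepath_Reals_iff) (auto simp: shift)
  then have "(f has_contour_integral ?I) (linepath (Complex a y) (Complex b y))"
    unfolding has_contour_integral_linepath shift[symmetric] by (simp add: linepath_def algebra_simps)
  then show ?thesis by (rule contour_integral_unique)
qed

lemma slit_jump_continuous: "c > 0 \<Longrightarrow> continuous_on S (slit_jump \<alpha> c)"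
proof -
  assume c: "c > 0"
  have p: "1 + exp (- x) > 0" for x :: real by (simp add: add_pos_pos)
  have "1 / (1 + exp (- x)) + c \<noteq> 0" for x :: real
    using p[of x] c by (metis add_pos_pos divide_pos_pos less_irrefl zero_less_one)
  then show ?thesis using p unfolding slit_jump_def Let_def
    by (intro continuous_intros) (auto simp: less_imp_neq[symmetric])
qed

text \<open>With \<open>\<alpha> \<le> 1\<close> the angle \<open>pi * \<alpha> * y\<close> stays in
  [0, pi]; for larger \<alpha> the sine changes sign near \<open>y = 1\<close>.\<close>

lemma slit_jump_nonneg:
  assumes "0 < \<alpha>" "\<alpha> \<le> 1" "c > 0"
  shows "slit_jump \<alpha> c x \<ge> 0"
proof -
  define y where "y = 1 / (1 + exp (- x))"
  have "1 + exp (- x) > 0" by (simp add: add_pos_pos)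
  then have y: "0 < y" "y < 1" unfolding y_def by (auto simp: divide_less_eq)
  have "\<alpha> * y \<le> 1" using mult_mono[of \<alpha> 1 y 1] assms y by simp
  then have "pi * (\<alpha> * y) \<le> pi * 1" by (intro mult_left_mono) auto
  then have "sin (pi * \<alpha> * y) \<ge> 0" using y assms by (intro sin_ge_zero) (auto simp: mult.assoc)
  then show ?thesis unfolding slit_jump_def Let_def y_def[symmetric] using y assms by simp
qed

text \<open>The horizontal sides combine to \<open>2 * \<i>\<close> times the integral of the jump,
  since the upper one is traversed backwards, and the residue supplies the limit. The error comes
  from the vertical sides, each of length \<open>2 * pi\<close>, halved on dividing by
  \<open>2 * \<i>\<close>.\<close>

lemma slit_jump_integral_eq:
  assumes a: "\<alpha> > 0" and c: "c > 0" and R: "R > \<bar>ln (c / (1 + c))\<bar>" "c * exp R > 1 + c"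
  shows "\<bar>integral {- R..R} (slit_jump \<alpha> c) - pi * ((c / (1 + c)) powr (\<alpha> * c) / (1 + c))\<bar> \<le>
     pi * (exp (- \<alpha> * (R - (R + pi) * exp (- R) / (1 - exp (- R)))) +
       exp (\<alpha> * ((R + pi) / (exp R - 1))) / (c * exp R - (1 + c)))"
proof -
  let ?f = "slit_fun \<alpha> c"
  define a1 a2 a3 a4 where "a1 = Complex (- R) (- pi)" and "a2 = Complex R (- pi)" and "a3 = Complex R pi" and "a4 = Complex (- R) pi"
  note ad = a1_def a2_def a3_def a4_def
  define B1 where "B1 = exp (- \<alpha> * (R - (R + pi) * exp (- R) / (1 - exp (- R))))"
  define B2 where "B2 = exp (\<alpha> * ((R + pi) / (exp R - 1))) / (c * exp R - (1 + c))"
  have R0: "R > 0" using R by linarith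
  have B: "B1 \<ge> 0" "B2 \<ge> 0" using R(2) unfolding B1_def B2_def by auto
  have hol: "?f holomorphic_on {w. \<bar>Im w\<bar> < 2 * pi} - {of_real (ln (c / (1 + c)))}"
    unfolding slit_fun_def
    by (intro holomorphic_intros holomorphic_on_subset[OF todd_holomorphic]) (use slit_denom_zero[OF c] in auto)
  have pp: "pi < 2 * pi" using pi_gt_zero by linarith
  have pin: "path_image (rectpath a1 a3) \<subseteq> {w. \<bar>Im w\<bar> < 2 * pi} - {of_real (ln (c / (1 + c)))}"
  proof
    fix w assume "w \<in> path_image (rectpath a1 a3)"
    then have 1: "(Re w = - R \<or> Re w = R) \<and> \<bar>Im w\<bar> \<le> pi \<or> (Im w = - pi \<or> Im w = pi)"
      using R0 by (auto simp: path_image_rectpath ad)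
    then have "\<bar>Im w\<bar> \<le> pi" by auto
    then have 2: "\<bar>Im w\<bar> < 2 * pi" using pp by linarith
    show "w \<in> {w. \<bar>Im w\<bar> < 2 * pi} - {of_real (ln (c / (1 + c)))}"
      using 1 2 R R0 pi_gt_zero by auto
  qed
  have cont: "continuous_on (path_image (rectpath a1 a3)) ?f"
    by (rule holomorphic_on_imp_continuous_on[OF holomorphic_on_subset[OF hol pin]])
  have pim: "path_image (rectpath a1 a3) = closed_segment a1 a2 \<union> closed_segment a2 a3 \<union> closed_segment a3 a4 \<union> closed_segment a4 a1"
    by (simp add: rectpath_def Let_def path_image_join ad Un_assoc)
  have cs: "continuous_on (closed_segment a1 a2) ?f" "continuous_on (closed_segment a2 a3) ?f"
     "continuous_on (closed_segment a3 a4) ?f" "continuous_on (closed_segment a4 a1) ?f"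
    by (rule continuous_on_subset[OF cont], use pim in blast)+
  note ci = cs[THEN contour_integrable_continuous_linepath]
  have "contour_integral (rectpath a1 a3) ?f = contour_integral (linepath a1 a2) ?f + contour_integral (linepath a2 a3) ?f
     + contour_integral (linepath a3 a4) ?f + contour_integral (linepath a4 a1) ?f"
    using ci unfolding rectpath_def Let_def ad by simp
  moreover have "contour_integral (linepath a1 a2) ?f = integral {- R..R} (\<lambda>x. ?f (Complex x (- pi)))"
    unfolding ad by (rule integral_linepath_horizontal) (use R0 cs(1) in \<open>auto simp: ad\<close>)
  moreover have "contour_integral (linepath a3 a4) ?f = - contour_integral (linepath a4 a3) ?f"
    using contour_integral_reversepath[of "linepath a4 a3" ?f] by simp
  moreover have "contour_integral (linepath a4 a3) ?f = integral {- R..R} (\<lambda>x. ?f (Complex x pi))"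
    unfolding ad by (rule integral_linepath_horizontal) (use R0 cs(3) in \<open>auto simp: ad closed_segment_commute\<close>)
  moreover have "contour_integral (rectpath a1 a3) ?f = 2 * pi * \<i> * of_real ((c / (1 + c)) powr (\<alpha> * c) / (1 + c))"
    unfolding ad by (rule slit_contour[OF c R(1)])
  moreover have "integral {- R..R} (\<lambda>x. ?f (Complex x (- pi))) - integral {- R..R} (\<lambda>x. ?f (Complex x pi))
     = 2 * \<i> * of_real (integral {- R..R} (slit_jump \<alpha> c))"
  proof -
    have cc: "continuous_on {- R..R} (\<lambda>x. Complex x y)" for y by (simp add: Complex_eq continuous_intros)
    have i1: "(\<lambda>x. ?f (Complex x (- pi))) integrable_on {- R..R}"
      by (intro integrable_continuous_interval continuous_on_compose2[OF cs(1) cc])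
        (auto simp: ad closed_segment_same_Im closed_segment_eq_real_ivl)
    have i2: "(\<lambda>x. ?f (Complex x pi)) integrable_on {- R..R}"
      by (intro integrable_continuous_interval continuous_on_compose2[OF cs(3) cc])
        (auto simp: ad closed_segment_same_Im closed_segment_eq_real_ivl)
    have ij: "slit_jump \<alpha> c integrable_on {- R..R}"
      by (intro integrable_continuous_interval slit_jump_continuous c)
    have "((\<lambda>x. of_real (slit_jump \<alpha> c x)) has_integral (of_real (integral {- R..R} (slit_jump \<alpha> c)) :: complex)) {- R..R}"
      using ij by (intro has_integral_of_real) (simp add: has_integral_integral)
    then have "((\<lambda>x. 2 * \<i> * of_real (slit_jump \<alpha> c x)) has_integral 2 * \<i> * of_real (integral {- R..R} (slit_jump \<alpha> c))) {- R..R}"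
      by (rule has_integral_mult_right)
    then have "integral {- R..R} (\<lambda>x. 2 * \<i> * of_real (slit_jump \<alpha> c x)) = 2 * \<i> * of_real (integral {- R..R} (slit_jump \<alpha> c))"
      by (rule integral_unique)
    then show ?thesis using i1 i2 by (simp add: integral_diff[symmetric] slit_jump_eq[OF c])
  qed
  ultimately have eq: "2 * \<i> * of_real (integral {- R..R} (slit_jump \<alpha> c) - pi * ((c / (1 + c)) powr (\<alpha> * c) / (1 + c))) =
     - (contour_integral (linepath a2 a3) ?f + contour_integral (linepath a4 a1) ?f)"
    by (simp add: algebra_simps)
  have n1: "norm (contour_integral (linepath a2 a3) ?f) \<le> B1 * norm (a3 - a2)"
  proof (rule contour_integral_bound_linepath[OF ci(2) B(1)])
    fix x assume "x \<in> closed_segment a2 a3"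
    then have "Re x = R" "\<bar>Im x\<bar> \<le> pi" by (auto simp: ad closed_segment_same_Re closed_segment_eq_real_ivl split: if_splits)
    from norm_slit_right[OF a c R0 this] show "norm (?f x) \<le> B1" unfolding B1_def .
  qed
  have n2: "norm (contour_integral (linepath a4 a1) ?f) \<le> B2 * norm (a1 - a4)"
  proof (rule contour_integral_bound_linepath[OF ci(4) B(2)])
    fix x assume "x \<in> closed_segment a4 a1"
    then have "Re x = - R" "\<bar>Im x\<bar> \<le> pi" by (auto simp: ad closed_segment_same_Re closed_segment_eq_real_ivl split: if_splits)
    from norm_slit_left[OF a c R0 R(2) this] show "norm (?f x) \<le> B2" unfolding B2_def .
  qed
  have d: "norm (a3 - a2) = 2 * pi" "norm (a1 - a4) = 2 * pi"
  proof -
    have "a3 - a2 = \<i> * of_real (2 * pi)" "a1 - a4 = \<i> * of_real (- 2 * pi)" by (auto simp: ad complex_eq_iff)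
    then show "norm (a3 - a2) = 2 * pi" "norm (a1 - a4) = 2 * pi" by (simp_all add: norm_mult)
  qed
  have "2 * \<bar>integral {- R..R} (slit_jump \<alpha> c) - pi * ((c / (1 + c)) powr (\<alpha> * c) / (1 + c))\<bar> =
     norm (- (contour_integral (linepath a2 a3) ?f + contour_integral (linepath a4 a1) ?f))"
    unfolding eq[symmetric] norm_mult norm_of_real by simp
  also have "\<dots> \<le> norm (contour_integral (linepath a2 a3) ?f) + norm (contour_integral (linepath a4 a1) ?f)"
    unfolding norm_minus_cancel by (rule norm_triangle_ineq)
  also have "\<dots> \<le> 2 * (pi * (B1 + B2))" using n1 n2 unfolding d by (simp add: algebra_simps)
  finally show ?thesis unfolding B1_def B2_def by simp
qed

text \<open>Nonnegativity makes the truncations to [-n, n] increase, so the convergence of their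
  integrals yields integrability and the value together.\<close>

lemma slit_jump_integral:
  assumes a: "0 < \<alpha>" "\<alpha> \<le> 1" and c: "c > 0"
  shows "integrable lborel (slit_jump \<alpha> c)"
    and "(\<integral>x. slit_jump \<alpha> c x \<partial>lborel) = pi * ((c / (1 + c)) powr (\<alpha> * c) / (1 + c))"
proof -
  define L where "L = pi * ((c / (1 + c)) powr (\<alpha> * c) / (1 + c))"
  define B where "B = (\<lambda>R. pi * (exp (- \<alpha> * (R - (R + pi) * exp (- R) / (1 - exp (- R)))) +
       exp (\<alpha> * ((R + pi) / (exp R - 1))) / (c * exp R - (1 + c))))"
  have B0: "(\<lambda>n::nat. B (real n)) \<longlonglongrightarrow> 0"
  proof -
    have "filterlim (\<lambda>n::nat. real n - (real n + pi) * exp (- real n) / (1 - exp (- real n))) at_top sequentially"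
      by real_asymp
    then have "filterlim (\<lambda>n::nat. \<alpha> * (real n - (real n + pi) * exp (- real n) / (1 - exp (- real n)))) at_top sequentially"
      using a(1) by (intro filterlim_tendsto_pos_mult_at_top[OF tendsto_const])
    then have 1: "(\<lambda>n::nat. exp (- \<alpha> * (real n - (real n + pi) * exp (- real n) / (1 - exp (- real n))))) \<longlonglongrightarrow> 0"
      by (intro filterlim_compose[OF exp_at_bot]) (simp add: filterlim_uminus_at_top)
    have "(\<lambda>n::nat. (real n + pi) / (exp (real n) - 1)) \<longlonglongrightarrow> 0" by real_asymp
    then have 2: "(\<lambda>n::nat. exp (\<alpha> * ((real n + pi) / (exp (real n) - 1)))) \<longlonglongrightarrow> exp (\<alpha> * 0)"
      by (intro tendsto_intros)
    have 3: "filterlim (\<lambda>n::nat. c * exp (real n) - (1 + c)) at_top sequentially" using c by real_asymp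
    have "(\<lambda>n::nat. B (real n)) \<longlonglongrightarrow> pi * (0 + 0)"
      unfolding B_def
      by (intro tendsto_intros 1 real_tendsto_divide_at_top[OF 2 3])
    then show ?thesis by simp
  qed
  have ev: "\<forall>\<^sub>F n in sequentially. norm (integral {- real n..real n} (slit_jump \<alpha> c) - L) \<le> B (real n)"
  proof -
    have "\<forall>\<^sub>F n in sequentially. real n > \<bar>ln (c / (1 + c))\<bar>" by real_asymp
    moreover have "\<forall>\<^sub>F n in sequentially. c * exp (real n) > 1 + c" using c by real_asymp
    ultimately show ?thesis
      unfolding L_def B_def real_norm_def by eventually_elim (rule slit_jump_integral_eq[OF a(1) c])
  qed
  have "(\<lambda>n. integral {- real n..real n} (slit_jump \<alpha> c) - L) \<longlonglongrightarrow> 0"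
    by (rule Lim_null_comparison[OF ev B0])
  then have lim: "(\<lambda>n. integral {- real n..real n} (slit_jump \<alpha> c)) \<longlonglongrightarrow> L"
    by (simp add: LIM_zero_iff)
  let ?g = "\<lambda>(n::nat) x. indicator {- real n..real n} x *\<^sub>R slit_jump \<alpha> c x"
  have meas: "slit_jump \<alpha> c \<in> borel_measurable borel"
    by (rule borel_measurable_continuous_onI) (rule slit_jump_continuous[OF c])
  have int: "integrable lborel (?g n)" for n
    using borel_integrable_atLeastAtMost'[OF slit_jump_continuous[OF c], of "- real n" "real n" \<alpha>]
    by (simp add: set_integrable_def)
  have inteq: "(\<integral>x. ?g n x \<partial>lborel) = integral {- real n..real n} (slit_jump \<alpha> c)" for n
    using set_borel_integral_eq_integral(2)[of "{- real n..real n}" "slit_jump \<alpha> c"] int[of n]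
    by (simp add: set_lebesgue_integral_def set_integrable_def)
  have mono: "AE x in lborel. mono (\<lambda>n. ?g n x)"
    using slit_jump_nonneg[OF a c] by (intro AE_I2 monoI) (auto simp: indicator_def)
  have pw: "AE x in lborel. (\<lambda>n. ?g n x) \<longlonglongrightarrow> slit_jump \<alpha> c x"
  proof (rule AE_I2)
    fix x
    obtain n0 :: nat where "\<bar>x\<bar> \<le> real n0" using real_arch_simple by blast
    then have "\<forall>n\<ge>n0. ?g n x = slit_jump \<alpha> c x" by (auto simp: indicator_def)
    then have "\<forall>\<^sub>F n in sequentially. ?g n x = slit_jump \<alpha> c x"
      unfolding eventually_sequentially by blast
    then show "(\<lambda>n. ?g n x) \<longlonglongrightarrow> slit_jump \<alpha> c x" by (rule tendsto_eventually)
  qed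
  show "integrable lborel (slit_jump \<alpha> c)"
    by (rule integrable_monotone_convergence[OF int mono pw]) (use lim meas in \<open>simp_all only: inteq, simp\<close>)
  show "(\<integral>x. slit_jump \<alpha> c x \<partial>lborel) = pi * ((c / (1 + c)) powr (\<alpha> * c) / (1 + c))"
    unfolding L_def[symmetric]
    by (rule integral_monotone_convergence[OF int mono pw]) (use lim meas in \<open>simp_all only: inteq, simp\<close>)
qed

lemma einterval_01: "einterval 0 1 = {0<..<1}"
  unfolding zero_ereal_def one_ereal_def by (rule einterval_eq(1))

text \<open>The logistic substitution \<open>y = g x\<close> returns from the strip to the unit
  interval: \<open>y / (1 - y)\<close> is \<open>exp x\<close>, and \<open>g' = g * (1 - g)\<close>
  cancels the factor \<open>1 - y\<close> in the denominator of \<open>f\<close>.\<close>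

lemma slit_stieltjes:
  assumes a: "0 < \<alpha>" "\<alpha> \<le> 1" and c: "c > 0"
  defines "f \<equiv> \<lambda>y. (y / (1 - y)) powr (- \<alpha> * y) * sin (pi * \<alpha> * y) / ((1 - y) * (y + c))"
  shows "set_integrable lborel {0<..<1} f"
    and "(LINT y:{0<..<1}|lborel. f y) = pi * ((c / (1 + c)) powr (\<alpha> * c) / (1 + c))"
proof -
  define g where "g = (\<lambda>x::real. 1 / (1 + exp (- x)))"
  define g' where "g' = (\<lambda>x::real. exp (- x) / (1 + exp (- x)) ^ 2)"
  have p: "1 + exp (- x) > 0" for x :: real by (simp add: add_pos_pos)
  have g: "0 < g x" "g x < 1" for x using p[of x] unfolding g_def by (auto simp: divide_less_eq)
  have g'g: "g' x = g x * (1 - g x)" for x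
    using p[of x] unfolding g'_def g_def by (simp add: divide_simps power2_eq_square)
  have gx: "g x / (1 - g x) = exp x" for x
    using p[of x] unfolding g_def by (simp add: divide_simps exp_minus)
  have fg: "f (g x) * g' x = slit_jump \<alpha> c x" for x
  proof -
    have "f (g x) * g' x = exp (- (\<alpha> * g x * x)) * sin (pi * \<alpha> * g x) / ((1 - g x) * (g x + c)) * (g x * (1 - g x))"
      unfolding f_def gx g'g by (simp add: powr_def mult_ac)
    also have "\<dots> = exp (- (\<alpha> * g x * x)) * sin (pi * \<alpha> * g x) * (g x / (g x + c))"
      using g[of x] by simp
    finally show ?thesis unfolding slit_jump_def Let_def g_def .
  qed
  have d: "DERIV g x :> g' x" for x
    unfolding g_def g'_def
    by (rule derivative_eq_intros refl)+ (use p[of x] in \<open>auto simp: power2_eq_square\<close>)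
  have cf: "isCont f (g x)" for x
    unfolding f_def using g[of x] c by (intro continuous_intros) auto
  have cg': "isCont g' x" for x
    unfolding g'_def using p[of x] by (intro continuous_intros) auto
  have A: "((ereal \<circ> g \<circ> real_of_ereal) \<longlongrightarrow> 0) (at_right (- \<infinity>))"
  proof -
    have "(g \<longlongrightarrow> 0) at_bot" unfolding g_def by real_asymp
    then show ?thesis unfolding zero_ereal_def by (simp add: ereal_tendsto_simps)
  qed
  have B: "((ereal \<circ> g \<circ> real_of_ereal) \<longlongrightarrow> 1) (at_left \<infinity>)"
  proof -
    have "(g \<longlongrightarrow> 1) at_top" unfolding g_def by real_asymp
    then show ?thesis unfolding one_ereal_def by (simp add: ereal_tendsto_simps)
  qed
  have f0: "0 \<le> f (g x)" for x
  proof -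
    have "0 \<le> f (g x) * g' x" unfolding fg by (rule slit_jump_nonneg[OF a c])
    moreover have "g' x > 0" unfolding g'g using g[of x] by simp
    ultimately show ?thesis by (simp add: zero_le_mult_iff)
  qed
  have int: "set_integrable lborel (einterval (- \<infinity>) \<infinity>) (\<lambda>x. f (g x) * g' x)"
    unfolding fg using slit_jump_integral(1)[OF a c] by (simp add: set_integrable_def)
  have g'0: "0 \<le> g' x" for x unfolding g'_def by simp
  note sub = interval_integral_substitution_nonneg[where a="-\<infinity>" and b="\<infinity>" and g=g and g'=g' and f=f,
      OF _ d cf cg' f0 g'0 A B int]
  show "set_integrable lborel {0<..<1} f" using sub(1) by (simp add: einterval_01)
  have "(LBINT y=0..1. f y) = (LBINT x=-\<infinity>..\<infinity>. slit_jump \<alpha> c x)" using sub(2) unfolding fg by simp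
  then show "(LINT y:{0<..<1}|lborel. f y) = pi * ((c / (1 + c)) powr (\<alpha> * c) / (1 + c))"
    using slit_jump_integral(2)[OF a c]
    by (simp add: interval_lebesgue_integral_def einterval_01 set_lebesgue_integral_def)
qed

section \<open>The transform of the function vartheta\<close>

lemma nn_integral_powr_left:
  fixes a b p :: real
  assumes "p > 0" "a \<le> b"
  shows "(\<integral>\<^sup>+x. ennreal (indicator {a<..<b} x * (x - a) powr (p - 1)) \<partial>lborel) = ennreal ((b - a) powr p / p)"
proof -
  have "((\<lambda>x. x powr (p - 1)) has_integral ((b - a) powr (p - 1 + 1) / (p - 1 + 1))) {0..b - a}"
    using assms by (intro has_integral_powr_from_0) auto
  then have "(\<integral>\<^sup>+x. ennreal (indicator {0..b - a} x * x powr (p - 1)) \<partial>lborel) = ennreal ((b - a) powr p / p)"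
    using nn_integral_has_integral_lebesgue[of "{0..b - a}" "\<lambda>x. x powr (p - 1)"] by simp
  also have "(\<integral>\<^sup>+x. ennreal (indicator {0..b - a} x * x powr (p - 1)) \<partial>lborel) =
     (\<integral>\<^sup>+x. ennreal (indicator {0<..<b - a} x * x powr (p - 1)) \<partial>lborel)"
    by (intro nn_integral_cong_AE AE_I[where N="{0, b - a}"]) (auto simp: indicator_def split: if_splits intro!: emeasure_lborel_countable)
  also have "\<dots> = (\<integral>\<^sup>+x. ennreal (indicator {0<..<b - a} (- a + 1 * x) * (- a + 1 * x) powr (p - 1)) \<partial>lborel)"
    by (subst nn_integral_real_affine[where c=1 and t="- a"]) auto
  also have "\<dots> = (\<integral>\<^sup>+x. ennreal (indicator {a<..<b} x * (x - a) powr (p - 1)) \<partial>lborel)"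
    by (intro nn_integral_cong) (auto simp: indicator_def)
  finally show ?thesis by simp
qed

lemma nn_integral_powr_right:
  fixes a b p :: real
  assumes "p > 0" "a \<le> b"
  shows "(\<integral>\<^sup>+x. ennreal (indicator {a<..<b} x * (b - x) powr (p - 1)) \<partial>lborel) = ennreal ((b - a) powr p / p)"
proof -
  have "(\<integral>\<^sup>+x. ennreal (indicator {a<..<b} x * (b - x) powr (p - 1)) \<partial>lborel) =
    (\<integral>\<^sup>+x. ennreal (indicator {a<..<b} (0 + (-1) * x) * (b - (0 + (-1) * x)) powr (p - 1)) \<partial>lborel)"
    by (subst nn_integral_real_affine[where c="-1" and t=0]) auto
  also have "\<dots> = (\<integral>\<^sup>+x. ennreal (indicator {-b<..<-a} x * (x - (-b)) powr (p - 1)) \<partial>lborel)"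
    by (intro nn_integral_cong) (auto simp: indicator_def add.commute)
  also have "\<dots> = ennreal ((b - a) powr p / p)" using nn_integral_powr_left[of p "-b" "-a"] assms by simp
  finally show ?thesis .
qed

lemma integrable_powr_right:
  fixes a b p :: real
  assumes "p > 0" "a \<le> b"
  shows "integrable lborel (\<lambda>x. indicator {a<..<b} x * (b - x) powr (p - 1))"
  using nn_integral_powr_right[OF assms] by (intro integrableI_nonneg) auto

lemma integrable_powr_left:
  fixes a b p :: real
  assumes "p > 0" "a \<le> b"
  shows "integrable lborel (\<lambda>x. indicator {a<..<b} x * (x - a) powr (p - 1))"
  using nn_integral_powr_left[OF assms] by (intro integrableI_nonneg) auto

text \<open>The bracket in the definition of \<^const>\<open>vartheta\<close>, together with its prefactor, is the derivative of
  \<open>vt_prim\<close>.\<close>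

definition vt_prim :: "real \<Rightarrow> real \<Rightarrow> real" where
  "vt_prim \<alpha> y = exp \<alpha> / pi * (exp (- \<alpha> * (y * ln y + (1 - y) * ln (1 - y))) * sin (pi * \<alpha> * y))"

definition vt_deriv :: "real \<Rightarrow> real \<Rightarrow> real" where
  "vt_deriv \<alpha> y = \<alpha> * exp \<alpha> * (y powr (- \<alpha> * y) * (1 - y) powr (- \<alpha> * (1 - y))
        * (cos (pi * \<alpha> * y) - 1 / pi * sin (pi * \<alpha> * y) * ln (y / (1 - y))))"

lemma vt_deriv_measurable [measurable]: "vt_deriv \<alpha> \<in> borel_measurable borel"
  unfolding vt_deriv_def by measurable

lemma vt_prim_deriv:
  assumes "0 < y" "y < 1"
  shows "(vt_prim \<alpha> has_real_derivative vt_deriv \<alpha> y) (at y)"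
proof -
  define E where "E = exp (- \<alpha> * (y * ln y + (1 - y) * ln (1 - y)))"
  have E: "y powr (- \<alpha> * y) * (1 - y) powr (- \<alpha> * (1 - y)) = E"
    using assms by (simp add: E_def powr_def exp_add[symmetric] algebra_simps)
  have 1: "((\<lambda>y. y * ln y + (1 - y) * ln (1 - y)) has_real_derivative (ln y - ln (1 - y))) (at y)"
    using assms by (auto intro!: derivative_eq_intros)
  have 2: "((\<lambda>y. exp (- \<alpha> * (y * ln y + (1 - y) * ln (1 - y)))) has_real_derivative E * (- \<alpha> * (ln y - ln (1 - y)))) (at y)"
    unfolding E_def by (rule DERIV_fun_exp[OF DERIV_cmult[OF 1]])
  have 3: "((\<lambda>y. sin (pi * \<alpha> * y)) has_real_derivative cos (pi * \<alpha> * y) * (pi * \<alpha>)) (at y)"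
    by (auto intro!: derivative_eq_intros)
  have "(vt_prim \<alpha> has_real_derivative exp \<alpha> / pi * (E * (- \<alpha> * (ln y - ln (1 - y))) * sin (pi * \<alpha> * y)
       + cos (pi * \<alpha> * y) * (pi * \<alpha>) * E)) (at y)"
    unfolding vt_prim_def using DERIV_cmult[OF DERIV_mult[OF 2 3], of "exp \<alpha> / pi"] by (simp add: E_def)
  also have "exp \<alpha> / pi * (E * (- \<alpha> * (ln y - ln (1 - y))) * sin (pi * \<alpha> * y)
       + cos (pi * \<alpha> * y) * (pi * \<alpha>) * E) = vt_deriv \<alpha> y"
    unfolding vt_deriv_def E using assms by (simp add: ln_div field_simps)
  finally show ?thesis .
qed

section \<open>Boundedness and continuity of \<open>vartheta\<close>\<close>

lemma neg_ln_le_powr: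
  fixes t p :: real
  assumes "t > 0" "p > 0"
  shows "- ln t \<le> t powr (- p) / p"
proof -
  have "ln (t powr (- p)) \<le> t powr (- p) - 1" using assms by (intro ln_le_minus_one) simp
  then have "p * (- ln t) \<le> t powr (- p)" using assms by (simp add: ln_powr)
  then show ?thesis using assms by (simp add: field_simps)
qed

lemma x_neg_ln_le_one:
  fixes x :: real
  assumes "0 < x"
  shows "- (x * ln x) \<le> 1"
proof -
  have "- ln x \<le> x powr (- 1) / 1" using assms by (rule neg_ln_le_powr) simp
  then have "- ln x \<le> 1 / x" using assms by (simp add: powr_minus divide_inverse)
  then show ?thesis using assms by (simp add: field_simps)
qed

text \<open>At \<open>y = 0\<close> the sine vanishes and absorbs \<open>ln y\<close>. At
  \<open>y = 1\<close> the logarithm may survive and is traded for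
  \<open>(1 - y) powr (- \<alpha> / 2)\<close>, mild enough to leave the integrable exponent
  \<open>\<alpha> / 2 - 1\<close> next to a factor of exponent \<open>\<alpha> - 1\<close>. The
  constant collects \<open>exp 1\<close> for the prefactor, \<open>exp 2\<close> for the entropy
  factor \<open>E\<close> and \<open>4 / \<alpha>\<close> for the bracket.\<close>

lemma vt_deriv_bound:
  assumes a: "0 < \<alpha>" "\<alpha> \<le> 1" and y: "0 < y" "y < 1"
  shows "\<bar>vt_deriv \<alpha> y\<bar> \<le> (4 * exp 3 / \<alpha>) * (1 - y) powr (- \<alpha> / 2)"
proof -
  define E where "E = y powr (- \<alpha> * y) * (1 - y) powr (- \<alpha> * (1 - y))"
  define P where "P = (1 - y) powr (- \<alpha> / 2)"
  have P1: "P \<ge> 1"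
  proof -
    have "(1 - y) powr (\<alpha> / 2) \<le> 1" "(1 - y) powr (\<alpha> / 2) > 0" using y a by (auto intro: powr_le1)
    then have "1 \<le> inverse ((1 - y) powr (\<alpha> / 2))" by (simp add: one_le_inverse)
    then show ?thesis unfolding P_def by (simp add: powr_minus[symmetric])
  qed
  have E0: "E \<ge> 0" unfolding E_def by simp
  have "E = exp (\<alpha> * (- (y * ln y)) + \<alpha> * (- ((1 - y) * ln (1 - y))))"
    using y by (simp add: E_def powr_def exp_add[symmetric] algebra_simps)
  also have "\<dots> \<le> exp (1 * 1 + 1 * 1)"
  proof (subst exp_le_cancel_iff, rule add_mono)
    have "0 \<le> - (y * ln y)" using y by (simp add: mult_le_0_iff)
    then show "\<alpha> * - (y * ln y) \<le> 1 * 1" using x_neg_ln_le_one[of y] y a by (intro mult_mono) auto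
    have "0 \<le> - ((1 - y) * ln (1 - y))" using y by (simp add: mult_le_0_iff)
    then show "\<alpha> * - ((1 - y) * ln (1 - y)) \<le> 1 * 1" using x_neg_ln_le_one[of "1 - y"] y a by (intro mult_mono) auto
  qed
  finally have E2: "E \<le> exp 2" by simp
  have s1: "\<bar>sin (pi * \<alpha> * y) * ln y\<bar> \<le> pi"
  proof -
    have "\<bar>sin (pi * \<alpha> * y)\<bar> \<le> \<bar>pi * \<alpha> * y\<bar>" by (rule abs_sin_x_le_abs_x)
    then have "\<bar>sin (pi * \<alpha> * y)\<bar> * \<bar>ln y\<bar> \<le> \<bar>pi * \<alpha> * y\<bar> * \<bar>ln y\<bar>" by (rule mult_right_mono) simp
    also have "\<dots> = (pi * \<alpha>) * (- (y * ln y))" using y a by (simp add: abs_mult)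
    also have "\<dots> \<le> (pi * \<alpha>) * 1" using x_neg_ln_le_one[of y] y a by (intro mult_left_mono) auto
    also have "\<dots> \<le> pi" using a by simp
    finally show ?thesis by (simp add: abs_mult)
  qed
  have s2: "\<bar>sin (pi * \<alpha> * y) * ln (1 - y)\<bar> \<le> 2 / \<alpha> * P"
  proof -
    have "\<bar>sin (pi * \<alpha> * y)\<bar> * \<bar>ln (1 - y)\<bar> \<le> 1 * \<bar>ln (1 - y)\<bar>" by (intro mult_right_mono) auto
    also have "\<dots> = - ln (1 - y)" using y by simp
    also have "\<dots> \<le> (1 - y) powr (- (\<alpha> / 2)) / (\<alpha> / 2)" using y a by (intro neg_ln_le_powr) auto
    finally show ?thesis by (simp add: P_def abs_mult mult.commute)
  qed
  have "\<bar>1 / pi * sin (pi * \<alpha> * y) * ln (y / (1 - y))\<bar> = 1 / pi * \<bar>sin (pi * \<alpha> * y) * ln y - sin (pi * \<alpha> * y) * ln (1 - y)\<bar>"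
    using y by (simp add: ln_div abs_mult right_diff_distrib[symmetric])
  also have "\<dots> \<le> 1 / pi * (pi + 2 / \<alpha> * P)"
    using s1 s2 by (intro mult_left_mono) auto
  also have "\<dots> \<le> 1 + 2 / \<alpha> * P"
  proof -
    have "1 / pi * (2 / \<alpha> * P) \<le> 1 * (2 / \<alpha> * P)"
      using P1 a pi_ge_two by (intro mult_right_mono) auto
    then show ?thesis by (simp add: distrib_left)
  qed
  finally have "\<bar>cos (pi * \<alpha> * y) - 1 / pi * sin (pi * \<alpha> * y) * ln (y / (1 - y))\<bar> \<le> 1 + (1 + 2 / \<alpha> * P)"
    using abs_cos_le_one[of "pi * \<alpha> * y"] by linarith
  also have "\<dots> \<le> 4 / \<alpha> * P"
  proof -
    have "1 \<le> 1 / \<alpha>" using a by simp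
    then have "1 * 1 \<le> 1 / \<alpha> * P" using P1 a by (intro mult_mono) auto
    then have "1 \<le> P / \<alpha>" by simp
    moreover have "1 + (1 + 2 / \<alpha> * P) = 2 + 2 * (P / \<alpha>)" "4 / \<alpha> * P = 4 * (P / \<alpha>)" by simp_all
    ultimately show ?thesis by linarith
  qed
  finally have br: "\<bar>cos (pi * \<alpha> * y) - 1 / pi * sin (pi * \<alpha> * y) * ln (y / (1 - y))\<bar> \<le> 4 / \<alpha> * P" .
  have "\<bar>vt_deriv \<alpha> y\<bar> = (\<alpha> * exp \<alpha>) * (E * \<bar>cos (pi * \<alpha> * y) - 1 / pi * sin (pi * \<alpha> * y) * ln (y / (1 - y))\<bar>)"
    unfolding vt_deriv_def E_def[symmetric] using a E0 by (simp add: abs_mult)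
  also have "\<dots> \<le> (1 * exp 1) * (exp 2 * (4 / \<alpha> * P))"
    using a E0 E2 br P1 by (intro mult_mono) auto
  also have "\<dots> = (4 * exp 3 / \<alpha>) * P" by (simp add: exp_add[symmetric])
  finally show ?thesis unfolding P_def .
qed

lemma vartheta_eq:
  assumes "z \<ge> 0"
  shows "vartheta \<alpha> z = (\<integral>y. indicator {0<..<z} y * ((z - y) powr (\<alpha> - 1) * vt_deriv \<alpha> y) \<partial>lborel)"
proof -
  have "einterval 0 (ereal z) = {0<..<z}" unfolding zero_ereal_def by (rule einterval_eq(1))
  then have "vartheta \<alpha> z = \<alpha> * exp \<alpha> * (\<integral>y. indicator {0<..<z} y * ((z - y) powr (\<alpha> - 1) * y powr (- \<alpha> * y) * (1 - y) powr (- \<alpha> * (1 - y))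
        * (cos (pi * \<alpha> * y) - 1 / pi * sin (pi * \<alpha> * y) * ln (y / (1 - y)))) \<partial>lborel)"
    unfolding vartheta_def using assms
    by (simp add: interval_lebesgue_integral_def set_lebesgue_integral_def)
  also have "\<dots> = (\<integral>y. \<alpha> * exp \<alpha> * (indicator {0<..<z} y * ((z - y) powr (\<alpha> - 1) * y powr (- \<alpha> * y) * (1 - y) powr (- \<alpha> * (1 - y))
        * (cos (pi * \<alpha> * y) - 1 / pi * sin (pi * \<alpha> * y) * ln (y / (1 - y))))) \<partial>lborel)"
    by (rule Bochner_Integration.integral_mult_right_zero[symmetric])
  also have "\<dots> = (\<integral>y. indicator {0<..<z} y * ((z - y) powr (\<alpha> - 1) * vt_deriv \<alpha> y) \<partial>lborel)"
    by (simp add: vt_deriv_def mult_ac)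
  finally show ?thesis .
qed

text \<open>Rescaling by \<open>y = z * s\<close> moves the endpoint singularity from
  \<open>y = z\<close> to the fixed point \<open>s = 1\<close>, so that a single dominating function
  serves all \<open>z\<close>.\<close>

lemma vartheta_scaled:
  assumes "0 < z"
  shows "vartheta \<alpha> z = (\<integral>s. indicator {0<..<1} s * (z powr \<alpha> * (1 - s) powr (\<alpha> - 1) * vt_deriv \<alpha> (z * s)) \<partial>lborel)"
proof -
  have "vartheta \<alpha> z = z * (\<integral>s. indicator {0<..<z} (0 + z * s) * ((z - (0 + z * s)) powr (\<alpha> - 1) * vt_deriv \<alpha> (0 + z * s)) \<partial>lborel)"
    using assms by (subst vartheta_eq, simp, subst lborel_integral_real_affine[where c=z and t=0]) auto
  also have "\<dots> = (\<integral>s. z * (indicator {0<..<z} (0 + z * s) * ((z - (0 + z * s)) powr (\<alpha> - 1) * vt_deriv \<alpha> (0 + z * s))) \<partial>lborel)"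
    by (rule Bochner_Integration.integral_mult_right_zero[symmetric])
  also have "\<dots> = (\<integral>s. indicator {0<..<1} s * (z powr \<alpha> * (1 - s) powr (\<alpha> - 1) * vt_deriv \<alpha> (z * s)) \<partial>lborel)"
  proof (rule Bochner_Integration.integral_cong[OF refl])
    fix s :: real
    show "z * (indicator {0<..<z} (0 + z * s) * ((z - (0 + z * s)) powr (\<alpha> - 1) * vt_deriv \<alpha> (0 + z * s))) =
       indicator {0<..<1} s * (z powr \<alpha> * (1 - s) powr (\<alpha> - 1) * vt_deriv \<alpha> (z * s))"
    proof (cases "s \<in> {0<..<1}")
      case True
      have "z - z * s = z * (1 - s)" by (simp add: algebra_simps)
      moreover have "z * z powr (\<alpha> - 1) = z powr \<alpha>" using assms by (simp add: powr_diff)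
      ultimately have "z * (z - z * s) powr (\<alpha> - 1) = z powr \<alpha> * (1 - s) powr (\<alpha> - 1)"
        using assms True by (simp add: powr_mult)
      then show ?thesis using True assms by simp
    next
      case False
      then have "z * s \<notin> {0<..<z}" using assms by (auto simp: zero_less_mult_iff)
      then show ?thesis using False by simp
    qed
  qed
  finally show ?thesis .
qed

lemma vartheta_kernel_bound:
  assumes a: "0 < \<alpha>" "\<alpha> \<le> 1" and z: "0 < z" "z < 1"
  shows "\<bar>indicator {0<..<1} s * (z powr \<alpha> * (1 - s) powr (\<alpha> - 1) * vt_deriv \<alpha> (z * s))\<bar> \<le>
    (4 * exp 3 / \<alpha>) * (indicator {0<..<1} s * (1 - s) powr (\<alpha> / 2 - 1))"
proof (cases "s \<in> {0<..<1}")
  case True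
  then have s: "0 < s" "s < 1" by auto
  have zs: "0 < z * s" "z * s < 1" using z s mult_strict_mono[of z 1 s 1] by auto
  \<comment> \<open>The exponent of \<open>vt_deriv_bound\<close> is negative, so its singularity
    can be moved onto that of the kernel at \<open>s = 1\<close>.\<close>
  have zs2: "1 - s \<le> 1 - z * s" using z s by simp
  have "\<bar>vt_deriv \<alpha> (z * s)\<bar> \<le> (4 * exp 3 / \<alpha>) * (1 - z * s) powr (- \<alpha> / 2)"
    by (rule vt_deriv_bound[OF a zs])
  also have "\<dots> \<le> (4 * exp 3 / \<alpha>) * (1 - s) powr (- \<alpha> / 2)"
    using a s zs2 by (intro mult_left_mono powr_mono2') auto
  finally have 1: "\<bar>vt_deriv \<alpha> (z * s)\<bar> \<le> (4 * exp 3 / \<alpha>) * (1 - s) powr (- \<alpha> / 2)" .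
  have 2: "z powr \<alpha> \<le> 1" using z a by (intro powr_le1) auto
  have "(z powr \<alpha> * (1 - s) powr (\<alpha> - 1)) * \<bar>vt_deriv \<alpha> (z * s)\<bar> \<le>
     (1 * (1 - s) powr (\<alpha> - 1)) * ((4 * exp 3 / \<alpha>) * (1 - s) powr (- \<alpha> / 2))"
    using 1 2 by (intro mult_mono) auto
  also have "\<dots> = (4 * exp 3 / \<alpha>) * ((1 - s) powr (\<alpha> - 1) * (1 - s) powr (- \<alpha> / 2))" by simp
  also have "(1 - s) powr (\<alpha> - 1) * (1 - s) powr (- \<alpha> / 2) = (1 - s) powr (\<alpha> / 2 - 1)"
    by (simp add: powr_add[symmetric])
  finally show ?thesis using True by (simp add: abs_mult)
qed simp

lemma vartheta_bounded:
  assumes a: "0 < \<alpha>" "\<alpha> \<le> 1"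
  obtains C where "C > 0" "\<And>z. 0 < z \<Longrightarrow> z < 1 \<Longrightarrow> \<bar>vartheta \<alpha> z\<bar> \<le> C"
proof
  let ?g = "\<lambda>s. (4 * exp 3 / \<alpha>) * (indicator {0<..<1} s * (1 - s) powr (\<alpha> / 2 - 1))"
  have ig: "integrable lborel ?g"
    using integrable_powr_right[of "\<alpha> / 2" 0 1] a by (intro integrable_mult_right) auto
  fix z :: real assume z: "0 < z" "z < 1"
  have "\<bar>vartheta \<alpha> z\<bar> \<le> (\<integral>s. ?g s \<partial>lborel)"
  proof -
    let ?f = "\<lambda>s. indicator {0<..<1} s * (z powr \<alpha> * (1 - s) powr (\<alpha> - 1) * vt_deriv \<alpha> (z * s))"
    have b: "\<bar>?f s\<bar> \<le> ?g s" for s by (rule vartheta_kernel_bound[OF a z])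
    have if': "integrable lborel ?f"
    proof (rule Bochner_Integration.integrable_bound[OF ig])
      show "AE s in lborel. norm (?f s) \<le> norm (?g s)"
        unfolding real_norm_def by (intro AE_I2 order_trans[OF b abs_ge_self])
    qed simp
    have "\<bar>\<integral>s. ?f s \<partial>lborel\<bar> \<le> (\<integral>s. \<bar>?f s\<bar> \<partial>lborel)" by (rule integral_abs_bound)
    also have "\<dots> \<le> (\<integral>s. ?g s \<partial>lborel)" by (rule integral_mono[OF integrable_abs[OF if'] ig]) (rule b)
    finally show ?thesis unfolding vartheta_scaled[OF z(1)] .
  qed
  then show "\<bar>vartheta \<alpha> z\<bar> \<le> \<bar>\<integral>s. ?g s \<partial>lborel\<bar> + 1" by linarith
qed (rule add_nonneg_pos[OF abs_ge_zero zero_less_one])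

lemma vt_deriv_continuous:
  assumes "0 < y" "y < 1"
  shows "isCont (vt_deriv \<alpha>) y"
  unfolding vt_deriv_def using assms by (intro continuous_intros) auto

lemma vartheta_continuous:
  assumes a: "0 < \<alpha>" "\<alpha> \<le> 1"
  shows "continuous_on {0<..<1} (vartheta \<alpha>)"
proof -
  let ?f = "\<lambda>z s. indicator {0<..<1} s * (z powr \<alpha> * (1 - s) powr (\<alpha> - 1) * vt_deriv \<alpha> (z * s))"
  let ?g = "\<lambda>s. (4 * exp 3 / \<alpha>) * (indicator {0<..<1} s * (1 - s) powr (\<alpha> / 2 - 1))"
  have ig: "integrable lborel ?g"
    using integrable_powr_right[of "\<alpha> / 2" 0 1] a by (intro integrable_mult_right) auto
  have "continuous_on {0<..<1} (\<lambda>z. \<integral>s. ?f z s \<partial>lborel)"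
  proof (subst continuous_on_sequentially, intro allI ballI impI)
    fix u :: "nat \<Rightarrow> real" and z assume zz: "z \<in> {0<..<1}" and h: "(\<forall>n. u n \<in> {0<..<1}) \<and> u \<longlonglongrightarrow> z"
    have z: "0 < z" "z < 1" using zz by auto
    have u: "0 < u n" "u n < 1" for n using h by auto
    have "(\<lambda>n. \<integral>s. ?f (u n) s \<partial>lborel) \<longlonglongrightarrow> (\<integral>s. ?f z s \<partial>lborel)"
    proof (rule integral_dominated_convergence[where w="?g"])
      show "AE s in lborel. (\<lambda>n. ?f (u n) s) \<longlonglongrightarrow> ?f z s"
      proof (rule AE_I2)
        fix s :: real
        show "(\<lambda>n. ?f (u n) s) \<longlonglongrightarrow> ?f z s"
        proof (cases "s \<in> {0<..<1}")
          case True
          then have zs: "0 < z * s" "z * s < 1" using z mult_strict_mono[of z 1 s 1] by auto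
          have "(\<lambda>n. vt_deriv \<alpha> (u n * s)) \<longlonglongrightarrow> vt_deriv \<alpha> (z * s)"
            by (rule isCont_tendsto_compose[OF vt_deriv_continuous[OF zs]]) (use h in \<open>auto intro!: tendsto_intros\<close>)
          then show ?thesis using h z by (intro tendsto_intros) auto
        qed simp
      qed
    qed (use ig vartheta_kernel_bound[OF a u] in auto)
    then show "((\<lambda>z. \<integral>s. ?f z s \<partial>lborel) \<circ> u) \<longlonglongrightarrow> (\<integral>s. ?f z s \<partial>lborel)"
      by (simp add: o_def)
  qed
  then show ?thesis by (rule continuous_on_eq) (auto simp: vartheta_scaled)
qed

lemma integrable_vt_deriv:
  assumes a: "0 < \<alpha>" "\<alpha> \<le> 1"
  shows "integrable lborel (\<lambda>y. indicator {0<..<1} y * vt_deriv \<alpha> y)"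
proof (rule Bochner_Integration.integrable_bound)
  let ?g = "\<lambda>y. (4 * exp 3 / \<alpha>) * (indicator {0<..<1} y * (1 - y) powr ((1 - \<alpha> / 2) - 1))"
  show "integrable lborel ?g"
    using integrable_powr_right[of "1 - \<alpha> / 2" 0 1] a by (intro integrable_mult_right) auto
  show "AE y in lborel. norm (indicator {0<..<1} y * vt_deriv \<alpha> y) \<le> norm (?g y)"
  proof (rule AE_I2)
    fix y :: real
    show "norm (indicator {0<..<1} y * vt_deriv \<alpha> y) \<le> norm (?g y)"
    proof (cases "y \<in> {0<..<1}")
      case True
      then show ?thesis using vt_deriv_bound[OF a, of y] a by (simp add: abs_mult)
    qed simp
  qed
qed measurable

lemma vt_prim_tendsto_0: "(vt_prim \<alpha> \<longlongrightarrow> 0) (at_right 0)"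
proof -
  have "((\<lambda>y::real. y * ln y + (1 - y) * ln (1 - y)) \<longlongrightarrow> 0) (at_right 0)" by real_asymp
  then have "((\<lambda>y. exp \<alpha> / pi * (exp (- \<alpha> * (y * ln y + (1 - y) * ln (1 - y))) * sin (pi * \<alpha> * y))) \<longlongrightarrow>
     exp \<alpha> / pi * (exp (- \<alpha> * 0) * sin (pi * \<alpha> * 0))) (at_right 0)"
    by (intro tendsto_intros)
  then show ?thesis unfolding vt_prim_def by simp
qed

lemma vt_prim_integral:
  assumes a: "0 < \<alpha>" "\<alpha> \<le> 1" and t: "0 < t" "t < 1"
  shows "(\<integral>y. indicator {0<..<t} y * vt_deriv \<alpha> y \<partial>lborel) = vt_prim \<alpha> t"
proof -
  have ei: "einterval 0 (ereal t) = {0<..<t}" unfolding zero_ereal_def by (rule einterval_eq(1))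
  have int: "set_integrable lborel {0<..<t} (vt_deriv \<alpha>)"
  proof (rule set_integrable_subset)
    show "set_integrable lborel {0<..<1} (vt_deriv \<alpha>)"
      using integrable_vt_deriv[OF a] by (simp add: set_integrable_def)
  qed (use t in auto)
  have "(LBINT y=0..ereal t. vt_deriv \<alpha> y) = vt_prim \<alpha> t - 0"
  proof (rule interval_integral_FTC_integrable)
    show "(0::ereal) < ereal t" using t by simp
    show "(vt_prim \<alpha> has_vector_derivative vt_deriv \<alpha> x) (at x)" if "0 < ereal x" "ereal x < ereal t" for x
      using vt_prim_deriv[of x \<alpha>] that t by (simp add: has_real_derivative_iff_has_vector_derivative)
    show "isCont (vt_deriv \<alpha>) x" if "0 < ereal x" "ereal x < ereal t" for x
      using vt_deriv_continuous[of x \<alpha>] that t by simp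
    show "set_integrable lborel (einterval 0 (ereal t)) (vt_deriv \<alpha>)" unfolding ei by (rule int)
    show "((vt_prim \<alpha> \<circ> real_of_ereal) \<longlongrightarrow> 0) (at_right 0)"
      using vt_prim_tendsto_0[of \<alpha>] unfolding zero_ereal_def by (simp add: ereal_tendsto_simps)
    have "(vt_prim \<alpha> \<longlongrightarrow> vt_prim \<alpha> t) (at t)"
      using DERIV_isCont[OF vt_prim_deriv[OF t]] by (simp add: isCont_def)
    then have "(vt_prim \<alpha> \<longlongrightarrow> vt_prim \<alpha> t) (at_left t)" by (rule tendsto_within_subset) simp
    then show "((vt_prim \<alpha> \<circ> real_of_ereal) \<longlongrightarrow> vt_prim \<alpha> t) (at_left (ereal t))"
      by (simp add: ereal_tendsto_simps)
  qed
  then show ?thesis using t by (simp add: interval_lebesgue_integral_def ei set_lebesgue_integral_def)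
qed

text \<open>\<open>v\<close> may change sign, so Fubini rests on absolute values: \<open>v\<close>
  is integrable and the inner integrals of the nonnegative \<open>k\<close> are at most
  \<open>K\<close> uniformly in \<open>y\<close>. It is applied in both directions, with two
  different kernels.\<close>

lemma triangle_fubini:
  fixes k :: "real \<Rightarrow> real \<Rightarrow> real" and v :: "real \<Rightarrow> real"
  assumes km[measurable]: "(\<lambda>(y, z). k y z) \<in> borel_measurable (borel \<Otimes>\<^sub>M borel)"
    and vm[measurable]: "v \<in> borel_measurable borel"
    and k0: "\<And>y z. k y z \<ge> 0"
    and vi: "integrable lborel (\<lambda>y. indicator {0<..<1} y * v y)"
    and ki: "\<And>y. 0 < y \<Longrightarrow> y < 1 \<Longrightarrow> integrable lborel (\<lambda>z. indicator {y<..<1} z * k y z)"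
    and kb: "\<And>y. 0 < y \<Longrightarrow> y < 1 \<Longrightarrow> (\<integral>z. indicator {y<..<1} z * k y z \<partial>lborel) \<le> K"
  shows "(\<integral>z. indicator {0<..<1} z * (\<integral>y. indicator {0<..<z} y * (k y z * v y) \<partial>lborel) \<partial>lborel) =
     (\<integral>y. indicator {0<..<1} y * v y * (\<integral>z. indicator {y<..<1} z * k y z \<partial>lborel) \<partial>lborel)"
proof -
  let ?J = "\<lambda>y. \<integral>z. indicator {y<..<1} z * k y z \<partial>lborel"
  define H where "H = (\<lambda>y z. indicator {0<..<1} y * v y * ((if y < z \<and> z < 1 then 1 else 0) * k y z))"
  have Hm: "(\<lambda>(y, z). H y z) \<in> borel_measurable (lborel \<Otimes>\<^sub>M lborel)"
    unfolding H_def by measurable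
  have H1: "H y z = indicator {0<..<1} y * v y * (indicator {y<..<1} z * k y z)" for y z
    by (auto simp: H_def indicator_def)
  have H2: "H y z = indicator {0<..<1} z * (indicator {0<..<z} y * (k y z * v y))" for y z
    by (auto simp: H_def indicator_def)
  have iH: "integrable lborel (H y)" for y
    unfolding H1[abs_def] using ki[of y] by (cases "y \<in> {0<..<1}") (auto intro!: integrable_mult_right)
  have nH: "(\<integral>z. norm (H y z) \<partial>lborel) = \<bar>indicator {0<..<1} y * v y\<bar> * ?J y" for y
  proof -
    have "norm (H y z) = \<bar>indicator {0<..<1} y * v y\<bar> * (indicator {y<..<1} z * k y z)" for z
      unfolding H1 using k0[of y z] by (simp add: abs_mult)
    then show ?thesis by simp
  qed
  have "integrable (lborel \<Otimes>\<^sub>M lborel) (\<lambda>(y, z). H y z)"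
  proof (rule lborel_pair.Fubini_integrable[OF Hm])
    show "AE y in lborel. integrable lborel (\<lambda>z. case (y, z) of (y, z) \<Rightarrow> H y z)"
      using iH by simp
    have m: "(\<lambda>y. \<integral>z. norm (H y z) \<partial>lborel) \<in> borel_measurable lborel"
      using Hm by (intro lborel.borel_measurable_lebesgue_integral) (simp add: split_beta')
    show "integrable lborel (\<lambda>y. \<integral>z. norm (case (y, z) of (y, z) \<Rightarrow> H y z) \<partial>lborel)"
    proof (rule Bochner_Integration.integrable_bound)
      show "integrable lborel (\<lambda>y. K * \<bar>indicator {0<..<1} y * v y\<bar>)" using vi by (intro integrable_mult_right integrable_abs)
      show "(\<lambda>y. \<integral>z. norm (case (y, z) of (y, z) \<Rightarrow> H y z) \<partial>lborel) \<in> borel_measurable lborel" using m by simp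
      show "AE y in lborel. norm (\<integral>z. norm (case (y, z) of (y, z) \<Rightarrow> H y z) \<partial>lborel) \<le> norm (K * \<bar>indicator {0<..<1} y * v y\<bar>)"
      proof (rule AE_I2)
        fix y :: real
        show "norm (\<integral>z. norm (case (y, z) of (y, z) \<Rightarrow> H y z) \<partial>lborel) \<le> norm (K * \<bar>indicator {0<..<1} y * v y\<bar>)"
        proof (cases "y \<in> {0<..<1}")
          case True
          have "?J y \<ge> 0" using k0 by (intro integral_nonneg_AE) auto
          moreover have "?J y \<le> K" using kb[of y] True by simp
          ultimately have "\<bar>indicator {0<..<1} y * v y\<bar> * ?J y \<le> \<bar>indicator {0<..<1} y * v y\<bar> * K" "K \<ge> 0"
            by (auto intro: mult_left_mono)
          then show ?thesis using \<open>?J y \<ge> 0\<close> unfolding case_prod_conv unfolding nH unfolding real_norm_def abs_mult[of _ "?J y"] abs_mult[of K]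
            by (simp only: abs_abs abs_of_nonneg mult.commute[of K])
        qed (simp add: H1)
      qed
    qed
  qed
  from lborel_pair.Fubini_integral[OF this]
  have "(\<integral>z. (\<integral>y. H y z \<partial>lborel) \<partial>lborel) = (\<integral>y. (\<integral>z. H y z \<partial>lborel) \<partial>lborel)" .
  then show ?thesis
    unfolding H2[abs_def] integral_mult_right_zero
    by (simp add: H1[abs_def] H2[symmetric, abs_def])
qed

text \<open>The Moebius map \<open>r\<close> sends (y, 1) to (0, 1 - y), and
  \<open>t = 1 - r z\<close> turns \<open>k\<close> into \<open>b\<close>. The gain is that
  \<open>b\<close> depends on \<open>y\<close> only through the range of integration: after a second
  exchange of integrals, \<open>vt_deriv\<close> is integrated alone and yields
  \<open>vt_prim\<close>. The bound is uniform in \<open>y\<close>, as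
  \<open>triangle_fubini\<close> requires.\<close>

lemma vt_kernel:
  fixes \<alpha> c y :: real
  assumes a: "0 < \<alpha>" "\<alpha> \<le> 1" and c: "c > 0" and y: "0 < y" "y < 1"
  defines "k \<equiv> \<lambda>z. (c + z) powr (- \<alpha>) * (z - y) powr (\<alpha> - 1)"
    and "b \<equiv> \<lambda>t. (1 + c) powr (1 - \<alpha>) * (1 - t) powr (\<alpha> - 1) / (c + t)"
  shows "integrable lborel (\<lambda>z. indicator {y<..<1} z * k z)"
    and "(\<integral>z. indicator {y<..<1} z * k z \<partial>lborel) \<le> c powr (- \<alpha>) / \<alpha>"
    and "integrable lborel (\<lambda>t. indicator {y<..<1} t * b t)"
    and "(\<integral>t. indicator {y<..<1} t * b t \<partial>lborel) = (\<integral>z. indicator {y<..<1} z * k z \<partial>lborel)"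
proof -
  let ?p = "\<lambda>z. indicator {y<..<1} z * (z - y) powr (\<alpha> - 1)"
  have ip: "integrable lborel ?p" using integrable_powr_left[of \<alpha> y 1] a y by simp
  have kb: "indicator {y<..<1} z * k z \<le> c powr (- \<alpha>) * ?p z" for z
  proof (cases "z \<in> {y<..<1}")
    case True
    have "(c + z) powr (- \<alpha>) \<le> c powr (- \<alpha>)" using True y c a by (intro powr_mono2') auto
    then show ?thesis using True by (simp add: k_def mult_right_mono)
  qed simp
  show ik: "integrable lborel (\<lambda>z. indicator {y<..<1} z * k z)"
  proof (rule Bochner_Integration.integrable_bound)
    show "integrable lborel (\<lambda>z. c powr (- \<alpha>) * ?p z)" using ip by (rule integrable_mult_right)
    show "AE z in lborel. norm (indicator {y<..<1} z * k z) \<le> norm (c powr (- \<alpha>) * ?p z)"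
    proof (rule AE_I2)
      fix z
      have "indicator {y<..<1} z * k z \<ge> 0" by (simp add: k_def)
      then show "norm (indicator {y<..<1} z * k z) \<le> norm (c powr (- \<alpha>) * ?p z)"
        using kb[of z] by simp
    qed
  qed (simp add: k_def)
  have ip2: "(\<integral>z. ?p z \<partial>lborel) = (1 - y) powr \<alpha> / \<alpha>"
  proof (rule integral_eq_nn_integral[THEN trans])
    show "enn2real (\<integral>\<^sup>+z. ennreal (?p z) \<partial>lborel) = (1 - y) powr \<alpha> / \<alpha>"
      using nn_integral_powr_left[of \<alpha> y 1] a y by simp
  qed auto
  have "(\<integral>z. indicator {y<..<1} z * k z \<partial>lborel) \<le> (\<integral>z. c powr (- \<alpha>) * ?p z \<partial>lborel)"
    using ik ip kb by (intro integral_mono) auto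
  also have "\<dots> = c powr (- \<alpha>) * ((1 - y) powr \<alpha> / \<alpha>)" by (simp add: ip2)
  also have "\<dots> \<le> c powr (- \<alpha>) * (1 / \<alpha>)"
    using a y by (intro mult_left_mono divide_right_mono powr_le1) auto
  finally show "(\<integral>z. indicator {y<..<1} z * k z \<partial>lborel) \<le> c powr (- \<alpha>) / \<alpha>" by simp

  define r where "r = (\<lambda>z. (c + 1) * (z - y) / (c + z))"
  define r' where "r' = (\<lambda>z. (c + 1) * (c + y) / (c + z) ^ 2)"
  define f where "f = (\<lambda>u. b (1 - u))"
  have fr: "f (r z) * r' z = k z" if "y < z" for z
  proof -
    have p: "c + z > 0" "c + y > 0" "z - y > 0" "c + 1 > 0" using that c y by auto
    have 1: "c + (1 - r z) = (c + 1) * (c + y) / (c + z)"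
      unfolding r_def using p by (simp add: field_simps)
    have "f (r z) * r' z = (1 + c) powr (1 - \<alpha>) * r z powr (\<alpha> - 1) * (r' z / (c + (1 - r z)))"
      unfolding f_def b_def by simp
    also have "r' z / (c + (1 - r z)) = 1 / (c + z)"
      unfolding 1 r'_def using p by (simp add: power2_eq_square)
    also have "r z powr (\<alpha> - 1) = (c + 1) powr (\<alpha> - 1) * (z - y) powr (\<alpha> - 1) / (c + z) powr (\<alpha> - 1)"
      unfolding r_def using p by (simp add: powr_mult powr_divide)
    also have "(1 + c) powr (1 - \<alpha>) * ((c + 1) powr (\<alpha> - 1) * (z - y) powr (\<alpha> - 1) / (c + z) powr (\<alpha> - 1)) * (1 / (c + z))
       = ((1 + c) powr (1 - \<alpha>) * (c + 1) powr (\<alpha> - 1)) * (z - y) powr (\<alpha> - 1) * (1 / ((c + z) powr (\<alpha> - 1) * (c + z)))"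
      by simp
    also have "(1 + c) powr (1 - \<alpha>) * (c + 1) powr (\<alpha> - 1) = 1"
      using c by (simp add: add.commute powr_add[symmetric])
    also have "(c + z) powr (\<alpha> - 1) * (c + z) = (c + z) powr \<alpha>" using p by (simp add: powr_diff)
    finally show ?thesis by (simp add: k_def powr_minus divide_inverse mult_ac)
  qed
  have ey: "einterval (ereal y) (ereal 1) = {y<..<1}" by (rule einterval_eq(1))
  have e0: "einterval 0 (ereal (1 - y)) = {0<..<1 - y}" unfolding zero_ereal_def by (rule einterval_eq(1))
  have sub: "set_integrable lborel (einterval 0 (ereal (1 - y))) f \<and>
     (LBINT u=0..ereal (1 - y). f u) = (LBINT z=ereal y..ereal 1. f (r z) * r' z)"
  proof -
    have 1: "DERIV r z :> r' z" if "ereal y < ereal z" for z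
      unfolding r_def r'_def using that c y
      by (auto intro!: derivative_eq_intros simp: power2_eq_square field_simps)
    have 2: "isCont f (r z)" if "ereal y < ereal z" "ereal z < ereal 1" for z
    proof -
      have p: "c + z > 0" "z - y > 0" using that c y by auto
      have "r z > 0" unfolding r_def using p c by simp
      moreover have "c + (1 - r z) > 0"
      proof -
        have "c + (1 - r z) = (c + 1) * (c + y) / (c + z)"
          unfolding r_def using p by (simp add: field_simps)
        then show ?thesis using p c y by simp
      qed
      ultimately show ?thesis unfolding f_def b_def by (intro continuous_intros) auto
    qed
    have 3: "isCont r' z" if "ereal y < ereal z" for z
      unfolding r'_def using that c y by (intro continuous_intros) auto
    have 4: "0 \<le> f (r z)" if "ereal y < ereal z" "ereal z < ereal 1" for z
    proof -
      have "f (r z) * r' z \<ge> 0" using fr[of z] that by (simp add: k_def)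
      moreover have "r' z > 0" unfolding r'_def using that c y by (intro divide_pos_pos mult_pos_pos zero_less_power) auto
      ultimately show ?thesis by (simp add: zero_le_mult_iff)
    qed
    have 5: "0 \<le> r' z" for z unfolding r'_def using c y by simp
    have rc: "isCont r z" if "z \<ge> y" for z unfolding r_def using that c y by (intro continuous_intros) auto
    have 6: "((ereal \<circ> r \<circ> real_of_ereal) \<longlongrightarrow> 0) (at_right (ereal y))"
    proof -
      have "(r \<longlongrightarrow> r y) (at_right y)" using rc[of y] by (auto simp: isCont_def intro: tendsto_within_subset)
      moreover have "r y = 0" by (simp add: r_def)
      ultimately show ?thesis unfolding zero_ereal_def by (simp add: ereal_tendsto_simps)
    qed
    have 7: "((ereal \<circ> r \<circ> real_of_ereal) \<longlongrightarrow> ereal (1 - y)) (at_left (ereal 1))"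
    proof -
      have "(r \<longlongrightarrow> r 1) (at_left 1)" using rc[of 1] y by (auto simp: isCont_def intro: tendsto_within_subset)
      moreover have "r 1 = 1 - y" using c by (simp add: r_def add.commute)
      ultimately show ?thesis by (simp add: ereal_tendsto_simps)
    qed
    have 8: "set_integrable lborel (einterval (ereal y) (ereal 1)) (\<lambda>z. f (r z) * r' z)"
    proof -
      have "set_integrable lborel {y<..<1} k" using ik by (simp add: set_integrable_def)
      then show ?thesis unfolding ey by (subst set_integrable_cong[OF refl refl]) (auto simp: fr)
    qed
    show ?thesis
      using interval_integral_substitution_nonneg[where a="ereal y" and b="ereal 1" and g=r and g'=r' and f=f and A=0 and B="ereal (1 - y)"]
        1 2 3 4 5 6 7 8 y by auto
  qed
  have i1: "integrable lborel (\<lambda>u. indicator {0<..<1 - y} u * f u)"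
    using sub unfolding e0 by (simp add: set_integrable_def)
  have refl1: "indicator {0<..<1 - y} (1 + (-1) * t) * f (1 + (-1) * t) = indicator {y<..<1} t * b t" for t
    by (auto simp: f_def indicator_def)
  show "integrable lborel (\<lambda>t. indicator {y<..<1} t * b t)"
    using lborel_integrable_real_affine[OF i1, of "-1" 1] unfolding refl1 by simp
  have "(\<integral>u. indicator {0<..<1 - y} u * f u \<partial>lborel) = (\<integral>t. indicator {y<..<1} t * b t \<partial>lborel)"
    using lborel_integral_real_affine[of "-1" "\<lambda>u. indicator {0<..<1 - y} u * f u" 1] unfolding refl1 by simp
  moreover have "(\<integral>u. indicator {0<..<1 - y} u * f u \<partial>lborel) = (LBINT z=ereal y..ereal 1. f (r z) * r' z)"
    using sub y by (simp add: interval_lebesgue_integral_def e0 set_lebesgue_integral_def)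
  moreover have "(LBINT z=ereal y..ereal 1. f (r z) * r' z) = (\<integral>z. indicator {y<..<1} z * k z \<partial>lborel)"
    using y unfolding interval_lebesgue_integral_def ey set_lebesgue_integral_def
    by (auto intro!: Bochner_Integration.integral_cong simp: fr indicator_def)
  ultimately show "(\<integral>t. indicator {y<..<1} t * b t \<partial>lborel) = (\<integral>z. indicator {y<..<1} z * k z \<partial>lborel)"
    by simp
qed

lemma vartheta_stieltjes:
  assumes a: "0 < \<alpha>" "\<alpha> \<le> 1" and c: "c > 0"
  shows "(\<integral>z. indicator {0<..<1} z * ((c + z) powr (- \<alpha>) * vartheta \<alpha> z) \<partial>lborel) =
     exp \<alpha> * (1 + c) powr (- \<alpha>) * (c / (1 + c)) powr (\<alpha> * c)"
proof -
  let ?k = "\<lambda>y z. (c + z) powr (- \<alpha>) * (z - y) powr (\<alpha> - 1)"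
  \<comment> \<open>The absolute value makes the kernel nonnegative for all real arguments, as
    \<open>triangle_fubini\<close> demands; on (0, 1) it agrees with \<open>?b'\<close>.\<close>
  let ?b = "\<lambda>y t. (1 + c) powr (1 - \<alpha>) * (1 - t) powr (\<alpha> - 1) / \<bar>c + t\<bar>"
  let ?b' = "\<lambda>t. (1 + c) powr (1 - \<alpha>) * (1 - t) powr (\<alpha> - 1) / (c + t)"
  let ?v = "vt_deriv \<alpha>"
  have bb: "indicator {y<..<1} t * ?b y t = indicator {y<..<1} t * ?b' t" if "0 < y" for y t
    using that c by (auto simp: indicator_def)
  note K = vt_kernel[OF a c]
  have "(\<integral>z. indicator {0<..<1} z * ((c + z) powr (- \<alpha>) * vartheta \<alpha> z) \<partial>lborel) =
     (\<integral>z. indicator {0<..<1} z * (\<integral>y. indicator {0<..<z} y * (?k y z * ?v y) \<partial>lborel) \<partial>lborel)"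
  proof (rule Bochner_Integration.integral_cong[OF refl])
    fix z :: real
    show "indicator {0<..<1} z * ((c + z) powr (- \<alpha>) * vartheta \<alpha> z) =
      indicator {0<..<1} z * (\<integral>y. indicator {0<..<z} y * (?k y z * ?v y) \<partial>lborel)"
    proof (cases "z \<in> {0<..<1}")
      case True
      then have "(c + z) powr (- \<alpha>) * vartheta \<alpha> z =
         (\<integral>y. (c + z) powr (- \<alpha>) * (indicator {0<..<z} y * ((z - y) powr (\<alpha> - 1) * ?v y)) \<partial>lborel)"
        by (subst vartheta_eq) auto
      then show ?thesis by (simp add: mult_ac)
    qed simp
  qed
  also have "\<dots> = (\<integral>y. indicator {0<..<1} y * ?v y * (\<integral>z. indicator {y<..<1} z * ?k y z \<partial>lborel) \<partial>lborel)"
    by (rule triangle_fubini[where K="c powr (- \<alpha>) / \<alpha>"]) (use K(1,2) integrable_vt_deriv[OF a] in auto)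
  also have "\<dots> = (\<integral>y. indicator {0<..<1} y * ?v y * (\<integral>z. indicator {y<..<1} z * ?b y z \<partial>lborel) \<partial>lborel)"
  proof (rule Bochner_Integration.integral_cong[OF refl])
    fix y :: real
    show "indicator {0<..<1} y * ?v y * (\<integral>z. indicator {y<..<1} z * ?k y z \<partial>lborel) =
      indicator {0<..<1} y * ?v y * (\<integral>z. indicator {y<..<1} z * ?b y z \<partial>lborel)"
    proof (cases "y \<in> {0<..<1}")
      case True
      then have y: "0 < y" "y < 1" by auto
      show ?thesis by (simp only: bb[OF y(1)] K(4)[OF y])
    qed simp
  qed
  also have "\<dots> = (\<integral>z. indicator {0<..<1} z * (\<integral>y. indicator {0<..<z} y * (?b y z * ?v y) \<partial>lborel) \<partial>lborel)"
  proof (rule triangle_fubini[where K="c powr (- \<alpha>) / \<alpha>", symmetric])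
    show "integrable lborel (\<lambda>z. indicator {y<..<1} z * ?b y z)" if "0 < y" "y < 1" for y
      by (simp only: bb[OF that(1)] K(3)[OF that])
    show "(\<integral>z. indicator {y<..<1} z * ?b y z \<partial>lborel) \<le> c powr (- \<alpha>) / \<alpha>" if "0 < y" "y < 1" for y
      by (simp only: bb[OF that(1)] K(4)[OF that] K(2)[OF that])
  qed (use integrable_vt_deriv[OF a] in auto)
  also have "\<dots> = (\<integral>t. (1 + c) powr (1 - \<alpha>) * exp \<alpha> / pi *
      (indicator {0<..<1} t * ((t / (1 - t)) powr (- \<alpha> * t) * sin (pi * \<alpha> * t) / ((1 - t) * (t + c)))) \<partial>lborel)"
  proof (rule Bochner_Integration.integral_cong[OF refl])
    fix t :: real
    show "indicator {0<..<1} t * (\<integral>y. indicator {0<..<t} y * (?b y t * ?v y) \<partial>lborel) =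
      (1 + c) powr (1 - \<alpha>) * exp \<alpha> / pi *
      (indicator {0<..<1} t * ((t / (1 - t)) powr (- \<alpha> * t) * sin (pi * \<alpha> * t) / ((1 - t) * (t + c))))"
    proof (cases "t \<in> {0<..<1}")
      case True
      then have t: "0 < t" "t < 1" by auto
      have "(\<integral>y. indicator {0<..<t} y * (?b y t * ?v y) \<partial>lborel) = (\<integral>y. ?b' t * (indicator {0<..<t} y * ?v y) \<partial>lborel)"
        using t c by (intro Bochner_Integration.integral_cong) auto
      also have "\<dots> = ?b' t * vt_prim \<alpha> t" using vt_prim_integral[OF a t] by simp
      also have "\<dots> = (1 + c) powr (1 - \<alpha>) * exp \<alpha> / pi *
         ((1 - t) powr (\<alpha> - 1) * exp (- \<alpha> * (t * ln t + (1 - t) * ln (1 - t))) * sin (pi * \<alpha> * t) / (t + c))"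
        unfolding vt_prim_def by (simp add: add.commute mult_ac)
      \<comment> \<open>The powers of \<open>1 - t\<close> combine to the exponent
        \<open>\<alpha> * t - 1\<close>, which is the integrand of
        \<open>slit_stieltjes\<close>.\<close>
      also have "(1 - t) powr (\<alpha> - 1) * exp (- \<alpha> * (t * ln t + (1 - t) * ln (1 - t))) = (t / (1 - t)) powr (- \<alpha> * t) / (1 - t)"
      proof -
        have "1 / (1 - t) = exp (- ln (1 - t))" using t by (simp add: exp_minus divide_inverse)
        moreover have "(t / (1 - t)) powr (- \<alpha> * t) = exp (- \<alpha> * t * (ln t - ln (1 - t)))"
          using t by (simp add: powr_def ln_div)
        ultimately have "(t / (1 - t)) powr (- \<alpha> * t) * (1 / (1 - t)) = exp (- \<alpha> * t * (ln t - ln (1 - t)) + - ln (1 - t))"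
          by (simp only: exp_add)
        then have "(t / (1 - t)) powr (- \<alpha> * t) / (1 - t) = exp (- \<alpha> * t * (ln t - ln (1 - t)) + - ln (1 - t))"
          by simp
        moreover have "(1 - t) powr (\<alpha> - 1) * exp (- \<alpha> * (t * ln t + (1 - t) * ln (1 - t))) =
           exp ((\<alpha> - 1) * ln (1 - t) + - \<alpha> * (t * ln t + (1 - t) * ln (1 - t)))"
          unfolding exp_add using t by (simp add: powr_def)
        ultimately show ?thesis by (simp add: algebra_simps)
      qed
      finally show ?thesis using True by (simp add: mult_ac)
    qed simp
  qed
  also have "\<dots> = (1 + c) powr (1 - \<alpha>) * exp \<alpha> / pi * (pi * ((c / (1 + c)) powr (\<alpha> * c) / (1 + c)))"
    using slit_stieltjes(2)[OF a c] unfolding integral_mult_right_zero by (simp add: set_lebesgue_integral_def)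
  also have "\<dots> = exp \<alpha> * ((1 + c) powr (1 - \<alpha>) / (1 + c)) * (c / (1 + c)) powr (\<alpha> * c)" by simp
  also have "(1 + c) powr (1 - \<alpha>) / (1 + c) = (1 + c) powr (- \<alpha>)" using c powr_diff[of "1 + c" "1 - \<alpha>" 1] by simp
  finally show ?thesis .
qed

lemma vartheta_measurable:
  assumes "0 < \<alpha>" "\<alpha> \<le> 1"
  shows "(\<lambda>z. indicator {0<..<1} z * vartheta \<alpha> z) \<in> borel_measurable borel"
  using borel_measurable_continuous_on_indicator[OF _ vartheta_continuous[OF assms]] by simp

lemma integrable_vartheta_mult:
  assumes a: "0 < \<alpha>" "\<alpha> \<le> 1" and fm: "f \<in> borel_measurable borel"
    and fb: "\<And>z. 0 < z \<Longrightarrow> z < 1 \<Longrightarrow> \<bar>f z\<bar> \<le> B"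
  shows "integrable lborel (\<lambda>z. indicator {0<..<1} z * (f z * vartheta \<alpha> z))"
proof -
  obtain C where C: "C > 0" "\<And>z. 0 < z \<Longrightarrow> z < 1 \<Longrightarrow> \<bar>vartheta \<alpha> z\<bar> \<le> C"
    using vartheta_bounded[OF a] by blast
  have "integrable lborel (\<lambda>z::real. indicator {0<..<1} z * (B * C))"
    by (intro integrable_mult_left integrable_real_indicator) auto
  then show ?thesis
  proof (rule Bochner_Integration.integrable_bound)
    have "(\<lambda>z. f z * (indicator {0<..<1} z * vartheta \<alpha> z)) \<in> borel_measurable borel"
      by (intro borel_measurable_times fm vartheta_measurable a)
    then show "(\<lambda>z. indicator {0<..<1} z * (f z * vartheta \<alpha> z)) \<in> borel_measurable lborel"
      by (simp add: mult_ac)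
    show "AE z in lborel. norm (indicator {0<..<1} z * (f z * vartheta \<alpha> z)) \<le> norm (indicator {0<..<1} z * (B * C))"
    proof (rule AE_I2)
      fix z :: real
      show "norm (indicator {0<..<1} z * (f z * vartheta \<alpha> z)) \<le> norm (indicator {0<..<1} z * (B * C))"
      proof (cases "z \<in> {0<..<1}")
        case True
        then have z: "0 < z" "z < 1" by auto
        have "\<bar>f z\<bar> * \<bar>vartheta \<alpha> z\<bar> \<le> B * C"
          using fb[OF z] C(2)[OF z] by (intro mult_mono) auto
        also have "\<dots> \<le> \<bar>B * C\<bar>" by (rule abs_ge_self)
        finally show ?thesis using True by (simp add: abs_mult)
      qed simp
    qed
  qed
qed

section \<open>Closed forms of the transform and of its derivative\<close>

lemma DERIV_x_ln_x:
  fixes x :: real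
  assumes "x > 0"
  shows "((\<lambda>x. x * ln x) has_real_derivative (ln x + 1)) (at x)"
  using assms by (auto intro!: derivative_eq_intros)

lemma integral_ln_affine:
  fixes A s :: real
  assumes "A > 0" "s > 0"
  shows "((\<lambda>t. ln (A + s * t)) has_integral (((A + s) * ln (A + s) - A * ln A) / s - 1)) {0..1}"
proof -
  let ?F = "\<lambda>t. ((A + s * t) * ln (A + s * t) - (A + s * t)) / s"
  have "((\<lambda>t. ln (A + s * t)) has_integral (?F 1 - ?F 0)) {0..1}"
  proof (rule fundamental_theorem_of_calculus)
    fix t :: real assume "t \<in> {0..1}"
    then have p: "A + s * t > 0" using assms by (intro add_pos_nonneg) auto
    have "(?F has_real_derivative ln (A + s * t)) (at t)"
    proof -
      have "((\<lambda>x. x * ln x - x) has_real_derivative (ln (A + s * t) + 1 - 1)) (at (A + s * t))"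
        by (intro DERIV_diff DERIV_x_ln_x p DERIV_ident)
      moreover have "((\<lambda>t. A + s * t) has_real_derivative s) (at t)" by (auto intro!: derivative_eq_intros)
      ultimately have "((\<lambda>t. (A + s * t) * ln (A + s * t) - (A + s * t)) has_real_derivative ((ln (A + s * t) + 1 - 1) * s)) (at t)"
        by (rule DERIV_chain2)
      from DERIV_cdivide[OF this, of s] show ?thesis using assms by simp
    qed
    then show "(?F has_vector_derivative ln (A + s * t)) (at t within {0..1})"
      by (simp add: has_real_derivative_iff_has_vector_derivative has_vector_derivative_at_within)
  qed simp
  also have "?F 1 - ?F 0 = ((A + s) * ln (A + s) - A * ln A) / s - 1"
    using assms by (simp add: field_simps)
  finally show ?thesis .
qed

text \<open>Homogeneity in \<open>A\<close> and \<open>s\<close> reduces this to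
  \<open>vartheta_stieltjes\<close> at \<open>c = A / s\<close>; the powers found there regroup into
  the mean of \<open>ln\<close> over the segment from \<open>A\<close> to
  \<open>A + s\<close>.\<close>

lemma vartheta_transform_pos:
  assumes a: "0 < \<alpha>" "\<alpha> \<le> 1" and A: "A > 0" and s: "s > 0"
  shows "(\<integral>z. indicator {0<..<1} z * ((A + s * z) powr (- \<alpha>) * vartheta \<alpha> z) \<partial>lborel) =
    exp (- \<alpha> * (((A + s) * ln (A + s) - A * ln A) / s - 1))"
proof -
  define c where "c = A / s"
  have c: "c > 0" using A s by (simp add: c_def)
  have "(\<integral>z. indicator {0<..<1} z * ((A + s * z) powr (- \<alpha>) * vartheta \<alpha> z) \<partial>lborel) =
    (\<integral>z. s powr (- \<alpha>) * (indicator {0<..<1} z * ((c + z) powr (- \<alpha>) * vartheta \<alpha> z)) \<partial>lborel)"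
  proof (rule Bochner_Integration.integral_cong[OF refl])
    fix z :: real
    show "indicator {0<..<1} z * ((A + s * z) powr (- \<alpha>) * vartheta \<alpha> z) =
      s powr (- \<alpha>) * (indicator {0<..<1} z * ((c + z) powr (- \<alpha>) * vartheta \<alpha> z))"
    proof (cases "z \<in> {0<..<1}")
      case True
      have "A + s * z = s * (c + z)" using s by (simp add: c_def field_simps)
      moreover have "c + z > 0" using c True by auto
      ultimately show ?thesis using s by (simp add: powr_mult)
    qed simp
  qed
  also have "\<dots> = s powr (- \<alpha>) * (exp \<alpha> * (1 + c) powr (- \<alpha>) * (c / (1 + c)) powr (\<alpha> * c))"
    using vartheta_stieltjes[OF a c] by simp
  also have "\<dots> = exp (- \<alpha> * ln s + \<alpha> + - \<alpha> * ln (1 + c) + \<alpha> * c * (ln c - ln (1 + c)))"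
    unfolding exp_add using s c by (simp add: powr_def ln_div)
  also have "- \<alpha> * ln s + \<alpha> + - \<alpha> * ln (1 + c) + \<alpha> * c * (ln c - ln (1 + c)) =
     - \<alpha> * (((A + s) * ln (A + s) - A * ln A) / s - 1)"
  proof -
    have l1: "ln (1 + c) = ln (A + s) - ln s"
    proof -
      have "1 + c = (A + s) / s" using s by (simp add: c_def field_simps)
      then show ?thesis using A s by (simp add: ln_div)
    qed
    have l2: "ln c = ln A - ln s" unfolding c_def using A s by (simp add: ln_div)
    have l3: "((A + s) * ln (A + s) - A * ln A) / s = (1 + c) * ln (A + s) - c * ln A"
      using s by (simp add: c_def field_simps)
    show ?thesis unfolding l1 l2 l3 by (simp add: algebra_simps)
  qed
  finally show ?thesis .
qed

text \<open>The residue formula needs \<open>s > 0\<close>, so the mass is obtained as the limit of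
  the transform at \<open>A = 1\<close> when \<open>s\<close> tends to 0.\<close>

lemma vartheta_total_mass:
  assumes a: "0 < \<alpha>" "\<alpha> \<le> 1"
  shows "(\<integral>z. indicator {0<..<1} z * vartheta \<alpha> z \<partial>lborel) = 1"
proof -
  define s where "s = (\<lambda>n::nat. 1 / (real n + 1))"
  have s: "s n > 0" for n unfolding s_def by simp
  have s0: "s \<longlonglongrightarrow> 0" unfolding s_def by real_asymp
  have "(\<lambda>n. \<integral>z. indicator {0<..<1} z * ((1 + s n * z) powr (- \<alpha>) * vartheta \<alpha> z) \<partial>lborel) \<longlonglongrightarrow>
    (\<integral>z. indicator {0<..<1} z * ((1 + 0 * z) powr (- \<alpha>) * vartheta \<alpha> z) \<partial>lborel)"
  proof (rule integral_dominated_convergence[where w="\<lambda>z. \<bar>indicator {0<..<1} z * (1 * vartheta \<alpha> z)\<bar>"])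
    have ie: "integrable lborel (\<lambda>z. indicator {0<..<1} z * ((1 + u * z) powr (- \<alpha>) * vartheta \<alpha> z))" if "u \<ge> 0" for u
      by (rule integrable_vartheta_mult[OF a, where B=1])
        (use that a in \<open>auto simp: powr_minus inverse_le_1_iff intro!: ge_one_powr_ge_zero\<close>)
    show "(\<lambda>z. indicator {0<..<1} z * ((1 + 0 * z) powr (- \<alpha>) * vartheta \<alpha> z)) \<in> borel_measurable lborel"
      using ie[of 0] by (intro borel_measurable_integrable) simp
    show "(\<lambda>z. indicator {0<..<1} z * ((1 + s n * z) powr (- \<alpha>) * vartheta \<alpha> z)) \<in> borel_measurable lborel" for n
      using ie[of "s n"] s[of n] by (intro borel_measurable_integrable) simp
    show "integrable lborel (\<lambda>z. \<bar>indicator {0<..<1} z * (1 * vartheta \<alpha> z)\<bar>)"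
      by (intro integrable_abs integrable_vartheta_mult[OF a, where B=1]) auto
    show "AE z in lborel. (\<lambda>n. indicator {0<..<1} z * ((1 + s n * z) powr (- \<alpha>) * vartheta \<alpha> z)) \<longlonglongrightarrow>
       indicator {0<..<1} z * ((1 + 0 * z) powr (- \<alpha>) * vartheta \<alpha> z)"
      by (intro AE_I2 tendsto_intros s0) auto
    show "AE z in lborel. norm (indicator {0<..<1} z * ((1 + s n * z) powr (- \<alpha>) * vartheta \<alpha> z)) \<le>
       \<bar>indicator {0<..<1} z * (1 * vartheta \<alpha> z)\<bar>" for n
    proof (rule AE_I2)
      fix z :: real
      show "norm (indicator {0<..<1} z * ((1 + s n * z) powr (- \<alpha>) * vartheta \<alpha> z)) \<le> \<bar>indicator {0<..<1} z * (1 * vartheta \<alpha> z)\<bar>"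
      proof (cases "z \<in> {0<..<1}")
        case True
        have "(1 + s n * z) powr (- \<alpha>) \<le> 1"
          using True s[of n] a by (auto simp: powr_minus inverse_le_1_iff intro!: ge_one_powr_ge_zero)
        then show ?thesis using True by (simp add: abs_mult mult_left_le_one_le)
      qed simp
    qed
  qed
  moreover have "(\<integral>z. indicator {0<..<1} z * ((1 + s n * z) powr (- \<alpha>) * vartheta \<alpha> z) \<partial>lborel) =
     exp (- \<alpha> * (((1 + s n) * ln (1 + s n)) / s n - 1))" for n
    using vartheta_transform_pos[OF a zero_less_one s] by simp
  moreover have "(\<lambda>n. exp (- \<alpha> * (((1 + s n) * ln (1 + s n)) / s n - 1))) \<longlonglongrightarrow> exp (- \<alpha> * (1 - 1))"
  proof -
    have "(\<lambda>n. ((1 + s n) * ln (1 + s n)) / s n) \<longlonglongrightarrow> 1" unfolding s_def by real_asymp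
    then show ?thesis by (intro tendsto_intros)
  qed
  ultimately show ?thesis using LIMSEQ_unique by fastforce
qed

lemma vartheta_transform:
  assumes a: "0 < \<alpha>" "\<alpha> \<le> 1" and A: "A > 0" and s: "s \<ge> 0"
  shows "(\<integral>z. indicator {0<..<1} z * ((A + s * z) powr (- \<alpha>) * vartheta \<alpha> z) \<partial>lborel) =
    exp (- \<alpha> * integral {0..1} (\<lambda>t. ln (A + s * t)))"
proof (cases "s = 0")
  case True
  have "(\<integral>z. indicator {0<..<1} z * ((A + s * z) powr (- \<alpha>) * vartheta \<alpha> z) \<partial>lborel) =
    (\<integral>z. A powr (- \<alpha>) * (indicator {0<..<1} z * vartheta \<alpha> z) \<partial>lborel)"
    by (simp add: True mult_ac)
  also have "\<dots> = A powr (- \<alpha>)" using vartheta_total_mass[OF a] by simp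
  finally show ?thesis using A True by (simp add: powr_def)
next
  case False
  then show ?thesis using vartheta_transform_pos[OF a A, of s] integral_ln_affine[OF A, of s, THEN integral_unique] s
    by simp
qed

text \<open>Differentiating the closed form with respect to \<open>A\<close> at 1 raises the
  exponent to \<open>\<alpha> + 1\<close> and brings down \<open>ln (1 + s) / s\<close>, the
  transform of the uniform law. This is the invariance under stick breaking, expressed through
  transforms.\<close>

lemma vartheta_transform_Suc:
  assumes a: "0 < \<alpha>" "\<alpha> \<le> 1" and s: "s > 0"
  shows "(\<integral>z. indicator {0<..<1} z * ((1 + s * z) powr (- (\<alpha> + 1)) * vartheta \<alpha> z) \<partial>lborel) =
    ln (1 + s) / s * (\<integral>z. indicator {0<..<1} z * ((1 + s * z) powr (- \<alpha>) * vartheta \<alpha> z) \<partial>lborel)"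
proof -
  define T where "T = (\<lambda>A. \<integral>z. indicator {0<..<1} z * ((A + s * z) powr (- \<alpha>) * vartheta \<alpha> z) \<partial>lborel)"
  define R where "R = (\<lambda>A. exp (- \<alpha> * (((A + s) * ln (A + s) - A * ln A) / s - 1)))"
  have TR: "A > 0 \<Longrightarrow> T A = R A" for A unfolding T_def R_def by (rule vartheta_transform_pos[OF a _ s])
  have dR: "(R has_real_derivative R 1 * (- \<alpha> * (ln (1 + s) / s))) (at 1)"
  proof -
    have "((\<lambda>A. ((A + s) * ln (A + s) - A * ln A) / s - 1) has_real_derivative (ln (1 + s) / s)) (at 1)"
    proof -
      have "((\<lambda>A. (A + s) * ln (A + s)) has_real_derivative (ln (1 + s) + 1)) (at 1)"
        using DERIV_x_ln_x[of "1 + s"] s by (subst DERIV_shift[symmetric, where f="\<lambda>x. x * ln x"]) auto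
      from DERIV_diff[OF DERIV_cdivide[OF DERIV_diff[OF this DERIV_x_ln_x[OF zero_less_one]], of s] DERIV_const[of 1]]
      show ?thesis by simp
    qed
    from DERIV_fun_exp[OF DERIV_cmult[OF this, of "- \<alpha>"]] show ?thesis unfolding R_def by simp
  qed
  define e where "e = (\<lambda>n::nat. 1 / (real n + 1))"
  have e: "e n > 0" for n unfolding e_def by simp
  have e0: "e \<longlonglongrightarrow> 0" unfolding e_def by real_asymp
  have e_at: "filterlim e (at 0) sequentially"
    using e0 e by (intro filterlim_atI) (auto simp: less_imp_neq[symmetric])
  have lim1: "(\<lambda>n. (T (1 + e n) - T 1) / e n) \<longlonglongrightarrow> R 1 * (- \<alpha> * (ln (1 + s) / s))"
  proof -
    have "((\<lambda>h. (R (1 + h) - R 1) / h) \<longlongrightarrow> R 1 * (- \<alpha> * (ln (1 + s) / s))) (at 0)"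
      using dR by (simp add: DERIV_def)
    from filterlim_compose[OF this e_at] show ?thesis
      using TR e by (simp add: add_pos_pos)
  qed
  let ?f = "\<lambda>n z. indicator {0<..<1} z * (((1 + e n + s * z) powr (- \<alpha>) - (1 + s * z) powr (- \<alpha>)) / e n * vartheta \<alpha> z)"
  have ib: "integrable lborel (\<lambda>z. indicator {0<..<1} z * ((A + s * z) powr (- p) * vartheta \<alpha> z))" if "A \<ge> 1" "p > 0" for A p
    by (rule integrable_vartheta_mult[OF a, where B=1])
      (use that a s in \<open>auto simp: powr_minus inverse_le_1_iff intro!: ge_one_powr_ge_zero add_increasing2\<close>)
  have diff: "(T (1 + e n) - T 1) / e n = (\<integral>z. ?f n z \<partial>lborel)" for n
  proof -
    have "(T (1 + e n) - T 1) / e n = (\<integral>z. (indicator {0<..<1} z * ((1 + e n + s * z) powr (- \<alpha>) * vartheta \<alpha> z) -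
        indicator {0<..<1} z * ((1 + s * z) powr (- \<alpha>) * vartheta \<alpha> z)) / e n \<partial>lborel)"
      unfolding T_def using ib[of "1 + e n" \<alpha>] ib[of 1 \<alpha>] e[of n] a by simp
    also have "\<dots> = (\<integral>z. ?f n z \<partial>lborel)"
      by (intro Bochner_Integration.integral_cong) (auto simp: field_simps)
    finally show ?thesis .
  qed
  have dz: "((\<lambda>A. (A + s * z) powr (- \<alpha>)) has_real_derivative (- \<alpha> * (A + s * z) powr (- \<alpha> - 1))) (at A)"
    if "A + s * z > 0" for A z
    using that by (auto intro!: derivative_eq_intros simp: powr_diff)
  have lim2: "(\<lambda>n. \<integral>z. ?f n z \<partial>lborel) \<longlonglongrightarrow>
     (\<integral>z. indicator {0<..<1} z * ((- \<alpha> * (1 + s * z) powr (- (\<alpha> + 1))) * vartheta \<alpha> z) \<partial>lborel)"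
  proof (rule integral_dominated_convergence[where w="\<lambda>z. \<bar>indicator {0<..<1} z * (1 * vartheta \<alpha> z)\<bar>"])
    show "integrable lborel (\<lambda>z. \<bar>indicator {0<..<1} z * (1 * vartheta \<alpha> z)\<bar>)"
      by (intro integrable_abs integrable_vartheta_mult[OF a, where B=1]) auto
    have "(\<lambda>z. - \<alpha> * (indicator {0<..<1} z * ((1 + s * z) powr (- (\<alpha> + 1)) * vartheta \<alpha> z))) \<in> borel_measurable lborel"
      using ib[of 1 "\<alpha> + 1"] a by (intro borel_measurable_times borel_measurable_integrable) auto
    then show "(\<lambda>z. indicator {0<..<1} z * ((- \<alpha> * (1 + s * z) powr (- (\<alpha> + 1))) * vartheta \<alpha> z)) \<in> borel_measurable lborel"
      by (simp add: mult_ac)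
    show "?f n \<in> borel_measurable lborel" for n
    proof -
      have feq: "?f n = (\<lambda>z. (indicator {0<..<1} z * ((1 + e n + s * z) powr (- \<alpha>) * vartheta \<alpha> z) -
          indicator {0<..<1} z * ((1 + s * z) powr (- \<alpha>) * vartheta \<alpha> z)) / e n)"
      proof (rule ext)
        fix z :: real
        have "i * ((p - q) / d * v) = (i * (p * v) - i * (q * v)) / d" for i p q d v :: real
          by (simp add: algebra_simps diff_divide_distrib)
        then show "?f n z = (indicator {0<..<1} z * ((1 + e n + s * z) powr (- \<alpha>) * vartheta \<alpha> z) -
          indicator {0<..<1} z * ((1 + s * z) powr (- \<alpha>) * vartheta \<alpha> z)) / e n" .
      qed
      have le: "1 + e n \<ge> 1" "\<alpha> > 0" using e[of n] a by auto
      show ?thesis unfolding feq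
        by (rule borel_measurable_divide[OF borel_measurable_diff[OF borel_measurable_integrable[OF ib[OF le]]
              borel_measurable_integrable[OF ib[OF order_refl le(2)]]] borel_measurable_const])
    qed
    show "AE z in lborel. (\<lambda>n. ?f n z) \<longlonglongrightarrow> indicator {0<..<1} z * ((- \<alpha> * (1 + s * z) powr (- (\<alpha> + 1))) * vartheta \<alpha> z)"
    proof (rule AE_I2)
      fix z :: real
      show "(\<lambda>n. ?f n z) \<longlonglongrightarrow> indicator {0<..<1} z * ((- \<alpha> * (1 + s * z) powr (- (\<alpha> + 1))) * vartheta \<alpha> z)"
      proof (cases "z \<in> {0<..<1}")
        case True
        have p: "1 + s * z > 0" using True s by (intro add_pos_pos) auto
        have "((\<lambda>h. ((1 + h + s * z) powr (- \<alpha>) - (1 + s * z) powr (- \<alpha>)) / h) \<longlongrightarrow> - \<alpha> * (1 + s * z) powr (- \<alpha> - 1)) (at 0)"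
          using dz[OF p] by (simp add: DERIV_def)
        from filterlim_compose[OF this e_at]
        have "(\<lambda>n. ((1 + e n + s * z) powr (- \<alpha>) - (1 + s * z) powr (- \<alpha>)) / e n) \<longlonglongrightarrow> - \<alpha> * (1 + s * z) powr (- (\<alpha> + 1))"
          by simp
        then show ?thesis by (intro tendsto_intros)
      qed simp
    qed
    show "AE z in lborel. norm (?f n z) \<le> \<bar>indicator {0<..<1} z * (1 * vartheta \<alpha> z)\<bar>" for n
    proof (rule AE_I2)
      fix z :: real
      show "norm (?f n z) \<le> \<bar>indicator {0<..<1} z * (1 * vartheta \<alpha> z)\<bar>"
      proof (cases "z \<in> {0<..<1}")
        case True
        then have sz: "s * z > 0" using s by simp
        \<comment> \<open>By the mean value theorem the difference quotient is
          \<open>- \<alpha>\<close> times a negative power of a number above 1, hence at most 1 in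
          absolute value.\<close>
        have "\<exists>x. 1 < x \<and> x < 1 + e n \<and> (1 + e n + s * z) powr (- \<alpha>) - (1 + s * z) powr (- \<alpha>) = (1 + e n - 1) * (- \<alpha> * (x + s * z) powr (- \<alpha> - 1))"
          using e[of n] sz by (intro MVT2[where f="\<lambda>A. (A + s * z) powr (- \<alpha>)"] dz) auto
        then obtain x where x: "1 < x" "(1 + e n + s * z) powr (- \<alpha>) - (1 + s * z) powr (- \<alpha>) = e n * (- \<alpha> * (x + s * z) powr (- \<alpha> - 1))"
          by auto
        have "(x + s * z) powr (- \<alpha> - 1) \<le> 1 powr (- \<alpha> - 1)"
          using x(1) sz a by (intro powr_mono2') auto
        then have "\<alpha> * (x + s * z) powr (- \<alpha> - 1) \<le> 1 * 1" using a by (intro mult_mono) auto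
        then have "\<bar>((1 + e n + s * z) powr (- \<alpha>) - (1 + s * z) powr (- \<alpha>)) / e n\<bar> \<le> 1"
          unfolding x(2) using e[of n] a by (simp add: abs_mult)
        then have "\<bar>((1 + e n + s * z) powr (- \<alpha>) - (1 + s * z) powr (- \<alpha>)) / e n\<bar> * \<bar>vartheta \<alpha> z\<bar> \<le> 1 * \<bar>vartheta \<alpha> z\<bar>"
          by (intro mult_right_mono) auto
        then show ?thesis using True by (simp only: real_norm_def abs_mult) simp
      qed simp
    qed
  qed
  have "(\<integral>z. indicator {0<..<1} z * ((- \<alpha> * (1 + s * z) powr (- (\<alpha> + 1))) * vartheta \<alpha> z) \<partial>lborel) = R 1 * (- \<alpha> * (ln (1 + s) / s))"
    using LIMSEQ_unique[OF lim2 lim1[unfolded diff]] .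
  moreover have "(\<integral>z. indicator {0<..<1} z * ((- \<alpha> * (1 + s * z) powr (- (\<alpha> + 1))) * vartheta \<alpha> z) \<partial>lborel) =
     (\<integral>z. - \<alpha> * (indicator {0<..<1} z * ((1 + s * z) powr (- (\<alpha> + 1)) * vartheta \<alpha> z)) \<partial>lborel)"
    by (simp add: mult_ac)
  ultimately have e: "- \<alpha> * (\<integral>z. indicator {0<..<1} z * ((1 + s * z) powr (- (\<alpha> + 1)) * vartheta \<alpha> z) \<partial>lborel) = - \<alpha> * (ln (1 + s) / s * T 1)"
    using TR[of 1] by (simp add: field_simps)
  have "- \<alpha> \<noteq> 0" using a by simp
  from mult_left_cancel[OF this, THEN iffD1, OF e] show ?thesis unfolding T_def .
qed

section \<open>Positivity of the function vartheta\<close>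

text \<open>Markov-Krein for two weights with parameters 1 and \<alpha>; the constant
  \<open>Gamma (1 + \<alpha>) / Gamma \<alpha>\<close> equals \<alpha>.\<close>

lemma beta_markov_krein:
  fixes u v \<alpha> :: real
  assumes "\<alpha> > 0" "u > 0" "v > 0"
  shows "(\<integral>\<^sup>+\<theta>. ennreal (indicator {0<..<1} \<theta> * (\<alpha> * (1 - \<theta>) powr (\<alpha> - 1) *
      (u * \<theta> + v * (1 - \<theta>)) powr (- (\<alpha> + 1)))) \<partial>lborel) = ennreal (inverse u * v powr (- \<alpha>))"
proof -
  define a where "a = (\<lambda>i::nat. if i = 1 then 1 else \<alpha>)"
  define c where "c = (\<lambda>i::nat. if i = 1 then u else v)"
  let ?F = "\<lambda>\<theta>. ennreal (indicator {0<..<1} \<theta> * (\<alpha> * (1 - \<theta>) powr (\<alpha> - 1) *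
      (u * \<theta> + v * (1 - \<theta>)) powr (- (\<alpha> + 1))))"
  have s2: "{1..2} = {1, 2 :: nat}" by auto
  have "(\<integral>\<^sup>+y. ennreal (dirichlet_density 2 a y *
            (\<Sum>i=1..2. c i * incr 2 y i) powr (- (\<Sum>i=1..2. a i))) \<partial>leb (2 - 1)) =
         ennreal (\<Prod>i=1..2. c i powr (- a i))"
    by (rule dirichlet_markov_krein) (use assms in \<open>auto simp: a_def c_def\<close>)
  also have "(\<Prod>i=1..2. c i powr (- a i)) = inverse u * v powr (- \<alpha>)"
    unfolding s2 using assms by (simp add: a_def c_def powr_minus)
  also have "(\<integral>\<^sup>+y. ennreal (dirichlet_density 2 a y *
            (\<Sum>i=1..2. c i * incr 2 y i) powr (- (\<Sum>i=1..2. a i))) \<partial>leb (2 - 1)) = (\<integral>\<^sup>+y. ?F (y 1) \<partial>PiM {1::nat} (\<lambda>_. lborel))"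
  proof -
    have "leb (2 - 1) = PiM {1} (\<lambda>_. lborel)" by (simp add: leb_def)
    moreover have "ennreal (dirichlet_density 2 a y * (\<Sum>i=1..2. c i * incr 2 y i) powr (- (\<Sum>i=1..2. a i))) = ?F (y 1)" for y
    proof -
      have i: "incr 2 y 1 = y 1" "incr 2 y 2 = 1 - y 1" by (auto simp: incr_def node_def)
      have Gp: "Gamma (1 + \<alpha>) = \<alpha> * Gamma \<alpha>"
      proof -
        have "\<alpha> \<notin> \<int>\<^sub>\<le>\<^sub>0" using assms(1) nonpos_Ints_nonpos not_le by blast
        then show ?thesis using Gamma_plus1[of \<alpha>] by (simp add: add.commute)
      qed
      have g: "Gamma (\<Sum>i=1..2. a i) / (\<Prod>i=1..2. Gamma (a i)) = \<alpha>"
        unfolding s2 using less_imp_neq[OF Gamma_real_pos[OF assms(1)], symmetric] by (simp add: a_def Gp)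
      have p: "(\<Prod>j=1..2. indicator {0<..} (incr 2 y j) * incr 2 y j powr (a j - 1)) =
         indicator {0<..<1} (y 1) * (1 - y 1) powr (\<alpha> - 1)"
        unfolding s2 using i by (auto simp: a_def indicator_def)
      have q: "(\<Sum>j=1..2. c j * incr 2 y j) = u * y 1 + v * (1 - y 1)" "(\<Sum>j=1..2. a j) = \<alpha> + 1"
        unfolding s2 using i by (auto simp: c_def a_def)
      show ?thesis unfolding dirichlet_density_def g unfolding p q by (simp add: mult_ac)
    qed
    ultimately show ?thesis by (simp only:)
  qed
  also have "\<dots> = (\<integral>\<^sup>+\<theta>. ?F \<theta> \<partial>lborel)"
    by (rule lb.product_nn_integral_singleton) measurable
  finally show ?thesis .
qed

text \<open>The transition density of the chain \<open>m \<mapsto> (1 - \<theta>) m + \<theta> U\<close> with \<open>\<theta>\<close> of law Beta(1, \<open>\<alpha>\<close>) and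
  \<open>U\<close> uniform (Sethuraman's stick breaking), which leaves \<open>vartheta \<alpha>\<close> invariant.\<close>

definition stick :: "real \<Rightarrow> real \<Rightarrow> real \<Rightarrow> ennreal" where
  "stick \<alpha> z m = (\<integral>\<^sup>+\<theta>. ennreal (indicator {0<..<1} \<theta> * (\<alpha> * (1 - \<theta>) powr (\<alpha> - 1) / \<theta>) *
     (if (1 - \<theta>) * m < z \<and> z < (1 - \<theta>) * m + \<theta> then 1 else 0)) \<partial>lborel)"

lemma stick_measurable [measurable]:
  "(\<lambda>(z, m). stick \<alpha> z m) \<in> borel_measurable (borel \<Otimes>\<^sub>M borel)"
  unfolding stick_def by measurable

lemma stick_eq_0:
  assumes "0 < m" "m < 1" "z \<notin> {0<..<1}"
  shows "stick \<alpha> z m = 0"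
proof -
  have "(if (1 - \<theta>) * m < z \<and> z < (1 - \<theta>) * m + \<theta> then 1 else 0) = (0::real)" if "\<theta> \<in> {0<..<1}" for \<theta>
  proof (rule ccontr)
    assume "(if (1 - \<theta>) * m < z \<and> z < (1 - \<theta>) * m + \<theta> then 1 else 0) \<noteq> (0::real)"
    then have 1: "(1 - \<theta>) * m < z" "z < (1 - \<theta>) * m + \<theta>" by (auto split: if_splits)
    have "0 < (1 - \<theta>) * m" using that assms by simp
    moreover have "(1 - \<theta>) * m < (1 - \<theta>) * 1" using that assms by (intro mult_strict_left_mono) auto
    ultimately have "0 < z" "z < 1" using 1 by auto
    then show False using assms(3) by simp
  qed
  then have "indicator {0<..<1} \<theta> * (\<alpha> * (1 - \<theta>) powr (\<alpha> - 1) / \<theta>) *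
     (if (1 - \<theta>) * m < z \<and> z < (1 - \<theta>) * m + \<theta> then 1 else 0) = 0" for \<theta>
    by (cases "\<theta> \<in> {0<..<1}") auto
  then show ?thesis unfolding stick_def by (simp only: ennreal_0) simp
qed

text \<open>Once \<open>\<theta> > 1 - \<epsilon>\<close>, the interval over which the new position
  is spread covers \<open>(\<epsilon>, 1 - \<epsilon>)\<close> wherever \<open>m\<close> lies. That
  event has probability \<open>\<epsilon> powr \<alpha>\<close>, and the spread density
  \<open>1 / \<theta>\<close> is at least 1. Independence of \<open>m\<close> lets the bound pass
  through the integral in \<open>vartheta_pos\<close>.\<close>

lemma stick_ge:
  assumes a: "\<alpha> > 0" and e: "0 < \<epsilon>" "\<epsilon> < z" "z < 1 - \<epsilon>" and m: "0 < m" "m < 1"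
  shows "stick \<alpha> z m \<ge> ennreal (\<epsilon> powr \<alpha>)"
proof -
  have "ennreal (\<epsilon> powr \<alpha>) = ennreal \<alpha> * ennreal ((1 - (1 - \<epsilon>)) powr \<alpha> / \<alpha>)"
    using a by (simp add: ennreal_mult[symmetric])
  also have "\<dots> = ennreal \<alpha> * (\<integral>\<^sup>+\<theta>. ennreal (indicator {1 - \<epsilon><..<1} \<theta> * (1 - \<theta>) powr (\<alpha> - 1)) \<partial>lborel)"
    using nn_integral_powr_right[OF a, of "1 - \<epsilon>" 1] e by simp
  also have "\<dots> = (\<integral>\<^sup>+\<theta>. ennreal \<alpha> * ennreal (indicator {1 - \<epsilon><..<1} \<theta> * (1 - \<theta>) powr (\<alpha> - 1)) \<partial>lborel)"
    by (rule nn_integral_cmult[symmetric]) measurable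
  also have "\<dots> \<le> stick \<alpha> z m"
    unfolding stick_def
  proof (rule nn_integral_mono)
    fix \<theta> :: real
    show "ennreal \<alpha> * ennreal (indicator {1 - \<epsilon><..<1} \<theta> * (1 - \<theta>) powr (\<alpha> - 1)) \<le>
      ennreal (indicator {0<..<1} \<theta> * (\<alpha> * (1 - \<theta>) powr (\<alpha> - 1) / \<theta>) *
     (if (1 - \<theta>) * m < z \<and> z < (1 - \<theta>) * m + \<theta> then 1 else 0))"
    proof (cases "\<theta> \<in> {1 - \<epsilon><..<1}")
      case True
      then have t: "0 < \<theta>" "\<theta> < 1" "1 - \<epsilon> < \<theta>" using e by auto
      have "(1 - \<theta>) * m \<le> 1 - \<theta>" using t m by (intro mult_left_le) auto
      then have 1: "(1 - \<theta>) * m < z" using t e by linarith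
      have "(1 - \<theta>) * m \<ge> 0" using t m by simp
      then have 2: "z < (1 - \<theta>) * m + \<theta>" using t e by linarith
      have "\<alpha> * (1 - \<theta>) powr (\<alpha> - 1) \<le> \<alpha> * (1 - \<theta>) powr (\<alpha> - 1) / \<theta>"
        using t a by (simp add: le_divide_eq mult_left_le)
      then show ?thesis using True t 1 2 a by (simp add: ennreal_mult[symmetric] ennreal_leI)
    qed simp
  qed
  finally show ?thesis .
qed

definition ell :: "real \<Rightarrow> real" where
  "ell s = (if s = 0 then 1 else ln (1 + s) / s)"

lemma nn_integral_ell:
  assumes s: "s \<ge> 0"
  shows "(\<integral>\<^sup>+x. ennreal (indicator {0<..<1} x * inverse (1 + s * x)) \<partial>lborel) = ennreal (ell s)"
proof -
  have p: "1 + s * x > 0" if "x \<in> {0..1}" for x using that s by (intro add_pos_nonneg) auto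
  have "((\<lambda>x. inverse (1 + s * x)) has_integral ell s) {0..1}"
  proof (cases "s = 0")
    case True
    then show ?thesis using has_integral_const_real[of "1::real" 0 1] by (simp add: ell_def)
  next
    case False
    have "((\<lambda>x. inverse (1 + s * x)) has_integral (ln (1 + s * 1) / s - ln (1 + s * 0) / s)) {0..1}"
    proof (rule fundamental_theorem_of_calculus)
      fix x :: real assume "x \<in> {0..1}"
      then have "((\<lambda>x. ln (1 + s * x) / s) has_real_derivative inverse (1 + s * x)) (at x)"
        using p[of x] False by (auto intro!: derivative_eq_intros simp: divide_inverse)
      then show "((\<lambda>x. ln (1 + s * x) / s) has_vector_derivative inverse (1 + s * x)) (at x within {0..1})"
        by (simp add: has_real_derivative_iff_has_vector_derivative has_vector_derivative_at_within)
    qed simp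
    then show ?thesis using False by (simp add: ell_def)
  qed
  then have "(\<integral>\<^sup>+x. ennreal (indicator {0..1} x * inverse (1 + s * x)) \<partial>lborel) = ennreal (ell s)"
    using p by (intro nn_integral_has_integral_lebesgue) (auto simp: less_imp_le)
  also have "(\<integral>\<^sup>+x. ennreal (indicator {0..1} x * inverse (1 + s * x)) \<partial>lborel) =
     (\<integral>\<^sup>+x. ennreal (indicator {0<..<1} x * inverse (1 + s * x)) \<partial>lborel)"
    by (intro nn_integral_cong_AE AE_I[where N="{0, 1}"])
      (auto simp: indicator_def split: if_splits intro!: emeasure_lborel_countable)
  finally show ?thesis .
qed

text \<open>With \<open>z = (1 - \<theta>) * m + \<theta> * x\<close> the Jacobian cancels
  \<open>1 / \<theta>\<close>, and \<open>1 + s * z\<close> is the mixture of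
  \<open>1 + s * x\<close> and \<open>1 + s * m\<close> with weights \<theta> and
  \<open>1 - \<theta>\<close>. Integrating out \<theta> by \<open>beta_markov_krein\<close> leaves a
  product; the exponent \<open>\<alpha> + 1\<close> is the total of its parameters.\<close>

lemma stick_transform:
  assumes a: "\<alpha> > 0" and m: "0 < m" "m < 1" and s: "s \<ge> 0"
  shows "(\<integral>\<^sup>+z. ennreal ((1 + s * z) powr (- (\<alpha> + 1))) * stick \<alpha> z m \<partial>lborel) =
    ennreal (ell s * (1 + s * m) powr (- \<alpha>))"
proof -
  let ?w = "\<lambda>\<theta>. indicator {0<..<1} \<theta> * (\<alpha> * (1 - \<theta>) powr (\<alpha> - 1) / \<theta>)"
  let ?I = "\<lambda>z \<theta>. if (1 - \<theta>) * m < z \<and> z < (1 - \<theta>) * m + \<theta> then 1 else 0 :: real"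
  let ?\<phi> = "\<lambda>z. (1 + s * z) powr (- (\<alpha> + 1))"
  have w0: "?w \<theta> \<ge> 0" for \<theta> using a by (auto simp: indicator_def)
  have "(\<integral>\<^sup>+z. ennreal (?\<phi> z) * stick \<alpha> z m \<partial>lborel) = (\<integral>\<^sup>+z. (\<integral>\<^sup>+\<theta>. ennreal (?\<phi> z) * ennreal (?w \<theta> * ?I z \<theta>) \<partial>lborel) \<partial>lborel)"
    unfolding stick_def by (intro nn_integral_cong nn_integral_cmult[symmetric]) measurable
  also have "\<dots> = (\<integral>\<^sup>+\<theta>. (\<integral>\<^sup>+z. ennreal (?\<phi> z) * ennreal (?w \<theta> * ?I z \<theta>) \<partial>lborel) \<partial>lborel)"
    by (rule lborel_pair.Fubini') measurable
  also have "\<dots> = (\<integral>\<^sup>+\<theta>. (\<integral>\<^sup>+x. ennreal (indicator {0<..<1} \<theta> * indicator {0<..<1} x * (\<alpha> * (1 - \<theta>) powr (\<alpha> - 1) *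
      ((1 + s * x) * \<theta> + (1 + s * m) * (1 - \<theta>)) powr (- (\<alpha> + 1)))) \<partial>lborel) \<partial>lborel)"
  proof (rule nn_integral_cong)
    fix \<theta> :: real
    show "(\<integral>\<^sup>+z. ennreal (?\<phi> z) * ennreal (?w \<theta> * ?I z \<theta>) \<partial>lborel) =
      (\<integral>\<^sup>+x. ennreal (indicator {0<..<1} \<theta> * indicator {0<..<1} x * (\<alpha> * (1 - \<theta>) powr (\<alpha> - 1) *
      ((1 + s * x) * \<theta> + (1 + s * m) * (1 - \<theta>)) powr (- (\<alpha> + 1)))) \<partial>lborel)"
    proof (cases "\<theta> \<in> {0<..<1}")
      case True
      then have t: "0 < \<theta>" "\<theta> < 1" by auto
      have "(\<integral>\<^sup>+z. ennreal (?\<phi> z) * ennreal (?w \<theta> * ?I z \<theta>) \<partial>lborel) =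
        ennreal \<theta> * (\<integral>\<^sup>+x. ennreal (?\<phi> ((1 - \<theta>) * m + \<theta> * x)) * ennreal (?w \<theta> * ?I ((1 - \<theta>) * m + \<theta> * x) \<theta>) \<partial>lborel)"
        using t by (subst nn_integral_real_affine[where c=\<theta> and t="(1 - \<theta>) * m"]) auto
      also have "\<dots> = (\<integral>\<^sup>+x. ennreal \<theta> * (ennreal (?\<phi> ((1 - \<theta>) * m + \<theta> * x)) * ennreal (?w \<theta> * ?I ((1 - \<theta>) * m + \<theta> * x) \<theta>)) \<partial>lborel)"
        by (rule nn_integral_cmult[symmetric]) measurable
      also have "\<dots> = (\<integral>\<^sup>+x. ennreal (indicator {0<..<1} \<theta> * indicator {0<..<1} x * (\<alpha> * (1 - \<theta>) powr (\<alpha> - 1) *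
        ((1 + s * x) * \<theta> + (1 + s * m) * (1 - \<theta>)) powr (- (\<alpha> + 1)))) \<partial>lborel)"
      proof (rule nn_integral_cong)
        fix x :: real
        have i: "?I ((1 - \<theta>) * m + \<theta> * x) \<theta> = indicator {0<..<1} x"
          using t by (auto simp: indicator_def zero_less_mult_iff)
        have f: "?\<phi> ((1 - \<theta>) * m + \<theta> * x) = ((1 + s * x) * \<theta> + (1 + s * m) * (1 - \<theta>)) powr (- (\<alpha> + 1))"
          by (simp add: algebra_simps)
        show "ennreal \<theta> * (ennreal (?\<phi> ((1 - \<theta>) * m + \<theta> * x)) * ennreal (?w \<theta> * ?I ((1 - \<theta>) * m + \<theta> * x) \<theta>)) =
          ennreal (indicator {0<..<1} \<theta> * indicator {0<..<1} x * (\<alpha> * (1 - \<theta>) powr (\<alpha> - 1) *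
          ((1 + s * x) * \<theta> + (1 + s * m) * (1 - \<theta>)) powr (- (\<alpha> + 1))))"
          unfolding i f using t a True by (auto simp: ennreal_mult[symmetric] indicator_def)
      qed
      finally show ?thesis .
    qed simp
  qed
  also have "\<dots> = (\<integral>\<^sup>+x. (\<integral>\<^sup>+\<theta>. ennreal (indicator {0<..<1} \<theta> * indicator {0<..<1} x * (\<alpha> * (1 - \<theta>) powr (\<alpha> - 1) *
      ((1 + s * x) * \<theta> + (1 + s * m) * (1 - \<theta>)) powr (- (\<alpha> + 1)))) \<partial>lborel) \<partial>lborel)"
    by (rule lborel_pair.Fubini') measurable
  also have "\<dots> = (\<integral>\<^sup>+x. ennreal ((1 + s * m) powr (- \<alpha>)) * ennreal (indicator {0<..<1} x * inverse (1 + s * x)) \<partial>lborel)"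
  proof (rule nn_integral_cong)
    fix x :: real
    show "(\<integral>\<^sup>+\<theta>. ennreal (indicator {0<..<1} \<theta> * indicator {0<..<1} x * (\<alpha> * (1 - \<theta>) powr (\<alpha> - 1) *
      ((1 + s * x) * \<theta> + (1 + s * m) * (1 - \<theta>)) powr (- (\<alpha> + 1)))) \<partial>lborel) =
      ennreal ((1 + s * m) powr (- \<alpha>)) * ennreal (indicator {0<..<1} x * inverse (1 + s * x))"
    proof (cases "x \<in> {0<..<1}")
      case True
      then have "1 + s * x > 0" "1 + s * m > 0" using s m by (auto intro!: add_pos_nonneg)
      then show ?thesis using beta_markov_krein[OF a, of "1 + s * x" "1 + s * m"] True
        by (simp add: ennreal_mult[symmetric] mult.commute)
    qed simp
  qed
  also have "\<dots> = ennreal ((1 + s * m) powr (- \<alpha>)) * ennreal (ell s)"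
    by (subst nn_integral_cmult) (auto simp: nn_integral_ell[OF s])
  also have "\<dots> = ennreal (ell s * (1 + s * m) powr (- \<alpha>))"
    by (subst ennreal_mult'[symmetric]) (auto simp: mult.commute)
  finally show ?thesis .
qed

lemma measure_eqI_markov_krein_real:
  fixes M N :: "real measure"
  assumes sM: "sets M = sets borel" and sN: "sets N = sets borel"
    and M: "finite_measure M" and N: "finite_measure N"
    and bM: "AE x in M. x \<in> {0..1}" and bN: "AE x in N. x \<in> {0..1}"
    and b: "b > 0"
    and eq: "\<And>s. s \<ge> 0 \<Longrightarrow> (\<integral>x. (1 + s * x) powr (- b) \<partial>M) = (\<integral>x. (1 + s * x) powr (- b) \<partial>N)"
  shows "M = N"
proof -
  let ?P = "PiM {0::nat} (\<lambda>_. borel :: real measure)"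
  let ?e = "\<lambda>x. \<lambda>i\<in>{0::nat}. x :: real"
  have em: "?e \<in> measurable borel ?P" by measurable
  have mM: "measurable M ?P = measurable borel ?P" and mN: "measurable N ?P = measurable borel ?P"
    using sM sN by (auto intro: measurable_cong_sets)
  have bk: "distr (distr K ?P ?e) borel (\<lambda>x. x 0) = K" if "sets K = sets borel" for K
  proof -
    have mK: "measurable K ?P = measurable borel ?P" using that by (auto intro: measurable_cong_sets)
    have "distr (distr K ?P ?e) borel (\<lambda>x. x 0) = distr K borel ((\<lambda>x. x 0) \<circ> ?e)"
      using em mK by (intro distr_distr) auto
    also have "(\<lambda>x. x 0) \<circ> ?e = (\<lambda>x. x)" by auto
    also have "distr K borel (\<lambda>x. x) = K" using that by (intro distr_id2) auto
    finally show ?thesis .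
  qed
  have "distr M ?P ?e = distr N ?P ?e"
  proof (rule measure_eqI_markov_krein[where I="{0}" and b=b])
    show "finite_measure (distr M ?P ?e)" "finite_measure (distr N ?P ?e)"
      using em mM mN M N by (auto intro: finite_measure.finite_measure_distr)
    show "AE x in distr M ?P ?e. \<forall>i\<in>{0}. x i \<in> {0..1}"
      using bM em mM by (subst AE_distr_iff) auto
    show "AE x in distr N ?P ?e. \<forall>i\<in>{0}. x i \<in> {0..1}"
      using bN em mN by (subst AE_distr_iff) auto
    fix l :: "nat \<Rightarrow> real" assume l: "\<And>i. i \<in> {0} \<Longrightarrow> l i \<ge> 0"
    have "(\<integral>x. (1 + (\<Sum>i\<in>{0}. l i * x i)) powr (- b) \<partial>distr M ?P ?e) = (\<integral>x. (1 + l 0 * x) powr (- b) \<partial>M)"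
      using em mM by (subst integral_distr) auto
    moreover have "(\<integral>x. (1 + (\<Sum>i\<in>{0}. l i * x i)) powr (- b) \<partial>distr N ?P ?e) = (\<integral>x. (1 + l 0 * x) powr (- b) \<partial>N)"
      using em mN by (subst integral_distr) auto
    ultimately show "(\<integral>x. (1 + (\<Sum>i\<in>{0}. l i * x i)) powr (- b) \<partial>distr M ?P ?e) =
       (\<integral>x. (1 + (\<Sum>i\<in>{0}. l i * x i)) powr (- b) \<partial>distr N ?P ?e)" using eq[of "l 0"] l by simp
  qed (use b in auto)
  then show ?thesis using bk[OF sM] bk[OF sN] by metis
qed

text \<open>By continuity the set where the bound fails is open; being null, it is empty.\<close>

lemma AE_ge_imp_ge:
  fixes f :: "real \<Rightarrow> real"
  assumes S: "open S" and f: "continuous_on S f" and ae: "AE z in lborel. z \<in> S \<longrightarrow> c \<le> f z" and z: "z \<in> S"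
  shows "c \<le> f z"
proof (rule ccontr)
  assume n: "\<not> c \<le> f z"
  let ?U = "S \<inter> f -` {..<c}"
  have U: "open ?U" using f S by (rule continuous_open_preimage) simp
  have "AE z in lborel. z \<notin> ?U" using ae by eventually_elim auto
  then have "?U \<in> null_sets lborel" using U by (subst (asm) AE_iff_null_sets[symmetric]) auto
  then have "negligible ?U" by (simp add: negligible_iff_null_sets null_sets_completionI)
  moreover have "?U \<noteq> {}" using n z by auto
  ultimately show False using open_not_negligible[OF U] by simp
qed

lemma integral_eq_diff_nn_integral:
  fixes f g :: "real \<Rightarrow> real"
  assumes int: "integrable lborel (\<lambda>z. g z * f z)" and g: "\<And>z. g z \<ge> 0"
    and fm: "f \<in> borel_measurable borel" and gm: "g \<in> borel_measurable borel"
  obtains P Q where "P \<ge> 0" "Q \<ge> 0"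
    "(\<integral>\<^sup>+z. ennreal (g z) * ennreal (f z) \<partial>lborel) = ennreal P"
    "(\<integral>\<^sup>+z. ennreal (g z) * ennreal (- f z) \<partial>lborel) = ennreal Q"
    "(\<integral>z. g z * f z \<partial>lborel) = P - Q"
proof -
  have e: "ennreal (g z) * ennreal (f z) = ennreal (g z * f z)" "ennreal (g z) * ennreal (- f z) = ennreal (- (g z * f z))" for z
    using g[of z] by (simp_all add: ennreal_mult'[symmetric])
  have fin: "(\<integral>\<^sup>+z. ennreal (norm (g z * f z)) \<partial>lborel) < \<infinity>" using int by (simp add: integrable_iff_bounded)
  have "(\<integral>\<^sup>+z. ennreal (g z * f z) \<partial>lborel) \<le> (\<integral>\<^sup>+z. ennreal (norm (g z * f z)) \<partial>lborel)"
    by (intro nn_integral_mono ennreal_leI) (simp add: abs_ge_self)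
  with fin have 1: "(\<integral>\<^sup>+z. ennreal (g z * f z) \<partial>lborel) < \<infinity>" by (rule le_less_trans[rotated])
  have "(\<integral>\<^sup>+z. ennreal (- (g z * f z)) \<partial>lborel) \<le> (\<integral>\<^sup>+z. ennreal (norm (g z * f z)) \<partial>lborel)"
    by (intro nn_integral_mono ennreal_leI) (simp add: abs_ge_minus_self)
  with fin have 2: "(\<integral>\<^sup>+z. ennreal (- (g z * f z)) \<partial>lborel) < \<infinity>" by (rule le_less_trans[rotated])
  show ?thesis
    by (rule that[of "enn2real (\<integral>\<^sup>+z. ennreal (g z * f z) \<partial>lborel)" "enn2real (\<integral>\<^sup>+z. ennreal (- (g z * f z)) \<partial>lborel)"])
      (use 1 2 int in \<open>auto simp: e real_lebesgue_integral_def\<close>)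
qed

text \<open>Write \<open>vartheta \<alpha> = p - q\<close> with positive and negative part. Invariance \<open>p + K q = q + K p\<close> gives
  \<open>q \<le> K q\<close>, with equality because \<open>K\<close> preserves mass; as the kernel is positive, \<open>q \<noteq> 0\<close> would
  force \<open>q > 0\<close> everywhere, against \<open>vartheta \<alpha>\<close> having mass 1. So \<open>vartheta \<alpha> = K p\<close> almost everywhere.\<close>

lemma vartheta_pos:
  assumes a: "0 < \<alpha>" "\<alpha> \<le> 1" and z: "0 < z" "z < 1"
  shows "vartheta \<alpha> z > 0"
proof -
  define f where "f = (\<lambda>z. indicator {0<..<1} z * vartheta \<alpha> z)"
  have fm[measurable]: "f \<in> borel_measurable borel" unfolding f_def by (rule vartheta_measurable[OF a])
  define p where "p = (\<lambda>z. ennreal (f z))"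
  define q where "q = (\<lambda>z. ennreal (- f z))"
  have [measurable]: "p \<in> borel_measurable borel" "q \<in> borel_measurable borel" unfolding p_def q_def by measurable
  define K where "K = (\<lambda>g z. \<integral>\<^sup>+m. stick \<alpha> z m * g m \<partial>lborel)"
  have Km[measurable]: "K g \<in> borel_measurable borel" if [measurable]: "g \<in> borel_measurable borel" for g
    unfolding K_def by measurable
  have p0: "p m = 0" "q m = 0" if "m \<notin> {0<..<1}" for m using that by (auto simp: p_def q_def f_def)
  have Ktrans: "(\<integral>\<^sup>+z. ennreal ((1 + s * z) powr (- (\<alpha> + 1))) * K g z \<partial>lborel) =
     ennreal (ell s) * (\<integral>\<^sup>+m. ennreal (\<bar>1 + s * m\<bar> powr (- \<alpha>)) * g m \<partial>lborel)"
    if s: "s \<ge> 0" and gm[measurable]: "g \<in> borel_measurable borel" and g0: "\<And>m. m \<notin> {0<..<1} \<Longrightarrow> g m = 0" for s g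
  proof -
    have el: "ell s \<ge> 0" using s by (auto simp: ell_def)
    have "(\<integral>\<^sup>+z. ennreal ((1 + s * z) powr (- (\<alpha> + 1))) * K g z \<partial>lborel) =
      (\<integral>\<^sup>+z. (\<integral>\<^sup>+m. ennreal ((1 + s * z) powr (- (\<alpha> + 1))) * (stick \<alpha> z m * g m) \<partial>lborel) \<partial>lborel)"
      unfolding K_def by (intro nn_integral_cong nn_integral_cmult[symmetric]) measurable
    also have "\<dots> = (\<integral>\<^sup>+m. (\<integral>\<^sup>+z. ennreal ((1 + s * z) powr (- (\<alpha> + 1))) * (stick \<alpha> z m * g m) \<partial>lborel) \<partial>lborel)"
      by (rule lborel_pair.Fubini') measurable
    also have "\<dots> = (\<integral>\<^sup>+m. ennreal (ell s) * (ennreal (\<bar>1 + s * m\<bar> powr (- \<alpha>)) * g m) \<partial>lborel)"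
    proof (rule nn_integral_cong)
      fix m :: real
      show "(\<integral>\<^sup>+z. ennreal ((1 + s * z) powr (- (\<alpha> + 1))) * (stick \<alpha> z m * g m) \<partial>lborel) =
         ennreal (ell s) * (ennreal (\<bar>1 + s * m\<bar> powr (- \<alpha>)) * g m)"
      proof (cases "m \<in> {0<..<1}")
        case True
        then have m: "0 < m" "m < 1" by auto
        have ab: "\<bar>1 + s * m\<bar> = 1 + s * m" using s m by simp
        have "(\<integral>\<^sup>+z. ennreal ((1 + s * z) powr (- (\<alpha> + 1))) * (stick \<alpha> z m * g m) \<partial>lborel) =
          (\<integral>\<^sup>+z. (ennreal ((1 + s * z) powr (- (\<alpha> + 1))) * stick \<alpha> z m) * g m \<partial>lborel)" by (simp only: mult.assoc)
        also have "\<dots> = (\<integral>\<^sup>+z. ennreal ((1 + s * z) powr (- (\<alpha> + 1))) * stick \<alpha> z m \<partial>lborel) * g m"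
          by (rule nn_integral_multc) measurable
        also have "\<dots> = ennreal (ell s * (1 + s * m) powr (- \<alpha>)) * g m"
          unfolding stick_transform[OF a(1) m s] ..
        finally show ?thesis using el by (simp add: ab ennreal_mult' mult.assoc)
      qed (simp add: g0)
    qed
    also have "\<dots> = ennreal (ell s) * (\<integral>\<^sup>+m. ennreal (\<bar>1 + s * m\<bar> powr (- \<alpha>)) * g m \<partial>lborel)"
      by (rule nn_integral_cmult) measurable
    finally show ?thesis .
  qed
  \<comment> \<open>Invariance of \<open>f = p - q\<close>, integrated against the test power and
    rearranged so that all terms are nonnegative. \<open>Ktrans\<close> lowers the exponent from
    \<open>\<alpha> + 1\<close> to \<alpha>, and \<open>vartheta_transform_Suc\<close> links the
    two.\<close>
  have key: "(\<integral>\<^sup>+z. ennreal ((1 + s * z) powr (- (\<alpha> + 1))) * (p z + K q z) \<partial>lborel) =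
       (\<integral>\<^sup>+z. ennreal ((1 + s * z) powr (- (\<alpha> + 1))) * (q z + K p z) \<partial>lborel)"
    and keyfin: "(\<integral>\<^sup>+z. ennreal ((1 + s * z) powr (- (\<alpha> + 1))) * (p z + K q z) \<partial>lborel) < \<infinity>"
    if s: "s \<ge> 0" for s
  proof -
    let ?\<phi> = "\<lambda>z. (1 + s * z) powr (- (\<alpha> + 1))" and ?\<psi> = "\<lambda>z. \<bar>1 + s * z\<bar> powr (- \<alpha>)"
    have le1: "\<bar>(1 + s * z) powr (- r)\<bar> \<le> 1" if "0 < z" "r > 0" for z r
      using that s by (auto simp: powr_minus inverse_le_1_iff intro!: ge_one_powr_ge_zero)
    have psi: "indicator {0<..<1} z * (?\<psi> z * vartheta \<alpha> z) = indicator {0<..<1} z * ((1 + s * z) powr (- \<alpha>) * vartheta \<alpha> z)" for z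
      using s by (auto simp: indicator_def)
    have r: "?\<phi> z * f z = indicator {0<..<1} z * (?\<phi> z * vartheta \<alpha> z)" "?\<psi> z * f z = indicator {0<..<1} z * ((1 + s * z) powr (- \<alpha>) * vartheta \<alpha> z)" for z
      unfolding psi[symmetric] by (simp_all add: f_def)
    have i1: "integrable lborel (\<lambda>z. ?\<phi> z * f z)" unfolding r
      by (rule integrable_vartheta_mult[OF a, where B=1]) (use le1[of _ "\<alpha> + 1"] a in auto)
    have i2: "integrable lborel (\<lambda>z. ?\<psi> z * f z)" unfolding r
      by (rule integrable_vartheta_mult[OF a, where B=1]) (use le1[of _ \<alpha>] a in auto)
    obtain P1 Q1 where 1: "P1 \<ge> 0" "Q1 \<ge> 0" "(\<integral>\<^sup>+z. ennreal (?\<phi> z) * p z \<partial>lborel) = ennreal P1"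
       "(\<integral>\<^sup>+z. ennreal (?\<phi> z) * q z \<partial>lborel) = ennreal Q1" "(\<integral>z. ?\<phi> z * f z \<partial>lborel) = P1 - Q1"
      unfolding p_def q_def by (rule integral_eq_diff_nn_integral[OF i1]) auto
    obtain P2 Q2 where 2: "P2 \<ge> 0" "Q2 \<ge> 0" "(\<integral>\<^sup>+z. ennreal (?\<psi> z) * p z \<partial>lborel) = ennreal P2"
       "(\<integral>\<^sup>+z. ennreal (?\<psi> z) * q z \<partial>lborel) = ennreal Q2" "(\<integral>z. ?\<psi> z * f z \<partial>lborel) = P2 - Q2"
      unfolding p_def q_def by (rule integral_eq_diff_nn_integral[OF i2]) auto
    have el: "ell s \<ge> 0" using s by (auto simp: ell_def)
    have "(\<integral>z. ?\<phi> z * f z \<partial>lborel) = ell s * (\<integral>z. ?\<psi> z * f z \<partial>lborel)"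
    proof (cases "s = 0")
      case True
      then show ?thesis by (simp add: ell_def)
    next
      case False
      then show ?thesis unfolding r using vartheta_transform_Suc[OF a, of s] s by (simp add: ell_def)
    qed
    then have id: "P1 + ell s * Q2 = Q1 + ell s * P2" unfolding 1(5) 2(5) by (simp add: algebra_simps)
    have L: "(\<integral>\<^sup>+z. ennreal (?\<phi> z) * (p z + K q z) \<partial>lborel) = ennreal (P1 + ell s * Q2)"
    proof -
      have "(\<integral>\<^sup>+z. ennreal (?\<phi> z) * (p z + K q z) \<partial>lborel) = (\<integral>\<^sup>+z. ennreal (?\<phi> z) * p z + ennreal (?\<phi> z) * K q z \<partial>lborel)"
        by (simp only: distrib_left)
      also have "\<dots> = (\<integral>\<^sup>+z. ennreal (?\<phi> z) * p z \<partial>lborel) + (\<integral>\<^sup>+z. ennreal (?\<phi> z) * K q z \<partial>lborel)"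
        by (rule nn_integral_add) measurable
      also have "(\<integral>\<^sup>+z. ennreal (?\<phi> z) * K q z \<partial>lborel) = ennreal (ell s) * ennreal Q2"
        using Ktrans[OF s, of q] p0 2(4) by simp
      finally show ?thesis using 1 2 el by (simp add: ennreal_mult ennreal_plus)
    qed
    have R: "(\<integral>\<^sup>+z. ennreal (?\<phi> z) * (q z + K p z) \<partial>lborel) = ennreal (Q1 + ell s * P2)"
    proof -
      have "(\<integral>\<^sup>+z. ennreal (?\<phi> z) * (q z + K p z) \<partial>lborel) = (\<integral>\<^sup>+z. ennreal (?\<phi> z) * q z + ennreal (?\<phi> z) * K p z \<partial>lborel)"
        by (simp only: distrib_left)
      also have "\<dots> = (\<integral>\<^sup>+z. ennreal (?\<phi> z) * q z \<partial>lborel) + (\<integral>\<^sup>+z. ennreal (?\<phi> z) * K p z \<partial>lborel)"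
        by (rule nn_integral_add) measurable
      also have "(\<integral>\<^sup>+z. ennreal (?\<phi> z) * K p z \<partial>lborel) = ennreal (ell s) * ennreal P2"
        using Ktrans[OF s, of p] p0 2(3) by simp
      finally show ?thesis using 1 2 el by (simp add: ennreal_mult ennreal_plus)
    qed
    show "(\<integral>\<^sup>+z. ennreal (?\<phi> z) * (p z + K q z) \<partial>lborel) = (\<integral>\<^sup>+z. ennreal (?\<phi> z) * (q z + K p z) \<partial>lborel)"
      unfolding L R id ..
    show "(\<integral>\<^sup>+z. ennreal (?\<phi> z) * (p z + K q z) \<partial>lborel) < \<infinity>" unfolding L by simp
  qed
  have K0: "K g z = 0" if "z \<notin> {0<..<1}" and g0: "\<And>m. m \<notin> {0<..<1} \<Longrightarrow> g m = 0" for g z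
  proof -
    have "stick \<alpha> z m * g m = 0" for m using stick_eq_0[of m z \<alpha>] g0[of m] that by (cases "m \<in> {0<..<1}") auto
    then show ?thesis unfolding K_def by (simp only:) simp
  qed
  let ?M = "density lborel (\<lambda>z. p z + K q z)" and ?N = "density lborel (\<lambda>z. q z + K p z)"
  have tot: "(\<integral>\<^sup>+z. p z + K q z \<partial>lborel) < \<infinity>" "(\<integral>\<^sup>+z. q z + K p z \<partial>lborel) < \<infinity>"
    using keyfin[of 0] key[of 0] by simp_all
  have fM: "finite_measure ?M" "finite_measure ?N"
    using tot by (auto intro!: finite_measureI simp: emeasure_density)
  have "?M = ?N"
  proof (rule measure_eqI_markov_krein_real[where b="\<alpha> + 1"])
    have out: "p x + K q x = 0" "q x + K p x = 0" if "x \<notin> {0..1}" for x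
    proof -
      have x: "x \<notin> {0<..<1}" using that by auto
      show "p x + K q x = 0" "q x + K p x = 0"
        using p0[OF x] K0[OF x, of q] K0[OF x, of p] p0 by auto
    qed
    show "AE x in ?M. x \<in> {0..1}"
      by (subst AE_density, measurable, intro AE_I2 impI) (use out(1) in force)
    show "AE x in ?N. x \<in> {0..1}"
      by (subst AE_density, measurable, intro AE_I2 impI) (use out(2) in force)
    fix s :: real assume s: "s \<ge> 0"
    have "(\<integral>x. (1 + s * x) powr (- (\<alpha> + 1)) \<partial>?M) = enn2real (\<integral>\<^sup>+x. ennreal ((1 + s * x) powr (- (\<alpha> + 1))) \<partial>?M)"
      by (rule integral_eq_nn_integral) auto
    also have "(\<integral>\<^sup>+x. ennreal ((1 + s * x) powr (- (\<alpha> + 1))) \<partial>?M) = (\<integral>\<^sup>+x. ennreal ((1 + s * x) powr (- (\<alpha> + 1))) \<partial>?N)"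
      using key[OF s] by (simp add: nn_integral_density mult.commute)
    also have "enn2real \<dots> = (\<integral>x. (1 + s * x) powr (- (\<alpha> + 1)) \<partial>?N)"
      by (rule integral_eq_nn_integral[symmetric]) auto
    finally show "(\<integral>x. (1 + s * x) powr (- (\<alpha> + 1)) \<partial>?M) = (\<integral>x. (1 + s * x) powr (- (\<alpha> + 1)) \<partial>?N)" .
  qed (use fM a in auto)
  then have eq: "AE z in lborel. p z + K q z = q z + K p z"
    by (intro sigma_finite_measure.density_unique[OF lborel.sigma_finite_measure_axioms]) auto
  have finite_p: "(\<integral>\<^sup>+z. p z \<partial>lborel) < \<infinity>" "(\<integral>\<^sup>+z. q z \<partial>lborel) < \<infinity>"
    using tot by (auto simp: nn_integral_add)
  \<comment> \<open>At \<open>s = 0\<close> both test powers and the factor \<open>ell s\<close> are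
    1, so \<open>K\<close> preserves mass.\<close>
  have Kq: "(\<integral>\<^sup>+z. K q z \<partial>lborel) = (\<integral>\<^sup>+z. q z \<partial>lborel)"
    using Ktrans[of 0 q] p0 by (simp add: ell_def)
  \<comment> \<open>\<open>p\<close> and \<open>q\<close> are never both nonzero: where
    \<open>q\<close> is positive, \<open>p = 0\<close>, and the balance equation gives
    \<open>q = K q + p - K p\<close> with \<open>p = 0\<close>.\<close>
  have q_le: "AE z in lborel. q z \<le> K q z" using eq
  proof eventually_elim
    case (elim z)
    show ?case
    proof (cases "f z \<ge> 0")
      case True
      then have "q z = 0" by (simp add: q_def ennreal_neg)
      then show ?thesis by simp
    next
      case False
      then have "p z = 0" by (simp add: p_def ennreal_neg)
      then show ?thesis using elim by (metis add.left_neutral le_iff_add)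
    qed
  qed
  have q_eq: "AE z in lborel. K q z = q z"
  proof -
    have "(\<integral>\<^sup>+z. K q z - q z \<partial>lborel) = (\<integral>\<^sup>+z. K q z \<partial>lborel) - (\<integral>\<^sup>+z. q z \<partial>lborel)"
      by (rule nn_integral_diff) (use finite_p q_le in auto)
    also have "\<dots> = 0" unfolding Kq using finite_p(2) by (intro ennreal_diff_self) (simp add: less_top)
    finally have "AE z in lborel. K q z - q z = 0" by (subst (asm) nn_integral_0_iff_AE) auto
    with q_le show ?thesis
    proof eventually_elim
      case (elim z)
      have "q z \<noteq> \<infinity>" by (simp add: q_def)
      then show ?case using elim by (metis antisym diff_eq_0_iff_ennreal le_less not_less)
    qed
  qed
  have Kge: "K g z \<ge> ennreal (\<epsilon> powr \<alpha>) * (\<integral>\<^sup>+m. g m \<partial>lborel)"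
    if [measurable]: "g \<in> borel_measurable borel" and g0: "\<And>m. m \<notin> {0<..<1} \<Longrightarrow> g m = 0" and e: "0 < \<epsilon>" "\<epsilon> < z" "z < 1 - \<epsilon>" for g z \<epsilon>
  proof -
    have "ennreal (\<epsilon> powr \<alpha>) * (\<integral>\<^sup>+m. g m \<partial>lborel) = (\<integral>\<^sup>+m. ennreal (\<epsilon> powr \<alpha>) * g m \<partial>lborel)"
      by (rule nn_integral_cmult[symmetric]) measurable
    also have "\<dots> \<le> K g z" unfolding K_def
    proof (rule nn_integral_mono)
      fix m :: real
      show "ennreal (\<epsilon> powr \<alpha>) * g m \<le> stick \<alpha> z m * g m"
        using stick_ge[OF a(1) e, of m] g0[of m] by (cases "m \<in> {0<..<1}") (auto intro: mult_right_mono)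
    qed
    finally show ?thesis .
  qed
  have int1: "(\<integral>z. f z \<partial>lborel) = 1" unfolding f_def by (rule vartheta_total_mass[OF a])
  have intf: "integrable lborel f" using int1 not_integrable_integral_eq by fastforce
  obtain P Q where PQ: "P \<ge> 0" "Q \<ge> 0" "(\<integral>\<^sup>+z. p z \<partial>lborel) = ennreal P" "(\<integral>\<^sup>+z. q z \<partial>lborel) = ennreal Q" "1 = P - Q"
    using integral_eq_diff_nn_integral[of "\<lambda>_. 1" f] intf int1 unfolding p_def q_def by auto
  have Q0: "(\<integral>\<^sup>+z. q z \<partial>lborel) = 0"
  proof (rule ccontr)
    assume nz: "(\<integral>\<^sup>+z. q z \<partial>lborel) \<noteq> 0"
    have Kpos: "K q z > 0" if "z \<in> {0<..<1}" for z
    proof -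
      define \<epsilon> where "\<epsilon> = min z (1 - z) / 2"
      have e: "0 < \<epsilon>" "\<epsilon> < z" "z < 1 - \<epsilon>" using that by (auto simp: \<epsilon>_def min_def field_simps)
      have "0 < ennreal (\<epsilon> powr \<alpha>) * (\<integral>\<^sup>+m. q m \<partial>lborel)" using e nz by (auto simp: ennreal_zero_less_mult_iff zero_less_iff_neq_zero)
      also have "\<dots> \<le> K q z" by (rule Kge[OF _ _ e]) (use p0 in auto)
      finally show ?thesis .
    qed
    have "AE z in lborel. p z = 0" using q_eq
    proof (eventually_elim)
      case (elim z)
      show ?case
      proof (cases "z \<in> {0<..<1}")
        case True
        then have "q z > 0" using elim Kpos by metis
        then have "f z < 0" by (simp add: q_def)
        then show ?thesis by (simp add: p_def ennreal_neg)
      qed (simp add: p0)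
    qed
    then have "(\<integral>\<^sup>+z. p z \<partial>lborel) = 0" by (subst nn_integral_0_iff_AE) auto
    then show False using PQ by simp
  qed
  then have q0: "AE z in lborel. q z = 0" by (subst (asm) nn_integral_0_iff_AE) auto
  have Pge: "(\<integral>\<^sup>+z. p z \<partial>lborel) = 1" using PQ Q0 by simp
  define \<epsilon> where "\<epsilon> = min z (1 - z) / 2"
  have e: "0 < \<epsilon>" "\<epsilon> < z" "z < 1 - \<epsilon>" using z by (auto simp: \<epsilon>_def min_def field_simps)
  \<comment> \<open>As \<open>q = 0\<close> almost everywhere, \<open>p = K p\<close> with mass 1,
    and the uniform lower bound on the kernel gives the explicit floor
    \<open>\<epsilon> powr \<alpha>\<close>. Continuity then carries it to the point
    \<open>z\<close> itself.\<close>
  have ae: "AE x in lborel. x \<in> {\<epsilon><..<1 - \<epsilon>} \<longrightarrow> \<epsilon> powr \<alpha> \<le> vartheta \<alpha> x"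
    using q0 q_eq eq
  proof eventually_elim
    case (elim x)
    show ?case
    proof
      assume x: "x \<in> {\<epsilon><..<1 - \<epsilon>}"
      have "ennreal (\<epsilon> powr \<alpha>) * (\<integral>\<^sup>+m. p m \<partial>lborel) \<le> K p x"
        by (rule Kge) (use p0 x e in auto)
      also have "K p x = p x" using elim by simp
      finally have "ennreal (\<epsilon> powr \<alpha>) \<le> ennreal (f x)" unfolding Pge by (simp add: p_def)
      moreover have "\<epsilon> powr \<alpha> > 0" using e by simp
      ultimately have "\<epsilon> powr \<alpha> \<le> f x"
        by (metis ennreal_le_iff2 leD)
      moreover have "x \<in> {0<..<1}" using x e by auto
      ultimately show "\<epsilon> powr \<alpha> \<le> vartheta \<alpha> x" by (simp add: f_def)
    qed
  qed
  have "\<epsilon> powr \<alpha> \<le> vartheta \<alpha> z"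
    by (rule AE_ge_imp_ge[OF _ _ ae])
      (use e in \<open>auto intro!: continuous_on_subset[OF vartheta_continuous[OF a]]\<close>)
  moreover have "\<epsilon> powr \<alpha> > 0" using e by simp
  ultimately show ?thesis by linarith
qed

section \<open>The transform of the projected Dirichlet-Ferguson measure\<close>

text \<open>For a monotone function the right-endpoint sum overshoots, and the errors telescope to
  at most \<open>h\<close> times the total increase. Paths of the process may jump, so monotonicity
  has to replace continuity.\<close>

lemma riemann_sum_mono_bound:
  fixes f :: "real \<Rightarrow> real"
  assumes f: "mono f" and h: "h > 0"
  shows "(LBINT t=a..a + real n * h. f t) \<le> (\<Sum>j=1..n. h * f (a + real j * h)) \<and>
     (\<Sum>j=1..n. h * f (a + real j * h)) - h * (f (a + real n * h) - f a) \<le> (LBINT t=a..a + real n * h. f t)"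
proof (induction n)
  case 0
  then show ?case by simp
next
  case (Suc n)
  have fm: "f \<in> borel_measurable borel" using f by (rule borel_measurable_mono)
  have int: "interval_lebesgue_integrable lborel (ereal u) (ereal v) f" if "u \<le> v" for u v
  proof -
    have "set_integrable lborel {u<..<v} f"
      unfolding set_integrable_def
    proof (rule integrableI_bounded_set[where A="{u<..<v}" and B="\<bar>f u\<bar> + \<bar>f v\<bar>"])
      show "AE x in lborel. x \<in> {u<..<v} \<longrightarrow> norm (indicator {u<..<v} x *\<^sub>R f x) \<le> \<bar>f u\<bar> + \<bar>f v\<bar>"
      proof (intro AE_I2 impI)
        fix x assume "x \<in> {u<..<v}"
        then have "f u \<le> f x" "f x \<le> f v" using monoD[OF f] by auto
        then show "norm (indicator {u<..<v} x *\<^sub>R f x) \<le> \<bar>f u\<bar> + \<bar>f v\<bar>" by (auto simp: indicator_def)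
      qed
    qed (use fm that in auto)
    then show ?thesis using that by (simp add: interval_lebesgue_integrable_def einterval_eq)
  qed
  let ?x = "a + real n * h" and ?y = "a + real (Suc n) * h"
  have xy: "a \<le> ?x" "?x \<le> ?y" "?y - ?x = h" using h by (auto simp: algebra_simps)
  have split: "(LBINT t=a..?y. f t) = (LBINT t=a..?x. f t) + (LBINT t=?x..?y. f t)"
    using interval_integral_sum[of a ?x ?y f] int[of a ?y] xy by (simp add: min_def max_def)
  have c: "(LBINT t=?x..?y. r) = h * r" for r :: real
    using xy by simp
  have up: "(LBINT t=?x..?y. f t) \<le> h * f ?y"
  proof -
    have "(LBINT t=?x..?y. f t) \<le> (LBINT t=?x..?y. f ?y)"
      using int[of ?x ?y] xy monoD[OF f] unfolding interval_lebesgue_integral_def interval_lebesgue_integrable_def einterval_eq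
      by (auto intro!: set_integral_mono simp: set_integrable_def)
    then show ?thesis unfolding c .
  qed
  have lo: "h * f ?x \<le> (LBINT t=?x..?y. f t)"
  proof -
    have "(LBINT t=?x..?y. f ?x) \<le> (LBINT t=?x..?y. f t)"
      using int[of ?x ?y] xy monoD[OF f] unfolding interval_lebesgue_integral_def interval_lebesgue_integrable_def einterval_eq
      by (auto intro!: set_integral_mono simp: set_integrable_def)
    then show ?thesis unfolding c .
  qed
  show ?case using Suc split up lo by (simp add: algebra_simps)
qed

lemma riemann_sum_mono:
  fixes f :: "real \<Rightarrow> real"
  assumes f: "mono f" and ab: "a < b"
  shows "(\<lambda>N. (1 / real N) * (\<Sum>j=1..N. f (a + real j * ((b - a) / real N)))) \<longlonglongrightarrow> (1 / (b - a)) * (LBINT t=a..b. f t)"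
proof -
  let ?S = "\<lambda>N. (1 / real N) * (\<Sum>j=1..N. f (a + real j * ((b - a) / real N)))"
  let ?L = "(1 / (b - a)) * (LBINT t=a..b. f t)"
  have bd: "\<bar>?S N - ?L\<bar> \<le> (f b - f a) / real N" if N: "N \<ge> 1" for N
  proof -
    define h where "h = (b - a) / real N"
    have h: "h > 0" using ab N by (simp add: h_def)
    have nh: "real N * h = b - a" using N by (simp add: h_def)
    have S: "(\<Sum>j=1..N. h * f (a + real j * h)) = (b - a) * ?S N"
      unfolding sum_distrib_left[symmetric] h_def by simp
    have hd: "h * (f b - f a) = (b - a) * ((f b - f a) / real N)" by (simp add: h_def)
    have "(LBINT t=a..b. f t) \<le> (b - a) * ?S N \<and> (b - a) * ?S N - (b - a) * ((f b - f a) / real N) \<le> (LBINT t=a..b. f t)"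
      using riemann_sum_mono_bound[OF f h, of a N] unfolding nh S hd[symmetric] by (simp add: algebra_simps)
    then have "?L \<le> ?S N \<and> ?S N - (f b - f a) / real N \<le> ?L"
      using ab by (simp add: field_simps)
    then show ?thesis by (simp only: abs_le_iff) linarith
  qed
  have "(\<lambda>N. (f b - f a) / real N) \<longlonglongrightarrow> 0" by (rule lim_const_over_n)
  then have "(\<lambda>N. ?S N - ?L) \<longlonglongrightarrow> 0"
    by (rule Lim_null_comparison[rotated]) (use bd in \<open>auto simp: eventually_sequentially intro!: exI[of _ 1]\<close>)
  then show ?thesis by (simp add: LIM_zero_iff)
qed

lemma riemann_sum_ln:
  fixes A s :: real
  assumes A: "A > 0" and s: "s \<ge> 0"
  shows "(\<lambda>N. (1 / real N) * (\<Sum>j=1..N. ln (A + s * (real j / real N)))) \<longlonglongrightarrow> integral {0..1} (\<lambda>t. ln (A + s * t))"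
proof -
  \<comment> \<open>The truncation makes the function monotone on the whole line, as
    \<open>riemann_sum_mono\<close> requires, without changing it on [0, 1].\<close>
  let ?f = "\<lambda>t. ln (A + s * max 0 t)"
  have p: "A + s * max 0 t > 0" for t using A s by (intro add_pos_nonneg) auto
  have "mono ?f" using p s by (intro monoI) (simp add: mult_left_mono)
  from riemann_sum_mono[OF this zero_less_one]
  have "(\<lambda>N. (1 / real N) * (\<Sum>j=1..N. ln (A + s * (real j / real N)))) \<longlonglongrightarrow> (LBINT t=ereal 0..ereal 1. ?f t)"
    by simp
  also have "(LBINT t=ereal 0..ereal 1. ?f t) = integral {0..1} ?f"
  proof (rule interval_integral_eq_integral)
    show "set_integrable lborel {0..1} ?f"
      by (intro borel_integrable_atLeastAtMost' continuous_on_ln continuous_intros ballI less_imp_neq[OF p, symmetric])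
  qed simp
  also have "integral {0..1} ?f = integral {0..1} (\<lambda>t. ln (A + s * t))"
    by (rule Henstock_Kurzweil_Integration.integral_cong) auto
  finally show ?thesis by (simp add: zero_ereal_def one_ereal_def)
qed

lemma prod_blocks:
  fixes f :: "nat \<Rightarrow> 'a :: comm_monoid_mult"
  shows "(\<Prod>l=1..k * N. f l) = (\<Prod>i=1..k. \<Prod>m=1..N. f ((i - 1) * N + m))"
proof (induction k)
  case (Suc k)
  have "(\<Prod>l=1..Suc k * N. f l) = (\<Prod>l=1..k * N. f l) * (\<Prod>l=k * N + 1..k * N + N. f l)"
    using prod.ub_add_nat[of 1 "k * N" f N] by (simp add: add.commute)
  also have "(\<Prod>l=k * N + 1..k * N + N. f l) = (\<Prod>m=1..N. f (k * N + m))"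
    using prod.shift_bounds_cl_nat_ivl[of f 1 "k * N" N] by (simp add: add.commute)
  finally show ?case using Suc.IH by simp
qed simp

lemma node_eq_sum_incr:
  assumes "p \<le> n" "n \<ge> 1"
  shows "node n y p = (\<Sum>l=1..n. of_bool (l \<le> p) * incr n y l)"
proof -
  have "(\<Sum>l=1..n. of_bool (l \<le> p) * incr n y l) = (\<Sum>l=1..p. incr n y l)"
    using assms by (intro sum.mono_neutral_cong_right) auto
  also have "\<dots> = node n y p - node n y 0" unfolding incr_def using sum_telescope''[of 0 p "node n y"] by simp
  finally show ?thesis by (simp add: node_def)
qed

text \<open>Divided by \<open>N\<close>, this is the weight of the \<open>m\<close>-th increment of
  block \<open>i0\<close> in the Riemann sum of block \<open>i\<close>, a discrete version of
  \<Phi>. The summand 1 in \<open>N - m + 1\<close> is there because the grid point at the right end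
  of an increment already sees it.\<close>

lemma count_block:
  fixes N i i0 m :: nat
  assumes "1 \<le> m" "m \<le> N" "1 \<le> i" "1 \<le> i0"
  shows "(\<Sum>j=1..N. of_bool ((i0 - 1) * N + m \<le> (i - 1) * N + j) :: real) =
    (if i < i0 then 0 else if i = i0 then real (N - m + 1) else real N)"
proof -
  consider "i < i0" | "i = i0" | "i > i0" by linarith
  then show ?thesis
  proof cases
    case 1
    have "\<not> (i0 - 1) * N + m \<le> (i - 1) * N + j" if "j \<in> {1..N}" for j
    proof -
      have "i * N \<le> (i0 - 1) * N" using 1 by (intro mult_right_mono) auto
      moreover have "(i - 1) * N + N = i * N" using assms by (cases i) auto
      moreover have "(i - 1) * N + j \<le> (i - 1) * N + N" using that by simp
      ultimately show ?thesis using assms(1) by linarith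
    qed
    then show ?thesis using 1 by simp
  next
    case 2
    have "(\<Sum>j=1..N. of_bool (m \<le> j) :: real) = (\<Sum>j\<in>{m..N}. 1)"
      using assms by (intro sum.mono_neutral_cong_right) auto
    then show ?thesis using 2 assms by (simp add: Suc_diff_le)
  next
    case 3
    have "(i0 - 1) * N + m \<le> (i - 1) * N + j" if "j \<in> {1..N}" for j
    proof -
      have "i0 * N \<le> (i - 1) * N" using 3 by (intro mult_right_mono) auto
      moreover have "(i0 - 1) * N + N = i0 * N" using assms by (cases i0) auto
      moreover have "(i0 - 1) * N + m \<le> (i0 - 1) * N + N" using assms by simp
      ultimately show ?thesis by linarith
    qed
    then show ?thesis using 3 by simp
  qed
qed

definition tail_sum :: "nat \<Rightarrow> (nat \<Rightarrow> real) \<Rightarrow> nat \<Rightarrow> real" where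
  "tail_sum k l i = (\<Sum>j=i+1..k. l j)"

lemma tail_sum_nonneg: "(\<And>i. i \<in> {1..k} \<Longrightarrow> l i \<ge> 0) \<Longrightarrow> tail_sum k l i \<ge> 0"
  unfolding tail_sum_def by (intro sum_nonneg) auto

text \<open>On the \<open>i\<close>-th block \<open>[(i - 1) / k, i / k]\<close>, reflected and rescaled to \<open>[0, 1]\<close>, the function
  \<open>\<Sum>j. l j * \<Phi>\<^sub>k\<^sup>j\<close> is \<open>\<lambda>t. tail_sum k l i + l i * t\<close>; hence with \<open>\<beta> = k \<alpha>\<close> the following is
  \<open>exp (- \<beta> * \<integral> ln (1 + \<Sum>j. l j * \<Phi>\<^sub>k\<^sup>j))\<close>.\<close>

definition transform_value :: "nat \<Rightarrow> real \<Rightarrow> (nat \<Rightarrow> real) \<Rightarrow> real" where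
  "transform_value k \<alpha> l = (\<Prod>i=1..k. exp (- \<alpha> * integral {0..1} (\<lambda>t. ln (1 + tail_sum k l i + l i * t))))"

lemma G_space_le:
  assumes "g \<in> G_space"
  shows "0 \<le> g t" "g t \<le> 1" "mono g" "t \<ge> 1 \<Longrightarrow> g t = 1"
proof -
  have m: "mono g" and g0: "\<forall>t<0. g t = 0" and g1: "\<forall>t\<ge>1. g t = 1" using assms by (auto simp: G_space_def)
  show "mono g" "t \<ge> 1 \<Longrightarrow> g t = 1" using m g1 by auto
  have "g (min t (-1)) \<le> g t" by (rule monoD[OF m]) simp
  then show "0 \<le> g t" using g0 by (simp add: min_def split: if_splits)
  have "g t \<le> g (max t 1)" by (rule monoD[OF m]) simp
  then show "g t \<le> 1" using g1 by simp
qed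

section \<open>The transform under the Dirichlet-Ferguson law\<close>

locale dirichlet_ferguson =
  fixes \<beta> :: real and Q :: "(real \<Rightarrow> real) measure" and k :: nat
  assumes b: "\<beta> > 0" and k: "k \<ge> 1" and df: "is_dirichlet_ferguson \<beta> Q"
begin

sublocale prob_space Q using df by (simp add: is_dirichlet_ferguson_def)

lemma sets_Q: "sets Q = sets G_measurable"
  using df by (simp add: is_dirichlet_ferguson_def)

lemma space_Q: "space Q = G_space"
  using sets_eq_imp_space_eq[OF sets_Q] by (simp add: G_measurable_def space_restrict_space space_PiM)

lemma eval_measurable [measurable]: "(\<lambda>g. g t) \<in> borel_measurable Q"
proof -
  have "(\<lambda>g. g t) \<in> borel_measurable G_measurable"
    unfolding G_measurable_def by (intro measurable_restrict_space1 measurable_component_singleton) simp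
  then show ?thesis by (simp cong: measurable_cong_sets add: measurable_cong_sets[OF sets_Q refl])
qed

definition J :: "nat \<Rightarrow> (real \<Rightarrow> real) \<Rightarrow> real" where
  "J i g = real k * (LBINT t=(real i - 1) / real k..real i / real k. g t)"

text \<open>Right-endpoint Riemann sums with \<open>N\<close> points per block. All blocks share the
  grid of mesh \<open>1 / (k * N)\<close>, so one finite-dimensional marginal serves them
  together.\<close>

definition S :: "nat \<Rightarrow> nat \<Rightarrow> (real \<Rightarrow> real) \<Rightarrow> real" where
  "S N i g = (1 / real N) * (\<Sum>j=1..N. g (real ((i - 1) * N + j) / real (k * N)))"

lemma S_tendsto_J:
  assumes g: "g \<in> G_space" and i: "i \<ge> 1"
  shows "(\<lambda>N. S N i g) \<longlonglongrightarrow> J i g"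
proof -
  let ?a = "(real i - 1) / real k" and ?b = "real i / real k"
  have ab: "?a < ?b" using k by (simp add: divide_strict_right_mono)
  have d: "?b - ?a = 1 / real k" using k by (simp add: field_simps)
  have "(\<lambda>N. (1 / real N) * (\<Sum>j=1..N. g (?a + real j * ((?b - ?a) / real N)))) \<longlonglongrightarrow> (1 / (?b - ?a)) * (LBINT t=?a..?b. g t)"
    by (rule riemann_sum_mono[OF G_space_le(3)[OF g] ab])
  moreover have "(1 / (?b - ?a)) * (LBINT t=?a..?b. g t) = J i g" unfolding d J_def by simp
  moreover have "\<forall>\<^sub>F N in sequentially. (1 / real N) * (\<Sum>j=1..N. g (?a + real j * ((?b - ?a) / real N))) = S N i g"
  proof (rule eventually_sequentiallyI[of 1])
    fix N :: nat assume N: "1 \<le> N"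
    have "?a + real j * ((?b - ?a) / real N) = real ((i - 1) * N + j) / real (k * N)" for j
      unfolding d using N k i by (simp add: of_nat_diff field_simps)
    then show "(1 / real N) * (\<Sum>j=1..N. g (?a + real j * ((?b - ?a) / real N))) = S N i g"
      unfolding S_def by simp
  qed
  ultimately show ?thesis using tendsto_cong by fastforce
qed

lemma S_measurable [measurable]: "S N i \<in> borel_measurable Q"
  unfolding S_def by measurable

text \<open>The sigma-algebra comes from evaluations at single times, so an integral over time
  inherits measurability from Riemann sums, each using finitely many evaluations.\<close>

lemma J_measurable:
  assumes "i \<ge> 1" shows "J i \<in> borel_measurable Q"
  by (rule borel_measurable_LIMSEQ_real[where u="\<lambda>N. S N i"]) (use S_tendsto_J assms in \<open>auto simp: space_Q\<close>)

lemma S_bounds: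
  assumes g: "g \<in> G_space" shows "0 \<le> S N i g" "S N i g \<le> 1"
proof -
  show "0 \<le> S N i g" unfolding S_def using G_space_le[OF g] by (intro mult_nonneg_nonneg sum_nonneg) auto
  have "(\<Sum>j=1..N. g (real ((i - 1) * N + j) / real (k * N))) \<le> real N * 1"
    using sum_bounded_above[of "{1..N}" "\<lambda>j. g (real ((i - 1) * N + j) / real (k * N))" 1] G_space_le[OF g] by simp
  then show "S N i g \<le> 1" unfolding S_def by (cases "N = 0") (auto simp: field_simps)
qed

lemma J_bounds:
  assumes g: "g \<in> G_space" and i: "i \<ge> 1" shows "0 \<le> J i g" "J i g \<le> 1"
proof -
  show "0 \<le> J i g" by (rule LIMSEQ_le_const[OF S_tendsto_J[OF g i]]) (use S_bounds[OF g] in auto)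
  show "J i g \<le> 1" by (rule LIMSEQ_le_const2[OF S_tendsto_J[OF g i]]) (use S_bounds[OF g] in auto)
qed

lemma hatJ_eq: "hatJ k = (\<lambda>g. \<lambda>i\<in>{1..k}. J i g)"
  unfolding hatJ_def J_def by simp

lemma hatJ_measurable: "hatJ k \<in> measurable Q (leb k)"
proof -
  have "(\<lambda>g. \<lambda>i\<in>{1..k}. J i g) \<in> measurable Q (PiM {1..k} (\<lambda>_. lborel))"
    by (rule measurable_restrict) (use J_measurable in auto)
  then show ?thesis unfolding hatJ_eq leb_def .
qed

text \<open>On the uniform grid the increments are Dirichlet with equal parameters
  \<open>\<beta> / (k * N)\<close>, and the linear form has positive coefficients \<open>c p\<close>
  in them, so Markov-Krein evaluates the expectation.\<close>

lemma S_transform: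
  assumes N: "N \<ge> 1" and l: "\<And>i. i \<in> {1..k} \<Longrightarrow> l i \<ge> 0"
  shows "(\<integral>\<^sup>+g. ennreal ((1 + (\<Sum>i=1..k. l i * S N i g)) powr (- \<beta>)) \<partial>Q) =
    ennreal (\<Prod>i=1..k. \<Prod>m=1..N. (1 + tail_sum k l i + l i * (real (N - m + 1) / real N)) powr (- (\<beta> / real (k * N))))"
proof -
  define n where "n = k * N"
  have n: "n \<ge> 1" using k N by (simp add: n_def)
  define t where "t = (\<lambda>l::nat. real l / real n)"
  have t: "t 0 = 0" "t n = 1" "\<And>i. i < n \<Longrightarrow> t i < t (Suc i)" using n by (auto simp: t_def divide_strict_right_mono)
  define a where "a = (\<lambda>i::nat. \<beta> * (t i - t (i - 1)))"
  have a_eq: "a i = \<beta> / real n" if "i \<ge> 1" for i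
  proof -
    have "t i - t (i - 1) = 1 / real n" using that by (simp add: t_def diff_divide_distrib[symmetric] of_nat_diff)
    then show ?thesis unfolding a_def by simp
  qed
  have sum_a: "(\<Sum>i=1..n. a i) = \<beta>"
    unfolding a_def sum_distrib_left[symmetric] using sum_telescope''[of 0 n t] t by simp
  define w where "w = (\<lambda>p i. (1 / real N) * (\<Sum>j=1..N. of_bool (p \<le> (i - 1) * N + j)))"
  have w0: "w p i \<ge> 0" for p i unfolding w_def by (intro mult_nonneg_nonneg sum_nonneg) auto
  define c where "c = (\<lambda>p. 1 + (\<Sum>i=1..k. l i * w p i))"
  have c_pos: "c p > 0" for p
    unfolding c_def using l w0 by (intro add_pos_nonneg sum_nonneg mult_nonneg_nonneg) auto
  let ?\<pi> = "\<lambda>g. \<lambda>i\<in>{1..n-1}. g (t i)"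
  have pm: "?\<pi> \<in> measurable Q (leb (n - 1))"
    unfolding leb_def by (rule measurable_restrict) auto
  have dist: "distr Q (leb (n - 1)) ?\<pi> = density (leb (n - 1)) (\<lambda>x. ennreal (dirichlet_density n a x))"
    using df t n unfolding is_dirichlet_ferguson_def
    by (simp add: dir_fdd_density_eq[of \<beta> t n, folded a_def, OF sum_a])
  \<comment> \<open>Index 0 is excluded: \<open>node\<close> is 0 there, whereas a path may be
    positive at time 0. The Riemann sums avoid that point because \<open>j \<ge> 1\<close>, and the
    first increment contains its value.\<close>
  have node_eq: "g (t p) = node n (?\<pi> g) p" if g: "g \<in> G_space" and p: "1 \<le> p" "p \<le> n" for g p
    using G_space_le(4)[OF g, of 1] p t by (auto simp: node_def)
  have lin: "1 + (\<Sum>i=1..k. l i * S N i g) = (\<Sum>p=1..n. c p * incr n (?\<pi> g) p)" if g: "g \<in> G_space" for g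
  proof -
    have S: "S N i g = (\<Sum>p=1..n. w p i * incr n (?\<pi> g) p)"
      if i: "i \<in> {1..k}" for i
    proof -
      have "g (real ((i - 1) * N + j) / real (k * N)) = (\<Sum>p=1..n. of_bool (p \<le> (i - 1) * N + j) * incr n (?\<pi> g) p)"
        if j: "j \<in> {1..N}" for j
      proof -
        have "(i - 1) * N + j \<le> (i - 1) * N + N" using j by simp
        also have "\<dots> = i * N" using i by (cases i) auto
        also have "\<dots> \<le> n" using i by (simp add: n_def)
        finally have le: "(i - 1) * N + j \<le> n" .
        have "g (real ((i - 1) * N + j) / real (k * N)) = node n (?\<pi> g) ((i - 1) * N + j)"
          using node_eq[OF g _ le] j by (simp add: t_def n_def)
        also have "\<dots> = (\<Sum>p=1..n. of_bool (p \<le> (i - 1) * N + j) * incr n (?\<pi> g) p)"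
          by (rule node_eq_sum_incr[OF le n])
        finally show ?thesis .
      qed
      then have "S N i g = (1 / real N) * (\<Sum>j=1..N. \<Sum>p=1..n. of_bool (p \<le> (i - 1) * N + j) * incr n (?\<pi> g) p)"
        unfolding S_def by (intro arg_cong2[where f="(*)"] sum.cong) auto
      also have "\<dots> = (\<Sum>p=1..n. w p i * incr n (?\<pi> g) p)"
        unfolding w_def by (subst sum.swap) (simp only: sum_distrib_left sum_distrib_right mult.assoc)
      finally show ?thesis .
    qed
    have "(\<Sum>i=1..k. l i * S N i g) = (\<Sum>i=1..k. \<Sum>p=1..n. l i * w p i * incr n (?\<pi> g) p)"
      by (intro sum.cong refl) (simp only: S sum_distrib_left mult.assoc)
    also have "\<dots> = (\<Sum>p=1..n. (\<Sum>i=1..k. l i * w p i) * incr n (?\<pi> g) p)"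
      by (subst sum.swap) (simp only: sum_distrib_right)
    \<comment> \<open>The increments sum to 1, which absorbs the constant 1 of the linear form into
      the coefficients \<open>c p\<close>.\<close>
    also have "\<dots> = (\<Sum>p=1..n. c p * incr n (?\<pi> g) p) - (\<Sum>p=1..n. incr n (?\<pi> g) p)"
      by (simp only: c_def distrib_right sum.distrib mult_1 add_diff_cancel_left')
    finally show ?thesis using sum_incr[OF n, of "?\<pi> g"] by simp
  qed
  let ?F = "\<lambda>y. (\<Sum>p=1..n. c p * incr n y p) powr (- \<beta>)"
  have Fm: "?F \<in> borel_measurable (leb (n - 1))"
    unfolding measurable_leb_cong
    by (intro powr_real_measurable borel_measurable_sum borel_measurable_times incr_measurable borel_measurable_const)
  have Dm: "dirichlet_density n a \<in> borel_measurable (leb (n - 1))"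
    unfolding measurable_leb_cong dirichlet_density_def
    by (intro borel_measurable_times borel_measurable_prod powr_real_measurable incr_measurable borel_measurable_const
        measurable_compose[OF incr_measurable borel_measurable_indicator]) auto
  have D0: "dirichlet_density n a y \<ge> 0" for y
    unfolding dirichlet_density_def sum_a using b a_eq n
    by (intro mult_nonneg_nonneg divide_nonneg_nonneg prod_nonneg) (auto intro!: less_imp_le[OF Gamma_real_pos])
  have "(\<integral>\<^sup>+g. ennreal ((1 + (\<Sum>i=1..k. l i * S N i g)) powr (- \<beta>)) \<partial>Q) = (\<integral>\<^sup>+g. ennreal (?F (?\<pi> g)) \<partial>Q)"
    by (intro nn_integral_cong) (simp only: space_Q lin)
  also have "\<dots> = (\<integral>\<^sup>+y. ennreal (?F y) \<partial>distr Q (leb (n - 1)) ?\<pi>)"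
    by (rule nn_integral_distr[OF pm, symmetric]) (use measurable_compose[OF Fm measurable_ennreal] in simp)
  also have "\<dots> = (\<integral>\<^sup>+y. ennreal (dirichlet_density n a y) * ennreal (?F y) \<partial>leb (n - 1))"
    unfolding dist using Fm Dm by (intro nn_integral_density) auto
  also have "\<dots> = (\<integral>\<^sup>+y. ennreal (dirichlet_density n a y * (\<Sum>p=1..n. c p * incr n y p) powr (- (\<Sum>i=1..n. a i))) \<partial>leb (n - 1))"
    unfolding sum_a using D0 by (simp add: ennreal_mult')
  also have "\<dots> = ennreal (\<Prod>p=1..n. c p powr (- a p))"
    by (rule dirichlet_markov_krein[OF n]) (use a_eq b n c_pos in auto)
  also have "(\<Prod>p=1..n. c p powr (- a p)) = (\<Prod>p=1..k * N. c p powr (- (\<beta> / real n)))"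
    unfolding n_def[symmetric] by (intro prod.cong refl) (simp add: a_eq)
  also have "\<dots> = (\<Prod>i=1..k. \<Prod>m=1..N. c ((i - 1) * N + m) powr (- (\<beta> / real n)))"
    by (rule prod_blocks)
  also have "\<dots> = (\<Prod>i=1..k. \<Prod>m=1..N. (1 + tail_sum k l i + l i * (real (N - m + 1) / real N)) powr (- (\<beta> / real (k * N))))"
  proof (intro prod.cong refl)
    fix i m assume i: "i \<in> {1..k}" and m: "m \<in> {1..N}"
    have "(\<Sum>i'=1..k. l i' * ((1 / real N) * (\<Sum>j=1..N. of_bool ((i - 1) * N + m \<le> (i' - 1) * N + j)))) =
      (\<Sum>i'=1..k. (if i' = i then l i' * (real (N - m + 1) / real N) else 0) + (if i < i' then l i' else 0))"
      using i m N by (intro sum.cong refl) (subst count_block, auto)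
    also have "\<dots> = l i * (real (N - m + 1) / real N) + (\<Sum>i'=1..k. if i < i' then l i' else 0)"
      using i by (simp add: sum.distrib sum.delta)
    also have "(\<Sum>i'=1..k. if i < i' then l i' else 0) = tail_sum k l i"
      unfolding tail_sum_def by (rule sum.mono_neutral_cong_right) auto
    finally have "c ((i - 1) * N + m) = 1 + tail_sum k l i + l i * (real (N - m + 1) / real N)"
      unfolding c_def w_def by simp
    then show "c ((i - 1) * N + m) powr (- (\<beta> / real n)) =
       (1 + tail_sum k l i + l i * (real (N - m + 1) / real N)) powr (- (\<beta> / real (k * N)))"
      by (simp add: n_def)
  qed
  finally show ?thesis .
qed

lemma m_beta_transform:
  assumes l: "\<And>i. i \<in> {1..k} \<Longrightarrow> l i \<ge> 0"
  shows "(\<integral>x. (1 + (\<Sum>i\<in>{1..k}. l i * x i)) powr (- \<beta>) \<partial>m_beta Q k) = transform_value k (\<beta> / real k) l"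
proof -
  let ?u = "\<lambda>N g. (1 + (\<Sum>i=1..k. l i * S N i g)) powr (- \<beta>)"
  let ?J = "\<lambda>g. (1 + (\<Sum>i=1..k. l i * J i g)) powr (- \<beta>)"
  have le1: "1 \<le> 1 + (\<Sum>i=1..k. l i * S N i g)" if "g \<in> G_space" for N g
    using l S_bounds[OF that] by (auto intro!: sum_nonneg mult_nonneg_nonneg)
  have le1J: "1 \<le> 1 + (\<Sum>i=1..k. l i * J i g)" if "g \<in> G_space" for g
    using l J_bounds[OF that] by (auto intro!: sum_nonneg mult_nonneg_nonneg)
  have lim1: "(\<lambda>N. \<integral>g. ?u N g \<partial>Q) \<longlonglongrightarrow> (\<integral>g. ?J g \<partial>Q)"
  proof (rule integral_dominated_convergence[where w="\<lambda>_. 1"])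
    show "?J \<in> borel_measurable Q"
      by (intro powr_real_measurable borel_measurable_add borel_measurable_sum borel_measurable_times J_measurable borel_measurable_const) auto
    show "AE g in Q. (\<lambda>N. ?u N g) \<longlonglongrightarrow> ?J g"
    proof (rule AE_I2)
      fix g assume "g \<in> space Q"
      then have g: "g \<in> G_space" by (simp add: space_Q)
      show "(\<lambda>N. ?u N g) \<longlonglongrightarrow> ?J g"
        by (intro tendsto_powr tendsto_intros S_tendsto_J[OF g]) (use le1J[OF g] in auto)
    qed
    show "AE g in Q. norm (?u N g) \<le> 1" for N
    proof (rule AE_I2)
      fix g assume "g \<in> space Q"
      then have "1 \<le> 1 + (\<Sum>i=1..k. l i * S N i g)" by (intro le1) (simp add: space_Q)
      then have "1 \<le> (1 + (\<Sum>i=1..k. l i * S N i g)) powr \<beta>" using b by (intro ge_one_powr_ge_zero) auto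
      then show "norm (?u N g) \<le> 1" by (simp add: powr_minus inverse_le_1_iff)
    qed
  qed auto
  let ?A = "\<lambda>i. 1 + tail_sum k l i"
  let ?R = "\<lambda>N i. (1 / real N) * (\<Sum>j=1..N. ln (?A i + l i * (real j / real N)))"
  have val: "(\<integral>g. ?u N g \<partial>Q) = (\<Prod>i=1..k. exp (- (\<beta> / real k) * ?R N i))" if N: "N \<ge> 1" for N
  proof -
    have pos: "?A i + l i * (real j / real N) > 0" if "i \<in> {1..k}" for i j
      using l[OF that] tail_sum_nonneg[where l=l and i=i, OF l] by (intro add_pos_nonneg) auto
    have "(\<integral>g. ?u N g \<partial>Q) = enn2real (\<integral>\<^sup>+g. ennreal (?u N g) \<partial>Q)" by (rule integral_eq_nn_integral) auto
    also have "\<dots> = (\<Prod>i=1..k. \<Prod>m=1..N. (?A i + l i * (real (N - m + 1) / real N)) powr (- (\<beta> / real (k * N))))"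
      by (subst S_transform[OF N], erule l, intro enn2real_ennreal prod_nonneg) auto
    also have "\<dots> = (\<Prod>i=1..k. exp (- (\<beta> / real k) * ?R N i))"
    proof (rule prod.cong[OF refl])
      fix i assume i: "i \<in> {1..k}"
      \<comment> \<open>Reversing the order inside a block is the reflection built into
        \<open>transform_value\<close>.\<close>
      have "(\<Prod>m=1..N. (?A i + l i * (real (N - m + 1) / real N)) powr (- (\<beta> / real (k * N)))) =
        (\<Prod>j=1..N. (?A i + l i * (real j / real N)) powr (- (\<beta> / real (k * N))))"
        by (rule prod.reindex_bij_witness[of _ "\<lambda>j. N - j + 1" "\<lambda>m. N - m + 1"]) auto
      also have "\<dots> = (\<Prod>j=1..N. exp (- (\<beta> / real (k * N)) * ln (?A i + l i * (real j / real N))))"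
        using pos[OF i] by (intro prod.cong refl) (simp add: powr_def less_imp_neq[symmetric])
      also have "\<dots> = exp (\<Sum>j=1..N. - (\<beta> / real (k * N)) * ln (?A i + l i * (real j / real N)))"
        by (rule exp_sum[symmetric]) simp
      also have "(\<Sum>j=1..N. - (\<beta> / real (k * N)) * ln (?A i + l i * (real j / real N))) = - (\<beta> / real k) * ?R N i"
        unfolding sum_distrib_left[symmetric] by simp
      finally show "(\<Prod>m=1..N. (?A i + l i * (real (N - m + 1) / real N)) powr (- (\<beta> / real (k * N)))) = exp (- (\<beta> / real k) * ?R N i)" .
    qed
    finally show ?thesis .
  qed
  have "(\<lambda>N. \<Prod>i=1..k. exp (- (\<beta> / real k) * ?R N i)) \<longlonglongrightarrow> transform_value k (\<beta> / real k) l"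
    unfolding transform_value_def
    by (intro tendsto_prod tendsto_exp tendsto_mult tendsto_const riemann_sum_ln) (use l tail_sum_nonneg[where l=l, OF l] in \<open>auto intro: add_pos_nonneg\<close>)
  then have "(\<lambda>N. \<integral>g. ?u N g \<partial>Q) \<longlonglongrightarrow> transform_value k (\<beta> / real k) l"
    by (rule Lim_transform_eventually) (use val in \<open>auto simp: eventually_sequentially intro!: exI[of _ 1]\<close>)
  then have "(\<integral>g. ?J g \<partial>Q) = transform_value k (\<beta> / real k) l"
    using lim1 LIMSEQ_unique by blast
  moreover have "(\<integral>x. (1 + (\<Sum>i\<in>{1..k}. l i * x i)) powr (- \<beta>) \<partial>m_beta Q k) = (\<integral>g. ?J g \<partial>Q)"
    unfolding m_beta_def
    by (subst integral_distr[OF hatJ_measurable]) (simp_all add: hatJ_eq)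
  ultimately show ?thesis by simp
qed

lemma m_beta_facts:
  shows "finite_measure (m_beta Q k)" "sets (m_beta Q k) = sets (PiM {1..k} (\<lambda>_. borel))"
    "AE x in m_beta Q k. \<forall>i\<in>{1..k}. x i \<in> {0..1}"
proof -
  show "finite_measure (m_beta Q k)" unfolding m_beta_def by (rule finite_measure_distr[OF hatJ_measurable])
  show "sets (m_beta Q k) = sets (PiM {1..k} (\<lambda>_. borel))" unfolding m_beta_def by (simp add: sets_leb)
  have "{x \<in> space (leb k). \<forall>i\<in>{1..k}. x i \<in> {0..1}} \<in> sets (leb k)"
  proof -
    have "{x \<in> space (leb k). \<forall>i\<in>{1..k}. x i \<in> {0..1}} = PiE {1..k} (\<lambda>_. {0..1})"
      by (auto simp: leb_def space_PiM PiE_iff extensional_def)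
    then show ?thesis unfolding leb_def by (simp add: sets_PiM_I_finite)
  qed
  then show "AE x in m_beta Q k. \<forall>i\<in>{1..k}. x i \<in> {0..1}"
    unfolding m_beta_def using J_bounds
    by (subst AE_distr_iff[OF hatJ_measurable]) (auto simp: hatJ_eq space_Q intro!: AE_I2)
qed

end

section \<open>The density\<close>

locale bridge_density =
  fixes \<alpha> :: real and k :: nat
  assumes a: "0 < \<alpha>" "\<alpha> \<le> 1" and k: "k \<ge> 1"
begin

text \<open>The power \<open>(q - p) powr (\<alpha> - 2)\<close> is the Dirichlet factor of exponent
  \<open>\<alpha> - 1\<close> times \<open>1 / (q - p)\<close> from rescaling the law
  \<open>vartheta \<alpha>\<close> to the interval (p, q). The cut-off encodes the domain of
  integration of \<open>rho_formula\<close>.\<close>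

definition kern :: "real \<Rightarrow> real \<Rightarrow> real \<Rightarrow> real" where
  "kern p x q = (if p < x \<and> x < q then vartheta \<alpha> ((x - p) / (q - p)) * (q - p) powr (\<alpha> - 2) else 0)"

lemma ratio_in: "p < x \<Longrightarrow> x < q \<Longrightarrow> (x - p) / (q - p) \<in> {0<..<1::real}"
  by (auto simp: field_simps)

lemma kern_nonneg: "kern p x q \<ge> 0"
  using vartheta_pos[OF a] ratio_in[of p x q] by (auto simp: kern_def less_imp_le)

lemma kern_pos: "p < x \<Longrightarrow> x < q \<Longrightarrow> kern p x q > 0"
  using vartheta_pos[OF a] ratio_in[of p x q] by (auto simp: kern_def intro!: mult_pos_pos)

lemma kern_nonzero: "kern p x q \<noteq> 0 \<longleftrightarrow> p < x \<and> x < q"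
  using kern_pos[of p x q] by (auto simp: kern_def)

lemma kern_measurable:
  assumes [measurable]: "f \<in> borel_measurable M" "g \<in> borel_measurable M" "h \<in> borel_measurable M"
  shows "(\<lambda>w. kern (f w) (g w) (h w)) \<in> borel_measurable M"
proof -
  define v where "v = (\<lambda>z. indicator {0<..<1} z * vartheta \<alpha> z)"
  have [measurable]: "v \<in> borel_measurable borel" unfolding v_def by (rule vartheta_measurable[OF a])
  have "(\<lambda>w. kern (f w) (g w) (h w)) =
     (\<lambda>w. if f w < g w \<and> g w < h w then v ((g w - f w) / (h w - f w)) * (h w - f w) powr (\<alpha> - 2) else 0)"
    using ratio_in by (auto simp: kern_def v_def)
  also have "\<dots> \<in> borel_measurable M" by measurable
  finally show ?thesis .
qed

lemma kern_affine:
  assumes d: "d > 0"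
  shows "d * kern p (p + d * z) (p + d) = indicator {0<..<1} z * vartheta \<alpha> z * d powr (\<alpha> - 1)"
proof (cases "z \<in> {0<..<1}")
  case True
  have "d * d powr (\<alpha> - 2) = d powr (\<alpha> - 1)" using d by (simp add: powr_mult_base)
  then show ?thesis using True d by (simp add: kern_def)
next
  case False
  then have "\<not> (0 < d * z \<and> d * z < d)" using d by (auto simp: zero_less_mult_iff)
  then show ?thesis using False by (auto simp: kern_def)
qed

text \<open>Up to \<open>Cst\<close>, the joint density of the vector \<open>x\<close> and the nodes
  \<open>y\<close> in the representation of the claimed law.\<close>

definition bridge :: "(nat \<Rightarrow> real) \<Rightarrow> (nat \<Rightarrow> real) \<Rightarrow> real" where
  "bridge x y = (\<Prod>i=1..k. kern (node k y (i - 1)) (x i) (node k y i))"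

lemma bridge_nonneg: "bridge x y \<ge> 0"
  unfolding bridge_def by (intro prod_nonneg) (simp add: kern_nonneg)

lemma bridge_nonzero:
  "bridge x y \<noteq> 0 \<longleftrightarrow> (\<forall>i\<in>{1..k}. node k y (i - 1) < x i \<and> x i < node k y i)"
  unfolding bridge_def by (simp only: prod_zero_iff[OF finite_atLeastAtMost] kern_nonzero[symmetric]) auto

lemma bridge_measurable_pair:
  "(\<lambda>(x, y). bridge x y) \<in> borel_measurable (leb k \<Otimes>\<^sub>M leb (k - 1))"
proof -
  have 1: "(\<lambda>w. fst w i) \<in> borel_measurable (leb k \<Otimes>\<^sub>M leb (k - 1))" if "i \<in> {1..k}" for i
    by (rule measurable_compose[OF measurable_fst]) (use that in \<open>simp add: measurable_component_singleton\<close>)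
  have 2: "(\<lambda>w. node k (snd w) i) \<in> borel_measurable (leb k \<Otimes>\<^sub>M leb (k - 1))" if "i \<le> k" for i
    by (rule measurable_compose[OF measurable_snd]) (use that node_measurable[of i k] in simp)
  show ?thesis unfolding bridge_def split_beta'
    by (intro borel_measurable_prod kern_measurable 1 2) auto
qed

lemma bridge_measurable: "bridge x \<in> borel_measurable (leb (k - 1))"
  unfolding bridge_def[abs_def] measurable_leb_cong
  by (intro borel_measurable_prod kern_measurable node_measurable borel_measurable_const) auto

text \<open>Gaps between consecutive points of \<open>0, x 1, ..., x k, 1\<close>: there are
  \<open>k + 1\<close> of them, the outer two being distances to the boundary.\<close>

definition gap :: "(nat \<Rightarrow> real) \<Rightarrow> nat \<Rightarrow> real" where
  "gap x i = (if i = 0 then x 1 else if i = k then 1 - x k else x (i + 1) - x i)"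

lemma Sigma_k_iff: "x \<in> Sigma_k k \<longleftrightarrow> x \<in> space (leb k) \<and> (\<forall>i\<in>{0..k}. gap x i > 0)"
proof -
  have "{0..k} = {0} \<union> {1..<k} \<union> {k}" using k by auto
  then show ?thesis using k by (auto simp: Sigma_k_def gap_def)
qed

text \<open>\<open>bridge\<close> groups the inequalities by \<open>x i\<close>,
  \<open>rho_formula\<close> by \<open>y i\<close>. Regrouping leaves the two end conditions, in
  which no \<open>y\<close> occurs.\<close>

lemma bridge_interlace:
  "bridge x y \<noteq> 0 \<longleftrightarrow> 0 < x 1 \<and> x k < 1 \<and> (\<forall>i\<in>{1..k-1}. x i < y i \<and> y i < x (i + 1))"
proof -
  have "(\<forall>i\<in>{1..k}. node k y (i - 1) < x i \<and> x i < node k y i) \<longleftrightarrow>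
    0 < x 1 \<and> x k < 1 \<and> (\<forall>i\<in>{1..k-1}. x i < y i \<and> y i < x (i + 1))" (is "?L \<longleftrightarrow> ?R")
  proof
    assume L: ?L
    have "0 < x 1" using bspec[OF L, of 1] k by (simp add: node_def)
    moreover have "x k < 1" using bspec[OF L, of k] k by (simp add: node_def)
    moreover have "x i < y i" "y i < x (i + 1)" if "i \<in> {1..k-1}" for i
    proof -
      have i: "i \<in> {1..k}" "i \<noteq> k" "i \<noteq> 0" using that k by auto
      then show "x i < y i" using bspec[OF L i(1)] by (simp add: node_def)
      have "i + 1 \<in> {1..k}" using that by auto
      from bspec[OF L this] show "y i < x (i + 1)" using that by (auto simp: node_def split: if_splits)
    qed
    ultimately show ?R by blast
  next
    assume R: ?R
    show ?L
    proof
      fix i assume i: "i \<in> {1..k}"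
      have "node k y (i - 1) < x i"
      proof (cases "i = 1")
        case True
        then show ?thesis using R by (simp add: node_def)
      next
        case False
        then have "i - 1 \<in> {1..k-1}" using i by auto
        then have "y (i - 1) < x (i - 1 + 1)" using R by blast
        then show ?thesis using i False by (auto simp: node_def)
      qed
      moreover have "x i < node k y i"
      proof (cases "i = k")
        case True
        then show ?thesis using R k by (simp add: node_def)
      next
        case False
        then have "i \<in> {1..k-1}" using i by auto
        then show ?thesis using R False i by (auto simp: node_def)
      qed
      ultimately show "node k y (i - 1) < x i \<and> x i < node k y i" ..
    qed
  qed
  then show ?thesis by (simp only: bridge_nonzero)
qed

definition I :: "(nat \<Rightarrow> real) \<Rightarrow> real" where
  "I x = (\<integral>y. bridge x y \<partial>leb (k - 1))"

definition Cst :: real where "Cst = Gamma (real k * \<alpha>) / Gamma \<alpha> ^ k"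

lemma Cst_pos: "Cst > 0"
  unfolding Cst_def using a k by (intro divide_pos_pos zero_less_power Gamma_real_pos mult_pos_pos) auto

lemma rho_formula_eq:
  assumes x: "x \<in> Sigma_k k"
  shows "rho_formula (real k * \<alpha>) k x = Cst * I x"
proof -
  have al: "real k * \<alpha> / real k = \<alpha>" using k by simp
  let ?A = "{y \<in> space (leb (k - 1)). \<forall>i\<in>{1..k-1}. x i < y i \<and> y i < x (i + 1)}"
  let ?f = "\<lambda>y. \<Prod>i\<in>{1..k}. vartheta \<alpha> ((x i - node k y (i - 1)) / (node k y i - node k y (i - 1)))
                        * (node k y i - node k y (i - 1)) powr (\<alpha> - 2)"
  have x0: "0 < x 1" "x k < 1" using x by (auto simp: Sigma_k_def)
  have eq: "indicator ?A y *\<^sub>R ?f y = bridge x y" if y: "y \<in> space (leb (k - 1))" for y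
  proof (cases "y \<in> ?A")
    case True
    then have "bridge x y \<noteq> 0" using bridge_interlace x0 by blast
    then have "\<forall>i\<in>{1..k}. node k y (i - 1) < x i \<and> x i < node k y i" by (simp only: bridge_nonzero)
    then have "bridge x y = ?f y" unfolding bridge_def by (intro prod.cong) (auto simp: kern_def)
    then show ?thesis using True by simp
  next
    case False
    then have "bridge x y = 0" using bridge_interlace[of x y] y by blast
    then show ?thesis using False by simp
  qed
  have "rho_formula (real k * \<alpha>) k x = Cst * (\<integral>y. indicator ?A y *\<^sub>R ?f y \<partial>leb (k - 1))"
    unfolding rho_formula_def Cst_def al Let_def set_lebesgue_integral_def node_def ..
  also have "(\<integral>y. indicator ?A y *\<^sub>R ?f y \<partial>leb (k - 1)) = I x"
    unfolding I_def by (rule Bochner_Integration.integral_cong[OF refl eq])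
  finally show ?thesis .
qed

lemma bridge_outside:
  assumes "x \<in> space (leb k)" "x \<notin> Sigma_k k"
  shows "bridge x y = 0"
proof (rule ccontr)
  assume "bridge x y \<noteq> 0"
  then have R: "0 < x 1" "x k < 1" "\<forall>i\<in>{1..k-1}. x i < y i \<and> y i < x (i + 1)" by (auto simp: bridge_interlace)
  have "x i < x (i + 1)" if "i \<in> {1..<k}" for i
  proof -
    have "i \<in> {1..k-1}" using that by auto
    then show ?thesis using R(3) by force
  qed
  then have "x \<in> Sigma_k k" using assms(1) R by (auto simp: Sigma_k_def)
  then show False using assms(2) by simp
qed

section \<open>Integration over a fixed cube: domination, positivity and continuity\<close>

definition sub :: "(nat \<Rightarrow> real) \<Rightarrow> (nat \<Rightarrow> real) \<Rightarrow> nat \<Rightarrow> real" where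
  "sub x s = (\<lambda>i\<in>{1..k-1}. x i + gap x i * s i)"

lemma gap_inner: "i \<in> {1..k-1} \<Longrightarrow> gap x i = x (i + 1) - x i"
  by (auto simp: gap_def)

lemma sub_measurable: "sub x \<in> measurable (leb (k - 1)) (leb (k - 1))"
proof -
  have "(\<lambda>s. \<lambda>i\<in>{1..k-1}. x i + gap x i * s i) \<in> measurable (PiM {1..k-1} (\<lambda>_. lborel)) (PiM {1..k-1} (\<lambda>_. lborel))"
    by (rule measurable_restrict) auto
  then show ?thesis unfolding sub_def[abs_def] leb_def .
qed

lemma bridge_sub_nonzero:
  assumes "\<forall>i\<in>{0..k}. gap x i > 0"
  shows "bridge x (sub x s) \<noteq> 0 \<longleftrightarrow> (\<forall>i\<in>{1..k-1}. 0 < s i \<and> s i < 1)"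
proof -
  have x0: "0 < x 1" "x k < 1" using bspec[OF assms, of 0] bspec[OF assms, of k] k by (auto simp: gap_def)
  have "x i < sub x s i \<and> sub x s i < x (i + 1) \<longleftrightarrow> 0 < s i \<and> s i < 1" if i: "i \<in> {1..k-1}" for i
  proof -
    have g: "gap x i > 0" using assms i by auto
    have "x (i + 1) = x i + gap x i" using gap_inner[OF i] by simp
    then show ?thesis using g i by (auto simp: sub_def zero_less_mult_iff)
  qed
  then show ?thesis using x0 by (simp add: bridge_interlace)
qed

text \<open>After the substitution \<open>y i = x i + gap x i * s i\<close> the domain of integration no longer depends on \<open>x\<close>,
  and \<open>majorant\<close> dominates locally uniformly in \<open>x\<close>. The exponent \<open>\<alpha> / 2 - 1\<close> comes from splitting
  the singularity \<open>(y i - y (i - 1)) powr (\<alpha> - 2)\<close> evenly between the two endpoints.\<close>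

definition majorant :: "(nat \<Rightarrow> real) \<Rightarrow> real" where
  "majorant s = (\<Prod>j=1..k-1. indicator {0<..<1} (s j) * (s j powr (\<alpha> / 2 - 1) * (1 - s j) powr (\<alpha> / 2 - 1)))"

lemma majorant_integrable: "integrable (leb (k - 1)) majorant"
  unfolding majorant_def[abs_def] leb_def
proof (rule lb.product_integrable_prod)
  fix i :: nat
  have "set_integrable lborel {0<..<1} (\<lambda>t. t powr (\<alpha> / 2 - 1) * (1 - t) powr (\<alpha> / 2 - 1))"
    by (rule set_integrable_subset[OF integrable_Beta[of "\<alpha> / 2" "\<alpha> / 2"]]) (use a in auto)
  then show "integrable lborel (\<lambda>t. indicator {0<..<1} t * (t powr (\<alpha> / 2 - 1) * (1 - t) powr (\<alpha> / 2 - 1)))"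
    by (simp add: set_integrable_def)
qed simp

text \<open>Each inner node \<open>j\<close> is the right end of interval \<open>j\<close> and the
  left end of interval \<open>j + 1\<close>; collecting its two factors turns a product over
  intervals into one over nodes.\<close>

lemma prod_shift_ends:
  fixes p q :: "nat \<Rightarrow> real"
  shows "(\<Prod>i=1..k. (if i = k then 1 else p i) * (if i = 1 then 1 else q (i - 1))) = (\<Prod>j=1..k-1. p j * q j)"
proof -
  obtain m where m: "k = Suc m" using k by (cases k) auto
  have "(\<Prod>i=1..k. if i = k then 1 else p i) = (\<Prod>j=1..m. p j)"
    unfolding m prod.cl_ivl_Suc by (auto intro!: prod.cong)
  moreover have "(\<Prod>i=1..k. if i = 1 then 1 else q (i - 1)) = (\<Prod>j=1..m. q j)"
  proof -
    have "(\<Prod>i=1..Suc m. if i = 1 then 1 else q (i - 1)) = (\<Prod>i=Suc 1..Suc m. if i = 1 then 1 else q (i - 1))"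
      by (subst prod.atLeast_Suc_atMost) auto
    also have "\<dots> = (\<Prod>i=1..m. q i)" unfolding prod.shift_bounds_cl_Suc_ivl by (intro prod.cong) auto
    finally show ?thesis unfolding m .
  qed
  ultimately show ?thesis by (simp add: prod.distrib m)
qed

text \<open>Interval \<open>i\<close> has length at least \<open>\<delta> * (e i + f i)\<close>,
  hence at least \<open>\<delta> * sqrt (e i * f i)\<close>; under the exponent
  \<open>\<alpha> - 2\<close> the square root separates into the exponents
  \<open>\<alpha> / 2 - 1\<close>. One \<open>M\<close> serves all \<open>x\<close> with gaps at
  least \<delta>, as dominated convergence requires.\<close>

lemma bridge_bound:
  "\<exists>M>0. \<forall>\<delta> x s. \<delta> > 0 \<longrightarrow> (\<forall>i\<in>{0..k}. gap x i \<ge> \<delta>) \<longrightarrow>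
    bridge x (sub x s) \<le> (M * \<delta> powr (\<alpha> - 2)) ^ k * majorant s"
proof -
  obtain M where M: "M > 0" "\<And>z. 0 < z \<Longrightarrow> z < 1 \<Longrightarrow> \<bar>vartheta \<alpha> z\<bar> \<le> M"
    using vartheta_bounded[OF a] by blast
  have bb: "bridge x (sub x s) \<le> (M * \<delta> powr (\<alpha> - 2)) ^ k * majorant s" if \<delta>: "\<delta> > 0" and g: "\<forall>i\<in>{0..k}. gap x i \<ge> \<delta>" for \<delta> x s
  proof (cases "\<forall>i\<in>{1..k-1}. 0 < s i \<and> s i < 1")
    case False
    have "\<forall>i\<in>{0..k}. gap x i > 0" using g \<delta> by force
    from bridge_sub_nonzero[OF this, of s] False have "bridge x (sub x s) = 0" by blast
    moreover have "majorant s \<ge> 0" unfolding majorant_def by (intro prod_nonneg) auto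
    ultimately show ?thesis using M(1) \<delta> by simp
  next
    case True
    let ?\<gamma> = "\<alpha> / 2 - 1"
    \<comment> \<open>\<open>e\<close> and \<open>f\<close> bound, in units of \<delta>, the
      distances from \<open>x i\<close> to the right and left end of its interval. At the outer ends
      this distance is a full gap, whence the value 1.\<close>
    define e where "e = (\<lambda>i. if i = k then 1 else s i)"
    define f where "f = (\<lambda>i. if i = 1 then 1 else 1 - s (i - 1))"
    have gpos: "\<forall>i\<in>{0..k}. gap x i > 0" using g \<delta> by force
    have nz: "\<forall>i\<in>{1..k}. node k (sub x s) (i - 1) < x i \<and> x i < node k (sub x s) i"
      using bridge_sub_nonzero[OF gpos] True bridge_nonzero by blast
    have each: "kern (node k (sub x s) (i - 1)) (x i) (node k (sub x s) i) \<le> M * \<delta> powr (\<alpha> - 2) * (e i powr ?\<gamma> * f i powr ?\<gamma>)"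
      if i: "i \<in> {1..k}" for i
    proof -
      let ?p = "node k (sub x s) (i - 1)" and ?q = "node k (sub x s) i"
      have e0: "e i > 0" using True i by (auto simp: e_def)
      have f0: "f i > 0"
      proof (cases "i = 1")
        case False
        then have "i - 1 \<in> {1..k-1}" using i by auto
        then show ?thesis using True False by (auto simp: f_def)
      qed (simp add: f_def)
      have q: "?q - x i \<ge> \<delta> * e i"
      proof (cases "i = k")
        case True
        then show ?thesis using bspec[OF g, of k] k by (auto simp: e_def node_def gap_def)
      next
        case False
        then have i': "i \<in> {1..k-1}" using i by auto
        then have "?q = x i + gap x i * s i" by (auto simp: node_def sub_def)
        moreover have "\<delta> * s i \<le> gap x i * s i" using g i' True by (intro mult_right_mono) (auto simp: less_imp_le)
        ultimately show ?thesis using False by (simp add: e_def)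
      qed
      have p: "x i - ?p \<ge> \<delta> * f i"
      proof (cases "i = 1")
        case True
        then show ?thesis using bspec[OF g, of 0] by (auto simp: f_def node_def gap_def)
      next
        case False
        then have i': "i - 1 \<in> {1..k-1}" using i by auto
        have "?p = x (i - 1) + gap x (i - 1) * s (i - 1)" using i' by (auto simp: node_def sub_def)
        moreover have "x i = x (i - 1) + gap x (i - 1)" using gap_inner[OF i', of x] i False by simp
        ultimately have "x i - ?p = gap x (i - 1) * (1 - s (i - 1))" by (simp add: algebra_simps)
        moreover have "\<delta> * (1 - s (i - 1)) \<le> gap x (i - 1) * (1 - s (i - 1))"
          using g i' True by (intro mult_right_mono) (auto simp: less_imp_le)
        ultimately show ?thesis using False by (simp add: f_def)
      qed
      have c: "?p < x i" "x i < ?q" using nz i by auto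
      have "sqrt (e i * f i) \<le> e i + f i"
        using arith_geo_mean_sqrt[of "e i" "f i"] e0 f0 by simp
      then have "\<delta> * sqrt (e i * f i) \<le> \<delta> * (e i + f i)" using \<delta> by (intro mult_left_mono) auto
      also have "\<dots> \<le> ?q - ?p" using p q by (simp add: distrib_left)
      finally have "(?q - ?p) powr (\<alpha> - 2) \<le> (\<delta> * sqrt (e i * f i)) powr (\<alpha> - 2)"
        using a \<delta> e0 f0 by (intro powr_mono2') auto
      also have "\<dots> = \<delta> powr (\<alpha> - 2) * (e i powr ?\<gamma> * f i powr ?\<gamma>)"
      proof -
        have "sqrt (e i * f i) powr (\<alpha> - 2) = (e i * f i) powr ?\<gamma>"
          using e0 f0 by (simp add: powr_half_sqrt[symmetric] powr_powr diff_divide_distrib)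
        then show ?thesis using \<delta> e0 f0 by (simp add: powr_mult)
      qed
      finally have d: "(?q - ?p) powr (\<alpha> - 2) \<le> \<delta> powr (\<alpha> - 2) * (e i powr ?\<gamma> * f i powr ?\<gamma>)" .
      have "\<bar>vartheta \<alpha> ((x i - ?p) / (?q - ?p))\<bar> \<le> M" using M(2) ratio_in[OF c] by auto
      then have "vartheta \<alpha> ((x i - ?p) / (?q - ?p)) * (?q - ?p) powr (\<alpha> - 2) \<le> M * (\<delta> powr (\<alpha> - 2) * (e i powr ?\<gamma> * f i powr ?\<gamma>))"
        using d M(1) by (intro mult_mono) auto
      then show ?thesis using c by (simp add: kern_def)
    qed
    have "bridge x (sub x s) \<le> (\<Prod>i=1..k. M * \<delta> powr (\<alpha> - 2) * (e i powr ?\<gamma> * f i powr ?\<gamma>))"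
      unfolding bridge_def using each kern_nonneg by (intro prod_mono) auto
    also have "\<dots> = (M * \<delta> powr (\<alpha> - 2)) ^ k * (\<Prod>i=1..k. e i powr ?\<gamma> * f i powr ?\<gamma>)"
      by (simp add: prod.distrib)
    also have "(\<Prod>i=1..k. e i powr ?\<gamma> * f i powr ?\<gamma>) =
       (\<Prod>i=1..k. (if i = k then 1 else s i powr ?\<gamma>) * (if i = 1 then 1 else (1 - s (i - 1)) powr ?\<gamma>))"
      by (intro prod.cong) (auto simp: e_def f_def)
    also have "\<dots> = (\<Prod>j=1..k-1. s j powr ?\<gamma> * (1 - s j) powr ?\<gamma>)" by (rule prod_shift_ends)
    also have "\<dots> = majorant s" unfolding majorant_def using True by (intro prod.cong) auto
    finally show ?thesis .
  qed
  show ?thesis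
  proof (intro exI[of _ M] conjI allI impI)
    fix \<delta> x s assume "\<delta> > 0" "\<forall>i\<in>{0..k}. gap x i \<ge> \<delta>"
    then show "bridge x (sub x s) \<le> (M * \<delta> powr (\<alpha> - 2)) ^ k * majorant s" by (rule bb)
  qed (rule M(1))
qed

lemma gap_lower:
  assumes "\<forall>i\<in>{0..k}. gap x i > 0"
  obtains \<delta> where "\<delta> > 0" "\<forall>i\<in>{0..k}. gap x i > \<delta>"
proof
  let ?m = "Min (gap x ` {0..k})"
  have m: "?m > 0" using assms by (subst Min_gr_iff) auto
  then show "?m / 2 > 0" by simp
  show "\<forall>i\<in>{0..k}. gap x i > ?m / 2"
  proof
    fix i assume "i \<in> {0..k}"
    then have "?m \<le> gap x i" by (intro Min_le) auto
    then show "gap x i > ?m / 2" using m by linarith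
  qed
qed

lemma sub_integrable:
  assumes g: "\<forall>i\<in>{0..k}. gap x i > 0"
  shows "integrable (leb (k - 1)) (\<lambda>s. bridge x (sub x s))"
proof -
  obtain \<delta> where \<delta>: "\<delta> > 0" "\<forall>i\<in>{0..k}. gap x i > \<delta>" using gap_lower[OF g] .
  obtain M where M: "\<forall>\<delta> x s. \<delta> > 0 \<longrightarrow> (\<forall>i\<in>{0..k}. gap x i \<ge> \<delta>) \<longrightarrow>
    bridge x (sub x s) \<le> (M * \<delta> powr (\<alpha> - 2)) ^ k * majorant s" using bridge_bound by (elim exE conjE)
  show ?thesis
  proof (rule Bochner_Integration.integrable_bound)
    show "integrable (leb (k - 1)) (\<lambda>s. (M * \<delta> powr (\<alpha> - 2)) ^ k * majorant s)"
      by (rule integrable_mult_right[OF majorant_integrable])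
    show "(\<lambda>s. bridge x (sub x s)) \<in> borel_measurable (leb (k - 1))"
      by (rule measurable_compose[OF sub_measurable bridge_measurable])
    show "AE s in leb (k - 1). norm (bridge x (sub x s)) \<le> norm ((M * \<delta> powr (\<alpha> - 2)) ^ k * majorant s)"
    proof (rule AE_I2)
      fix s
      have "bridge x (sub x s) \<le> (M * \<delta> powr (\<alpha> - 2)) ^ k * majorant s" using \<delta> by (intro M[rule_format]) (auto simp: less_imp_le)
      then show "norm (bridge x (sub x s)) \<le> norm ((M * \<delta> powr (\<alpha> - 2)) ^ k * majorant s)"
        using bridge_nonneg[of x "sub x s"] by simp
    qed
  qed
qed

text \<open>The substitution is made in nonnegative integrals, so integrability is transferred from
  the cube along with the value; the product of the gaps is the Jacobian.\<close>

lemma I_sub: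
  assumes g: "\<forall>i\<in>{0..k}. gap x i > 0"
  shows "integrable (leb (k - 1)) (bridge x)"
    and "I x = (\<Prod>i=1..k-1. gap x i) * (\<integral>s. bridge x (sub x s) \<partial>leb (k - 1))"
proof -
  have gi: "gap x i > 0" if "i \<in> {1..k-1}" for i using g that by auto
  have pr: "(\<Prod>i=1..k-1. gap x i) \<ge> 0" using gi by (intro prod_nonneg) (auto simp: less_imp_le)
  have "(\<integral>\<^sup>+y. ennreal (bridge x y) \<partial>leb (k - 1)) = ennreal (\<Prod>i=1..k-1. gap x i) *
     (\<integral>\<^sup>+s. ennreal (bridge x (\<lambda>i\<in>{1..k-1}. x i + gap x i * s i)) \<partial>leb (k - 1))"
    by (rule nn_integral_leb_affine[OF gi measurable_compose[OF bridge_measurable measurable_ennreal]])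
  also have "\<dots> = ennreal (\<Prod>i=1..k-1. gap x i) * ennreal (\<integral>s. bridge x (sub x s) \<partial>leb (k - 1))"
    unfolding sub_def[symmetric] using sub_integrable[OF g] bridge_nonneg
    by (subst nn_integral_eq_integral) auto
  also have "\<dots> = ennreal ((\<Prod>i=1..k-1. gap x i) * (\<integral>s. bridge x (sub x s) \<partial>leb (k - 1)))"
    using pr by (simp add: ennreal_mult')
  finally have nn: "(\<integral>\<^sup>+y. ennreal (bridge x y) \<partial>leb (k - 1)) = ennreal ((\<Prod>i=1..k-1. gap x i) * (\<integral>s. bridge x (sub x s) \<partial>leb (k - 1)))" .
  show "integrable (leb (k - 1)) (bridge x)"
    by (rule integrableI_nonneg[OF bridge_measurable]) (use nn bridge_nonneg in auto)
  have "I x = enn2real (\<integral>\<^sup>+y. ennreal (bridge x y) \<partial>leb (k - 1))"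
    unfolding I_def by (rule integral_eq_nn_integral[OF bridge_measurable]) (simp add: bridge_nonneg)
  also have "\<dots> = (\<Prod>i=1..k-1. gap x i) * (\<integral>s. bridge x (sub x s) \<partial>leb (k - 1))"
    unfolding nn using pr bridge_nonneg by (intro enn2real_ennreal mult_nonneg_nonneg Bochner_Integration.integral_nonneg) auto
  finally show "I x = (\<Prod>i=1..k-1. gap x i) * (\<integral>s. bridge x (sub x s) \<partial>leb (k - 1))" .
qed

text \<open>The integrand is positive exactly on the open unit cube, which has measure 1 also for
  \<open>k = 1\<close>, where it is a single point.\<close>

lemma I_pos:
  assumes g: "\<forall>i\<in>{0..k}. gap x i > 0"
  shows "I x > 0"
proof -
  let ?h = "\<lambda>s. bridge x (sub x s)" and ?B = "PiE {1..k-1} (\<lambda>_. {0<..<1::real})"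
  have "(\<integral>s. ?h s \<partial>leb (k - 1)) \<noteq> 0"
  proof
    assume "(\<integral>s. ?h s \<partial>leb (k - 1)) = 0"
    then have "AE s in leb (k - 1). ?h s = 0"
      using integral_nonneg_eq_0_iff_AE[OF sub_integrable[OF g]] bridge_nonneg by auto
    then have "AE s in leb (k - 1). s \<notin> ?B"
    proof eventually_elim
      case (elim s)
      then show ?case using bridge_sub_nonzero[OF g, of s] by (auto simp: PiE_iff)
    qed
    moreover have B: "?B \<in> sets (leb (k - 1))" unfolding leb_def by (intro sets_PiM_I_finite) auto
    ultimately have "emeasure (leb (k - 1)) ?B = 0"
      by (subst (asm) AE_iff_null_sets[symmetric, OF B]) auto
    moreover have "emeasure (leb (k - 1)) ?B = 1"
      unfolding leb_def by (subst lb.emeasure_PiM) auto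
    ultimately show False by simp
  qed
  moreover have "(\<integral>s. ?h s \<partial>leb (k - 1)) \<ge> 0" using bridge_nonneg by (intro Bochner_Integration.integral_nonneg) auto
  moreover have "(\<Prod>i=1..k-1. gap x i) > 0" using g by (intro prod_pos) auto
  ultimately show ?thesis unfolding I_sub(2)[OF g] by simp
qed

lemma kern_tendsto:
  assumes "p \<longlonglongrightarrow> p0" "x \<longlonglongrightarrow> x0" "q \<longlonglongrightarrow> q0" and c: "p0 < x0" "x0 < q0"
  shows "(\<lambda>n. kern (p n) (x n) (q n)) \<longlonglongrightarrow> kern p0 x0 q0"
proof -
  have d: "q0 - p0 > 0" using c by simp
  have r: "(\<lambda>n. (x n - p n) / (q n - p n)) \<longlonglongrightarrow> (x0 - p0) / (q0 - p0)"
    using assms d by (intro tendsto_intros) auto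
  have "isCont (vartheta \<alpha>) ((x0 - p0) / (q0 - p0))"
    using vartheta_continuous[OF a] ratio_in[OF c] by (auto simp: continuous_on_eq_continuous_at)
  from isCont_tendsto_compose[OF this r]
  have "(\<lambda>n. vartheta \<alpha> ((x n - p n) / (q n - p n)) * (q n - p n) powr (\<alpha> - 2)) \<longlonglongrightarrow>
     vartheta \<alpha> ((x0 - p0) / (q0 - p0)) * (q0 - p0) powr (\<alpha> - 2)"
    using assms d by (intro tendsto_intros) auto
  moreover have "\<forall>\<^sub>F n in sequentially. vartheta \<alpha> ((x n - p n) / (q n - p n)) * (q n - p n) powr (\<alpha> - 2) = kern (p n) (x n) (q n)"
  proof -
    have "\<forall>\<^sub>F n in sequentially. 0 < x n - p n" "\<forall>\<^sub>F n in sequentially. 0 < q n - x n"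
      using order_tendstoD(1)[OF tendsto_diff[OF assms(2,1)], of 0] order_tendstoD(1)[OF tendsto_diff[OF assms(3,2)], of 0] c by auto
    then show ?thesis by eventually_elim (simp add: kern_def)
  qed
  ultimately show ?thesis using c by (auto simp: kern_def intro: Lim_transform_eventually)
qed

lemma I_sequentially_continuous:
  assumes u: "\<And>n i. i \<in> {0..k} \<Longrightarrow> gap (u n) i > 0" and x: "\<forall>i\<in>{0..k}. gap x i > 0"
    and lim: "\<And>i. (\<lambda>n. u n i) \<longlonglongrightarrow> x i"
  shows "(\<lambda>n. I (u n)) \<longlonglongrightarrow> I x"
proof -
  have gl: "(\<lambda>n. gap (u n) i) \<longlonglongrightarrow> gap x i" for i unfolding gap_def by (auto intro!: tendsto_intros lim)
  obtain \<delta> where \<delta>: "\<delta> > 0" "\<forall>i\<in>{0..k}. gap x i > \<delta>" using gap_lower[OF x] .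
  have "\<forall>\<^sub>F n in sequentially. \<forall>i\<in>{0..k}. gap (u n) i > \<delta>"
    by (intro eventually_ball_finite ballI order_tendstoD(1)[OF gl]) (use \<delta>(2) in auto)
  then obtain n0 where n0: "\<And>n i. n \<ge> n0 \<Longrightarrow> i \<in> {0..k} \<Longrightarrow> gap (u n) i > \<delta>"
    unfolding eventually_sequentially by blast
  obtain M where M: "\<forall>\<delta> x s. \<delta> > 0 \<longrightarrow> (\<forall>i\<in>{0..k}. gap x i \<ge> \<delta>) \<longrightarrow>
    bridge x (sub x s) \<le> (M * \<delta> powr (\<alpha> - 2)) ^ k * majorant s" using bridge_bound by (elim exE conjE)
  \<comment> \<open>Dropping the first \<open>n0\<close> terms makes the lower bound \<delta> on the
    gaps uniform along the sequence.\<close>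
  define v where "v = (\<lambda>n. u (n + n0))"
  have vg: "\<forall>i\<in>{0..k}. gap (v n) i > \<delta>" for n unfolding v_def using n0 by auto
  have vg0: "\<forall>i\<in>{0..k}. gap (v n) i > 0" for n using vg[of n] \<delta>(1) by force
  have vl: "(\<lambda>n. v n i) \<longlonglongrightarrow> x i" for i unfolding v_def by (rule LIMSEQ_ignore_initial_segment[OF lim])
  have vgl: "(\<lambda>n. gap (v n) i) \<longlonglongrightarrow> gap x i" for i unfolding v_def by (rule LIMSEQ_ignore_initial_segment[OF gl])
  have "(\<lambda>n. \<integral>s. bridge (v n) (sub (v n) s) \<partial>leb (k - 1)) \<longlonglongrightarrow> (\<integral>s. bridge x (sub x s) \<partial>leb (k - 1))"
  proof (rule integral_dominated_convergence[where w="\<lambda>s. (M * \<delta> powr (\<alpha> - 2)) ^ k * majorant s"])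
    show "AE s in leb (k - 1). norm (bridge (v n) (sub (v n) s)) \<le> (M * \<delta> powr (\<alpha> - 2)) ^ k * majorant s" for n
    proof (rule AE_I2)
      fix s
      have "bridge (v n) (sub (v n) s) \<le> (M * \<delta> powr (\<alpha> - 2)) ^ k * majorant s"
        using \<delta> vg[of n] by (intro M[rule_format]) (auto simp: less_imp_le)
      then show "norm (bridge (v n) (sub (v n) s)) \<le> (M * \<delta> powr (\<alpha> - 2)) ^ k * majorant s"
        using bridge_nonneg[of "v n" "sub (v n) s"] by simp
    qed
    show "AE s in leb (k - 1). (\<lambda>n. bridge (v n) (sub (v n) s)) \<longlonglongrightarrow> bridge x (sub x s)"
    proof (rule AE_I2)
      fix s
      show "(\<lambda>n. bridge (v n) (sub (v n) s)) \<longlonglongrightarrow> bridge x (sub x s)"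
      proof (cases "\<forall>i\<in>{1..k-1}. 0 < s i \<and> s i < 1")
        case True
        then have nz: "\<forall>i\<in>{1..k}. node k (sub x s) (i - 1) < x i \<and> x i < node k (sub x s) i"
          using bridge_sub_nonzero[OF x] bridge_nonzero by blast
        have nl: "(\<lambda>n. node k (sub (v n) s) i) \<longlonglongrightarrow> node k (sub x s) i" for i
          unfolding node_def sub_def by (auto intro!: tendsto_intros vl vgl)
        show ?thesis unfolding bridge_def
          by (intro tendsto_prod kern_tendsto nl vl) (use nz in auto)
      next
        case False
        then have "bridge (v n) (sub (v n) s) = 0" "bridge x (sub x s) = 0" for n
          using bridge_sub_nonzero[OF vg0] bridge_sub_nonzero[OF x] by blast+
        then show ?thesis by simp
      qed
    qed
  qed (intro integrable_mult_right majorant_integrable measurable_compose[OF sub_measurable bridge_measurable])+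
  then have "(\<lambda>n. (\<Prod>i=1..k-1. gap (v n) i) * (\<integral>s. bridge (v n) (sub (v n) s) \<partial>leb (k - 1))) \<longlonglongrightarrow>
     (\<Prod>i=1..k-1. gap x i) * (\<integral>s. bridge x (sub x s) \<partial>leb (k - 1))"
    by (intro tendsto_mult tendsto_prod vgl)
  then have "(\<lambda>n. I (v n)) \<longlonglongrightarrow> I x" unfolding I_sub(2)[OF vg0] I_sub(2)[OF x] .
  then show ?thesis unfolding v_def by (rule LIMSEQ_offset)
qed

lemma I_continuous: "continuous_on (Sigma_k k) I"
proof (subst continuous_on_sequentially, intro allI ballI impI)
  fix u :: "nat \<Rightarrow> nat \<Rightarrow> real" and x assume x: "x \<in> Sigma_k k" and u: "(\<forall>n. u n \<in> Sigma_k k) \<and> u \<longlonglongrightarrow> x"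
  have "(\<lambda>n. u n i) \<longlonglongrightarrow> x i" for i
  proof -
    have "continuous_on UNIV (\<lambda>x::nat \<Rightarrow> real. x i)" by (rule continuous_on_product_coordinates)
    from continuous_on_tendsto_compose[OF this conjunct2[OF u]] show ?thesis by simp
  qed
  then have "(\<lambda>n. I (u n)) \<longlonglongrightarrow> I x"
    by (intro I_sequentially_continuous) (use u x Sigma_k_iff in auto)
  then show "(I \<circ> u) \<longlonglongrightarrow> I x" by (simp add: o_def)
qed

lemma I_measurable: "I \<in> borel_measurable (leb k)"
proof -
  interpret sigma_finite_measure "leb (k - 1)" by (rule sigma_finite_leb)
  show ?thesis unfolding I_def[abs_def]
    by (rule borel_measurable_lebesgue_integral[OF bridge_measurable_pair])
qed

section \<open>The transform of the claimed density\<close>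

lemma vartheta_transform_nn:
  assumes A: "A > 0" and s: "s \<ge> 0"
  shows "(\<integral>\<^sup>+z. ennreal (indicator {0<..<1} z * vartheta \<alpha> z * (A + s * z) powr (- \<alpha>)) \<partial>lborel) =
    ennreal (exp (- \<alpha> * integral {0..1} (\<lambda>t. ln (A + s * t))))"
proof -
  have "integrable lborel (\<lambda>z. indicator {0<..<1} z * ((A + s * z) powr (- \<alpha>) * vartheta \<alpha> z))"
    by (rule integrable_vartheta_mult[OF a, where B="A powr (- \<alpha>)"])
      (use A s a in \<open>auto intro!: powr_mono2'\<close>)
  moreover have "AE z in lborel. 0 \<le> indicator {0<..<1} z * ((A + s * z) powr (- \<alpha>) * vartheta \<alpha> z)"
    using vartheta_pos[OF a] by (intro AE_I2) (auto simp: indicator_def less_imp_le)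
  ultimately have "(\<integral>\<^sup>+z. ennreal (indicator {0<..<1} z * ((A + s * z) powr (- \<alpha>) * vartheta \<alpha> z)) \<partial>lborel) =
    ennreal (exp (- \<alpha> * integral {0..1} (\<lambda>t. ln (A + s * t))))"
    unfolding vartheta_transform[OF a A s, symmetric] by (rule nn_integral_eq_integral)
  then show ?thesis by (simp add: mult_ac)
qed

text \<open>Summation by parts: a node is the sum of the increments before it, so increment
  \<open>j\<close> collects the coefficients \<open>l i\<close> with \<open>i > j\<close>, which is
  \<open>tail_sum\<close>. The constant 1 is the sum of all increments.\<close>

lemma linear_form_nodes:
  "1 + (\<Sum>i=1..k. l i * (node k y (i - 1) + incr k y i * z i)) =
    (\<Sum>i=1..k. (1 + tail_sum k l i + l i * z i) * incr k y i)"
proof -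
  have "(\<Sum>i=1..k. l i * node k y (i - 1)) = (\<Sum>i=1..k. \<Sum>j=1..k. l i * (of_bool (j \<le> i - 1) * incr k y j))"
  proof (intro sum.cong refl)
    fix i assume "i \<in> {1..k}"
    then have "i - 1 \<le> k" by auto
    then show "l i * node k y (i - 1) = (\<Sum>j=1..k. l i * (of_bool (j \<le> i - 1) * incr k y j))"
      by (simp only: node_eq_sum_incr[OF _ k] sum_distrib_left)
  qed
  also have "\<dots> = (\<Sum>j=1..k. (\<Sum>i=1..k. l i * of_bool (j \<le> i - 1)) * incr k y j)"
    by (subst sum.swap) (simp only: sum_distrib_right mult.assoc)
  also have "\<dots> = (\<Sum>j=1..k. tail_sum k l j * incr k y j)"
  proof (intro sum.cong refl arg_cong2[where f="(*)"])
    fix j assume "j \<in> {1..k}"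
    show "(\<Sum>i=1..k. l i * of_bool (j \<le> i - 1)) = tail_sum k l j"
      unfolding tail_sum_def by (rule sum.mono_neutral_cong_right) auto
  qed
  finally have "(\<Sum>i=1..k. l i * node k y (i - 1)) = (\<Sum>j=1..k. tail_sum k l j * incr k y j)" .
  then show ?thesis using sum_incr[OF k, of y]
    by (simp add: distrib_left distrib_right sum.distrib mult_ac)
qed

text \<open>For fixed nodes, \<open>x i = node k y (i - 1) + incr k y i * z i\<close> turns each
  kernel into \<open>vartheta \<alpha> (z i)\<close> times a Dirichlet factor, normalised by
  \<open>Cst\<close>. If the nodes do not increase strictly, both sides vanish.\<close>

lemma bridge_fiber_transform:
  assumes l: "\<And>i. i \<in> {1..k} \<Longrightarrow> l i \<ge> 0"
  shows "ennreal Cst * (\<integral>\<^sup>+x. ennreal ((1 + (\<Sum>i=1..k. l i * x i)) powr (- (real k * \<alpha>))) * ennreal (bridge x y) \<partial>leb k) =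
    (\<integral>\<^sup>+z. ennreal (\<Prod>i=1..k. indicator {0<..<1} (z i) * vartheta \<alpha> (z i)) *
      ennreal (dirichlet_density k (\<lambda>_. \<alpha>) y * (\<Sum>i=1..k. (1 + tail_sum k l i + l i * z i) * incr k y i) powr (- (real k * \<alpha>))) \<partial>leb k)"
proof (cases "\<forall>i\<in>{1..k}. incr k y i > 0")
  case False
  then obtain i where i: "i \<in> {1..k}" "\<not> incr k y i > 0" by blast
  have "bridge x y = 0" for x
  proof (rule ccontr)
    assume "bridge x y \<noteq> 0"
    then have "node k y (i - 1) < x i \<and> x i < node k y i" using i bridge_nonzero by blast
    then show False using i by (simp add: incr_def)
  qed
  moreover have "dirichlet_density k (\<lambda>_. \<alpha>) y = 0"
  proof -
    have "(\<Prod>i=1..k. indicator {0<..} (incr k y i) * incr k y i powr (\<alpha> - 1)) = 0"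
      using i by (intro prod_zero bexI[of _ i]) auto
    then show ?thesis unfolding dirichlet_density_def by simp
  qed
  ultimately show ?thesis by simp
next
  case True
  let ?\<phi> = "\<lambda>x. (1 + (\<Sum>i=1..k. l i * x i)) powr (- (real k * \<alpha>))"
  let ?t = "\<lambda>i. node k y (i - 1)" and ?d = "incr k y"
  let ?V = "\<lambda>z. \<Prod>i=1..k. indicator {0<..<1} (z i) * vartheta \<alpha> (z i)"
  let ?L = "\<lambda>z. (\<Sum>i=1..k. (1 + tail_sum k l i + l i * z i) * incr k y i) powr (- (real k * \<alpha>))"
  have bm: "(\<lambda>x. bridge x y) \<in> borel_measurable (leb k)"
    unfolding bridge_def[abs_def] measurable_leb_cong
    by (intro borel_measurable_prod kern_measurable borel_measurable_const measurable_component_singleton) auto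
  have \<phi>m: "?\<phi> \<in> borel_measurable (leb k)"
    unfolding measurable_leb_cong
    by (intro powr_real_measurable borel_measurable_add borel_measurable_sum borel_measurable_times borel_measurable_const measurable_component_singleton) auto
  have m: "(\<lambda>x. ennreal (?\<phi> x) * ennreal (bridge x y)) \<in> borel_measurable (leb k)"
    using bm \<phi>m by (intro borel_measurable_times_ennreal measurable_compose[OF _ measurable_ennreal])
  have am: "(\<lambda>z. \<lambda>i\<in>{1..k}. ?t i + ?d i * z i) \<in> measurable (leb k) (leb k)"
    unfolding leb_def by (rule measurable_restrict) auto
  have pd: "(\<Prod>i=1..k. ?d i) > 0" using True by (intro prod_pos) auto
  have dd: "dirichlet_density k (\<lambda>_. \<alpha>) y = Cst * (\<Prod>i=1..k. ?d i powr (\<alpha> - 1))"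
    unfolding dirichlet_density_def Cst_def using True by (auto intro!: prod.cong)
  have pt: "Cst * ((\<Prod>i=1..k. ?d i) * (?\<phi> (\<lambda>i\<in>{1..k}. ?t i + ?d i * z i) * bridge (\<lambda>i\<in>{1..k}. ?t i + ?d i * z i) y)) =
     ?V z * (dirichlet_density k (\<lambda>_. \<alpha>) y * ?L z)" for z
  proof -
    have 1: "?\<phi> (\<lambda>i\<in>{1..k}. ?t i + ?d i * z i) = ?L z"
      by (subst linear_form_nodes[symmetric]) simp
    have "(\<Prod>i=1..k. ?d i) * bridge (\<lambda>i\<in>{1..k}. ?t i + ?d i * z i) y =
      (\<Prod>i=1..k. ?d i * kern (?t i) (?t i + ?d i * z i) (node k y i))"
      unfolding bridge_def prod.distrib by (auto intro!: prod.cong)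
    also have "\<dots> = (\<Prod>i=1..k. indicator {0<..<1} (z i) * vartheta \<alpha> (z i) * ?d i powr (\<alpha> - 1))"
    proof (rule prod.cong[OF refl])
      fix i assume "i \<in> {1..k}"
      then have d: "?d i > 0" using True by blast
      have "node k y i = ?t i + ?d i" by (simp add: incr_def)
      then show "?d i * kern (?t i) (?t i + ?d i * z i) (node k y i) = indicator {0<..<1} (z i) * vartheta \<alpha> (z i) * ?d i powr (\<alpha> - 1)"
        using kern_affine[OF d, of "?t i" "z i"] by simp
    qed
    also have "\<dots> = ?V z * (\<Prod>i=1..k. ?d i powr (\<alpha> - 1))" by (simp add: prod.distrib)
    finally have 2: "(\<Prod>i=1..k. ?d i) * bridge (\<lambda>i\<in>{1..k}. ?t i + ?d i * z i) y = ?V z * (\<Prod>i=1..k. ?d i powr (\<alpha> - 1))" .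
    have "Cst * ((\<Prod>i=1..k. ?d i) * (?L z * bridge (\<lambda>i\<in>{1..k}. ?t i + ?d i * z i) y)) =
      Cst * ?L z * ((\<Prod>i=1..k. ?d i) * bridge (\<lambda>i\<in>{1..k}. ?t i + ?d i * z i) y)"
      by (simp only: mult_ac)
    also have "\<dots> = ?V z * (Cst * (\<Prod>i=1..k. ?d i powr (\<alpha> - 1)) * ?L z)"
      unfolding 2 by (simp only: mult_ac)
    finally show ?thesis unfolding 1 dd .
  qed
  have V0: "?V z \<ge> 0" for z
    using vartheta_pos[OF a] by (intro prod_nonneg) (auto simp: indicator_def less_imp_le)
  have "(\<integral>\<^sup>+x. ennreal (?\<phi> x) * ennreal (bridge x y) \<partial>leb k) = ennreal (\<Prod>i=1..k. ?d i) *
    (\<integral>\<^sup>+z. ennreal (?\<phi> (\<lambda>i\<in>{1..k}. ?t i + ?d i * z i)) * ennreal (bridge (\<lambda>i\<in>{1..k}. ?t i + ?d i * z i) y) \<partial>leb k)"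
    by (rule nn_integral_leb_affine[OF _ m]) (use True in auto)
  then have "ennreal Cst * (\<integral>\<^sup>+x. ennreal (?\<phi> x) * ennreal (bridge x y) \<partial>leb k) =
    (ennreal Cst * ennreal (\<Prod>i=1..k. ?d i)) *
    (\<integral>\<^sup>+z. ennreal (?\<phi> (\<lambda>i\<in>{1..k}. ?t i + ?d i * z i)) * ennreal (bridge (\<lambda>i\<in>{1..k}. ?t i + ?d i * z i) y) \<partial>leb k)"
    by (simp only: mult.assoc)
  also have "\<dots> = (\<integral>\<^sup>+z. (ennreal Cst * ennreal (\<Prod>i=1..k. ?d i)) *
     (ennreal (?\<phi> (\<lambda>i\<in>{1..k}. ?t i + ?d i * z i)) * ennreal (bridge (\<lambda>i\<in>{1..k}. ?t i + ?d i * z i) y)) \<partial>leb k)"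
    by (rule nn_integral_cmult[symmetric]) (rule measurable_compose[OF am m])
  also have "\<dots> = (\<integral>\<^sup>+z. ennreal (?V z) * ennreal (dirichlet_density k (\<lambda>_. \<alpha>) y * ?L z) \<partial>leb k)"
  proof (rule nn_integral_cong)
    fix z
    have "(ennreal Cst * ennreal (\<Prod>i=1..k. ?d i)) *
     (ennreal (?\<phi> (\<lambda>i\<in>{1..k}. ?t i + ?d i * z i)) * ennreal (bridge (\<lambda>i\<in>{1..k}. ?t i + ?d i * z i) y)) =
      ennreal (Cst * ((\<Prod>i=1..k. ?d i) * (?\<phi> (\<lambda>i\<in>{1..k}. ?t i + ?d i * z i) * bridge (\<lambda>i\<in>{1..k}. ?t i + ?d i * z i) y)))"
      using Cst_pos pd by (simp add: ennreal_mult' mult.assoc)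
    also have "\<dots> = ennreal (?V z) * ennreal (dirichlet_density k (\<lambda>_. \<alpha>) y * ?L z)"
      unfolding pt using V0 by (simp add: ennreal_mult')
    finally show "(ennreal Cst * ennreal (\<Prod>i=1..k. ?d i)) *
     (ennreal (?\<phi> (\<lambda>i\<in>{1..k}. ?t i + ?d i * z i)) * ennreal (bridge (\<lambda>i\<in>{1..k}. ?t i + ?d i * z i) y)) =
       ennreal (?V z) * ennreal (dirichlet_density k (\<lambda>_. \<alpha>) y * ?L z)" .
  qed
  finally show ?thesis .
qed

text \<open>Tonelli twice: \<open>x\<close> is replaced by \<open>z\<close> on each fibre, then
  \<open>y\<close> is integrated before \<open>z\<close>. The exponent \<open>k * \<alpha>\<close>
  is the total Dirichlet mass, so Markov-Krein leaves a product of powers \<open>- \<alpha>\<close>,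
  and the \<open>z i\<close> separate into transforms of \<open>vartheta \<alpha>\<close>.\<close>

lemma density_transform:
  assumes l: "\<And>i. i \<in> {1..k} \<Longrightarrow> l i \<ge> 0"
  shows "(\<integral>\<^sup>+x. ennreal (Cst * I x) * ennreal ((1 + (\<Sum>i=1..k. l i * x i)) powr (- (real k * \<alpha>))) \<partial>leb k) =
    ennreal (transform_value k \<alpha> l)"
proof -
  let ?\<phi> = "\<lambda>x. (1 + (\<Sum>i=1..k. l i * x i)) powr (- (real k * \<alpha>))"
  let ?V = "\<lambda>z. \<Prod>i=1..k. indicator {0<..<1} (z i) * vartheta \<alpha> (z i)"
  let ?c = "\<lambda>z i. 1 + tail_sum k l i + l i * z i"
  let ?D = "\<lambda>z y. dirichlet_density k (\<lambda>_. \<alpha>) y * (\<Sum>i=1..k. ?c z i * incr k y i) powr (- (real k * \<alpha>))"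
  interpret P: pair_sigma_finite "leb k" "leb (k - 1)"
    by (intro pair_sigma_finite.intro sigma_finite_leb)
  have \<phi>m: "?\<phi> \<in> borel_measurable (leb k)"
    unfolding measurable_leb_cong
    by (intro powr_real_measurable borel_measurable_add borel_measurable_sum borel_measurable_times borel_measurable_const measurable_component_singleton) auto
  \<comment> \<open>A Bochner integral is 0 by default for non-integrable functions, so
    \<open>I\<close> must be tied to the nonnegative integral: on \<open>Sigma_k\<close> by
    integrability, off it because \<open>bridge\<close> vanishes.\<close>
  have nnI: "ennreal (I x) = (\<integral>\<^sup>+y. ennreal (bridge x y) \<partial>leb (k - 1))" if x: "x \<in> space (leb k)" for x
  proof (cases "x \<in> Sigma_k k")
    case True
    then have "\<forall>i\<in>{0..k}. gap x i > 0" by (simp add: Sigma_k_iff)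
    then show ?thesis unfolding I_def using bridge_nonneg I_sub(1) by (subst nn_integral_eq_integral) auto
  next
    case False
    then show ?thesis using bridge_outside[OF x] by (simp add: I_def)
  qed
  have I0: "I x \<ge> 0" for x unfolding I_def using bridge_nonneg by (intro Bochner_Integration.integral_nonneg) auto
  have fst_m: "(\<lambda>w. fst w i) \<in> borel_measurable (leb k \<Otimes>\<^sub>M leb (k - 1))" if "i \<in> {1..k}" for i
    by (rule measurable_compose[OF measurable_fst]) (use that in \<open>simp add: measurable_component_singleton\<close>)
  have snd_m: "(\<lambda>w. incr k (snd w) i) \<in> borel_measurable (leb k \<Otimes>\<^sub>M leb (k - 1))" if "i \<in> {1..k}" for i
    by (rule measurable_compose[OF measurable_snd]) (use that incr_measurable[of i k] in simp)
  have vm: "(\<lambda>z. indicator {0<..<1} z * vartheta \<alpha> z) \<in> borel_measurable borel" by (rule vartheta_measurable[OF a])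
  have m1: "(\<lambda>(x, y). ennreal (?\<phi> x) * ennreal (bridge x y)) \<in> borel_measurable (leb k \<Otimes>\<^sub>M leb (k - 1))"
    unfolding split_beta'
    by (intro borel_measurable_times_ennreal measurable_compose[OF _ measurable_ennreal] measurable_compose[OF measurable_fst \<phi>m]
        bridge_measurable_pair[unfolded split_beta'])
  have m2: "(\<lambda>(z, y). ennreal (?V z) * ennreal (?D z y)) \<in> borel_measurable (leb k \<Otimes>\<^sub>M leb (k - 1))"
    unfolding split_beta' dirichlet_density_def
    by (intro borel_measurable_times_ennreal measurable_compose[OF _ measurable_ennreal] borel_measurable_times borel_measurable_prod
        powr_real_measurable borel_measurable_sum borel_measurable_add borel_measurable_const fst_m snd_m
        measurable_compose[OF fst_m vm] measurable_compose[OF snd_m borel_measurable_indicator] borel_measurable_diff) auto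
  have Dm: "(\<lambda>y. ennreal (?D z y)) \<in> borel_measurable (leb (k - 1))" for z
    unfolding dirichlet_density_def measurable_leb_cong
    by (intro measurable_compose[OF _ measurable_ennreal] borel_measurable_times borel_measurable_prod
        powr_real_measurable borel_measurable_sum borel_measurable_const incr_measurable
        measurable_compose[OF incr_measurable borel_measurable_indicator]) auto
  have "(\<integral>\<^sup>+x. ennreal (Cst * I x) * ennreal (?\<phi> x) \<partial>leb k) =
     (\<integral>\<^sup>+x. ennreal Cst * (\<integral>\<^sup>+y. ennreal (?\<phi> x) * ennreal (bridge x y) \<partial>leb (k - 1)) \<partial>leb k)"
  proof (rule nn_integral_cong)
    fix x assume x: "x \<in> space (leb k)"
    have "(\<integral>\<^sup>+y. ennreal (?\<phi> x) * ennreal (bridge x y) \<partial>leb (k - 1)) = ennreal (?\<phi> x) * ennreal (I x)"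
      unfolding nnI[OF x] by (rule nn_integral_cmult[OF measurable_compose[OF bridge_measurable measurable_ennreal]])
    then show "ennreal (Cst * I x) * ennreal (?\<phi> x) = ennreal Cst * (\<integral>\<^sup>+y. ennreal (?\<phi> x) * ennreal (bridge x y) \<partial>leb (k - 1))"
      using Cst_pos I0[of x] by (simp add: ennreal_mult' mult_ac)
  qed
  also have "\<dots> = ennreal Cst * (\<integral>\<^sup>+x. (\<integral>\<^sup>+y. ennreal (?\<phi> x) * ennreal (bridge x y) \<partial>leb (k - 1)) \<partial>leb k)"
    by (rule nn_integral_cmult) (use sigma_finite_measure.borel_measurable_nn_integral[OF sigma_finite_leb m1] in simp)
  also have "(\<integral>\<^sup>+x. (\<integral>\<^sup>+y. ennreal (?\<phi> x) * ennreal (bridge x y) \<partial>leb (k - 1)) \<partial>leb k) =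
     (\<integral>\<^sup>+y. (\<integral>\<^sup>+x. ennreal (?\<phi> x) * ennreal (bridge x y) \<partial>leb k) \<partial>leb (k - 1))"
    by (rule P.Fubini'[OF m1, symmetric])
  also have "ennreal Cst * \<dots> = (\<integral>\<^sup>+y. ennreal Cst * (\<integral>\<^sup>+x. ennreal (?\<phi> x) * ennreal (bridge x y) \<partial>leb k) \<partial>leb (k - 1))"
  proof (rule nn_integral_cmult[symmetric])
    have "(\<lambda>(y, x). ennreal (?\<phi> x) * ennreal (bridge x y)) \<in> borel_measurable (leb (k - 1) \<Otimes>\<^sub>M leb k)"
      using measurable_compose[OF measurable_pair_swap' m1] by (simp add: split_beta')
    from sigma_finite_measure.borel_measurable_nn_integral[OF sigma_finite_leb this]
    show "(\<lambda>y. \<integral>\<^sup>+x. ennreal (?\<phi> x) * ennreal (bridge x y) \<partial>leb k) \<in> borel_measurable (leb (k - 1))" .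
  qed
  also have "\<dots> = (\<integral>\<^sup>+y. (\<integral>\<^sup>+z. ennreal (?V z) * ennreal (?D z y) \<partial>leb k) \<partial>leb (k - 1))"
    by (intro nn_integral_cong bridge_fiber_transform l)
  also have "\<dots> = (\<integral>\<^sup>+z. (\<integral>\<^sup>+y. ennreal (?V z) * ennreal (?D z y) \<partial>leb (k - 1)) \<partial>leb k)"
    by (rule P.Fubini'[OF m2])
  also have "\<dots> = (\<integral>\<^sup>+z. (\<Prod>i=1..k. ennreal (indicator {0<..<1} (z i) * vartheta \<alpha> (z i) * ?c z i powr (- \<alpha>))) \<partial>leb k)"
  proof (rule nn_integral_cong)
    fix z :: "nat \<Rightarrow> real"
    have v0: "0 \<le> indicator {0<..<1} (z i) * vartheta \<alpha> (z i)" for i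
      using vartheta_pos[OF a] by (auto simp: indicator_def less_imp_le)
    have V0: "?V z \<ge> 0" by (intro prod_nonneg v0)
    have "(\<integral>\<^sup>+y. ennreal (?V z) * ennreal (?D z y) \<partial>leb (k - 1)) = ennreal (?V z) * (\<integral>\<^sup>+y. ennreal (?D z y) \<partial>leb (k - 1))"
      by (rule nn_integral_cmult[OF Dm])
    also have "\<dots> = ennreal (?V z * (\<Prod>i=1..k. ?c z i powr (- \<alpha>)))"
    \<comment> \<open>Positivity of the coefficients, needed for Markov-Krein, is available for
      \<open>z\<close> in the cube; elsewhere \<open>?V z\<close> is 0.\<close>
    proof (cases "\<forall>i\<in>{1..k}. z i \<in> {0<..<1}")
      case True
      have "?c z i > 0" if "i \<in> {1..k}" for i
        using tail_sum_nonneg[where l=l and k=k and i=i] l True that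
        by (intro add_pos_nonneg mult_nonneg_nonneg) (auto simp: less_imp_le)
      from dirichlet_markov_krein[OF k a(1) this]
      have "(\<integral>\<^sup>+y. ennreal (?D z y) \<partial>leb (k - 1)) = ennreal (\<Prod>i=1..k. ?c z i powr (- \<alpha>))" by simp
      then show ?thesis using V0 by (simp add: ennreal_mult')
    next
      case False
      then obtain i where "i \<in> {1..k}" "z i \<notin> {0<..<1}" by blast
      then have "?V z = 0" by (intro prod_zero bexI[of _ i]) auto
      then show ?thesis by (simp only: ennreal_0 mult_zero_left)
    qed
    also have "?V z * (\<Prod>i=1..k. ?c z i powr (- \<alpha>)) = (\<Prod>i=1..k. indicator {0<..<1} (z i) * vartheta \<alpha> (z i) * ?c z i powr (- \<alpha>))"
      by (simp only: prod.distrib)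
    also have "ennreal \<dots> = (\<Prod>i=1..k. ennreal (indicator {0<..<1} (z i) * vartheta \<alpha> (z i) * ?c z i powr (- \<alpha>)))"
      by (rule prod_ennreal[symmetric]) (intro mult_nonneg_nonneg v0, simp)
    finally show "(\<integral>\<^sup>+y. ennreal (?V z) * ennreal (?D z y) \<partial>leb (k - 1)) =
       (\<Prod>i=1..k. ennreal (indicator {0<..<1} (z i) * vartheta \<alpha> (z i) * ?c z i powr (- \<alpha>)))" .
  qed
  also have "\<dots> = (\<Prod>i=1..k. \<integral>\<^sup>+u. ennreal (indicator {0<..<1} u * vartheta \<alpha> u * (1 + tail_sum k l i + l i * u) powr (- \<alpha>)) \<partial>lborel)"
    unfolding leb_def
  proof (rule lb.product_nn_integral_prod)
    fix i :: nat
    have "(\<lambda>u. indicator {0<..<1} u * vartheta \<alpha> u * (1 + tail_sum k l i + l i * u) powr (- \<alpha>)) \<in> borel_measurable borel"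
      by (intro borel_measurable_times[OF vm]) measurable
    then show "(\<lambda>u. ennreal (indicator {0<..<1} u * vartheta \<alpha> u * (1 + tail_sum k l i + l i * u) powr (- \<alpha>))) \<in> borel_measurable lborel"
      by simp
  qed simp
  also have "\<dots> = (\<Prod>i=1..k. ennreal (exp (- \<alpha> * integral {0..1} (\<lambda>t. ln (1 + tail_sum k l i + l i * t)))))"
  proof (rule prod.cong[OF refl])
    fix i assume i: "i \<in> {1..k}"
    have "1 + tail_sum k l i > 0" using tail_sum_nonneg[where l=l and k=k and i=i] l by (intro add_pos_nonneg) auto
    from vartheta_transform_nn[OF this l[OF i]]
    show "(\<integral>\<^sup>+u. ennreal (indicator {0<..<1} u * vartheta \<alpha> u * (1 + tail_sum k l i + l i * u) powr (- \<alpha>)) \<partial>lborel) =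
      ennreal (exp (- \<alpha> * integral {0..1} (\<lambda>t. ln (1 + tail_sum k l i + l i * t))))" .
  qed
  also have "\<dots> = ennreal (transform_value k \<alpha> l)"
    unfolding transform_value_def by (rule prod_ennreal) simp
  finally show ?thesis .
qed

lemma density_facts:
  defines "N \<equiv> density (leb k) (\<lambda>x. ennreal (Cst * I x))"
  shows "finite_measure N" "sets N = sets (PiM {1..k} (\<lambda>_. borel))"
    "AE x in N. \<forall>i\<in>{1..k}. x i \<in> {0..1}"
    "\<And>l. (\<And>i. i \<in> {1..k} \<Longrightarrow> l i \<ge> 0) \<Longrightarrow>
      (\<integral>x. (1 + (\<Sum>i\<in>{1..k}. l i * x i)) powr (- (real k * \<alpha>)) \<partial>N) = transform_value k \<alpha> l"
proof -
  have dm: "(\<lambda>x. ennreal (Cst * I x)) \<in> borel_measurable (leb k)"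
    by (intro measurable_compose[OF _ measurable_ennreal] borel_measurable_times I_measurable borel_measurable_const)
  show "sets N = sets (PiM {1..k} (\<lambda>_. borel))" unfolding N_def by (simp add: sets_leb)
  have nn: "(\<integral>\<^sup>+x. ennreal ((1 + (\<Sum>i=1..k. l i * x i)) powr (- (real k * \<alpha>))) \<partial>N) = ennreal (transform_value k \<alpha> l)"
    if l: "\<And>i. i \<in> {1..k} \<Longrightarrow> l i \<ge> 0" for l
  proof -
    have "(\<lambda>x. ennreal ((1 + (\<Sum>i=1..k. l i * x i)) powr (- (real k * \<alpha>)))) \<in> borel_measurable (leb k)"
      unfolding measurable_leb_cong
      by (intro measurable_compose[OF _ measurable_ennreal] powr_real_measurable borel_measurable_add borel_measurable_sum borel_measurable_times borel_measurable_const measurable_component_singleton) auto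
    from trans[OF nn_integral_density[OF dm this] density_transform[of l]] l show ?thesis
      unfolding N_def by blast
  qed
  \<comment> \<open>The transform at \<open>l = 0\<close> is the total mass.\<close>
  have "emeasure N (space N) = ennreal (transform_value k \<alpha> (\<lambda>_. 0))"
    using nn[of "\<lambda>_. 0"] by simp
  then show "finite_measure N" by (intro finite_measureI) simp
  show "AE x in N. \<forall>i\<in>{1..k}. x i \<in> {0..1}"
    unfolding N_def
  proof (subst AE_density[OF dm], intro AE_I2 impI)
    fix x assume x: "x \<in> space (leb k)" and p: "0 < ennreal (Cst * I x)"
    \<comment> \<open>A positive \<open>I x\<close> forces some interlacing \<open>y\<close>; its
      nodes lie in [0, 1] and enclose the coordinates of \<open>x\<close>.\<close>
    have "\<exists>y. bridge x y \<noteq> 0"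
    proof (rule ccontr)
      assume "\<not> (\<exists>y. bridge x y \<noteq> 0)"
      then have "I x = 0" by (simp add: I_def)
      then show False using p by simp
    qed
    then obtain y where y: "\<forall>i\<in>{1..k}. node k y (i - 1) < x i \<and> x i < node k y i" by (auto simp: bridge_nonzero)
    have incr0: "incr k y i \<ge> 0" if "i \<in> {1..k}" for i using bspec[OF y that] by (simp add: incr_def)
    have n01: "0 \<le> node k y i" "node k y i \<le> 1" if i: "i \<le> k" for i
    proof -
      show "0 \<le> node k y i" unfolding node_eq_sum_incr[OF i k] using incr0 by (intro sum_nonneg mult_nonneg_nonneg) auto
      have "node k y i \<le> (\<Sum>j=1..k. incr k y j)"
        unfolding node_eq_sum_incr[OF i k] using incr0 by (intro sum_mono) auto
      then show "node k y i \<le> 1" using sum_incr[OF k] by simp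
    qed
    show "\<forall>i\<in>{1..k}. x i \<in> {0..1}"
    proof
      fix i assume i: "i \<in> {1..k}"
      then have "i - 1 \<le> k" "i \<le> k" by auto
      then show "x i \<in> {0..1}" using bspec[OF y i] n01(1)[of "i - 1"] n01(2)[of i] by auto
    qed
  qed
  show "(\<integral>x. (1 + (\<Sum>i\<in>{1..k}. l i * x i)) powr (- (real k * \<alpha>)) \<partial>N) = transform_value k \<alpha> l"
    if l: "\<And>i. i \<in> {1..k} \<Longrightarrow> l i \<ge> 0" for l
  proof -
    have t0: "transform_value k \<alpha> l \<ge> 0" unfolding transform_value_def by (intro prod_nonneg) auto
    have "(\<lambda>x. (1 + (\<Sum>i=1..k. l i * x i)) powr (- (real k * \<alpha>))) \<in> borel_measurable (leb k)"
      unfolding measurable_leb_cong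
      by (intro powr_real_measurable borel_measurable_add borel_measurable_sum borel_measurable_times borel_measurable_const measurable_component_singleton) auto
    then have "(\<lambda>x. (1 + (\<Sum>i=1..k. l i * x i)) powr (- (real k * \<alpha>))) \<in> borel_measurable N"
      unfolding N_def by simp
    then have "(\<integral>x. (1 + (\<Sum>i\<in>{1..k}. l i * x i)) powr (- (real k * \<alpha>)) \<partial>N) =
      enn2real (\<integral>\<^sup>+x. ennreal ((1 + (\<Sum>i=1..k. l i * x i)) powr (- (real k * \<alpha>))) \<partial>N)"
      by (intro integral_eq_nn_integral) auto
    also have "\<dots> = enn2real (ennreal (transform_value k \<alpha> l))" using nn[of l] l by simp
    also have "\<dots> = transform_value k \<alpha> l" using t0 by simp
    finally show ?thesis .
  qed
qed

end

theorem theorem4p1: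
  fixes \<beta> :: real and k :: nat and Q :: "(real \<Rightarrow> real) measure"
  assumes "\<beta> > 0" and "real k \<ge> \<beta>"
    and "is_dirichlet_ferguson \<beta> Q"
  shows "absolutely_continuous (leb k) (m_beta Q k) \<and>
    (\<exists>\<rho> :: (nat \<Rightarrow> real) \<Rightarrow> real.
        m_beta Q k = density (leb k) (\<lambda>x. ennreal (\<rho> x)) \<and>
        (\<forall>x\<in>Sigma_k k. \<rho> x > 0) \<and> continuous_on (Sigma_k k) \<rho> \<and>
        (\<forall>x\<in>space (leb k) - Sigma_k k. \<rho> x = 0) \<and>
        (\<forall>x\<in>Sigma_k k. \<rho> x = rho_formula \<beta> k x))"
proof -
  have k: "k \<ge> 1" using assms(1,2) by (cases k) auto
  define \<alpha> where "\<alpha> = \<beta> / real k"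
  have a: "0 < \<alpha>" "\<alpha> \<le> 1" using assms(1,2) k by (auto simp: \<alpha>_def)
  have \<beta>: "\<beta> = real k * \<alpha>" using k by (simp add: \<alpha>_def)
  interpret D: dirichlet_ferguson \<beta> Q k by standard (use assms k in auto)
  interpret B: bridge_density \<alpha> k by standard (use a k in auto)
  let ?\<rho> = "\<lambda>x. B.Cst * B.I x"
  have eq: "m_beta Q k = density (leb k) (\<lambda>x. ennreal (?\<rho> x))"
  proof (rule measure_eqI_markov_krein[where I="{1..k}" and b=\<beta>])
    fix l :: "nat \<Rightarrow> real" assume l: "\<And>i. i \<in> {1..k} \<Longrightarrow> l i \<ge> 0"
    show "(\<integral>x. (1 + (\<Sum>i\<in>{1..k}. l i * x i)) powr (- \<beta>) \<partial>m_beta Q k) =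
      (\<integral>x. (1 + (\<Sum>i\<in>{1..k}. l i * x i)) powr (- \<beta>) \<partial>density (leb k) (\<lambda>x. ennreal (?\<rho> x)))"
      using D.m_beta_transform[of l] B.density_facts(4)[of l] l by (simp flip: \<beta> \<alpha>_def)
  qed (use D.m_beta_facts B.density_facts(1,2,3) assms(1) in auto)
  have dm: "(\<lambda>x. ennreal (?\<rho> x)) \<in> borel_measurable (leb k)"
    by (intro measurable_compose[OF _ measurable_ennreal] borel_measurable_times B.I_measurable borel_measurable_const)
  have "absolutely_continuous (leb k) (m_beta Q k)"
    unfolding eq by (rule absolutely_continuousI_density[OF dm])
  moreover have "\<forall>x\<in>Sigma_k k. ?\<rho> x > 0"
    using B.I_pos B.Cst_pos B.Sigma_k_iff by auto
  moreover have "continuous_on (Sigma_k k) ?\<rho>"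
    by (intro continuous_intros B.I_continuous)
  moreover have "\<forall>x\<in>space (leb k) - Sigma_k k. ?\<rho> x = 0"
    using B.bridge_outside by (simp add: B.I_def)
  moreover have "\<forall>x\<in>Sigma_k k. ?\<rho> x = rho_formula \<beta> k x"
    using B.rho_formula_eq unfolding \<beta> by simp
  ultimately show ?thesis using eq by (intro conjI exI[of _ ?\<rho>])
qed

end
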